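(* Let $\chi<0$ and let $X$ be a locally compact, complete, geodesic metric space which has curvature less than or equal to $\chi$. If a geodesic or geodesic ray $\gamma$ in $X$ is recurrent, then $\gamma$ is approximated by closed geodesics.
   Context: All curves are parametrized by arclength; $d$ denotes the metric of $X$. A geodesic metric space $X$ has curvature less than or equal to $\chi$ ($\chi<0$) if each $x\in X$ has a neighborhood $V_x$ such that every geodesic triangle contained in $V_x$ satisfies the $CAT(\chi)$ comparison inequality. A geodesic segment is an isometric embedding of a closed interval into $X$. A local geodesic is a map $c:I\to X$ from an interval $I\subseteq\mathbb{R}$ such that for each $t\in I$ there is $\varepsilon>0$ for which $c|_{[t-\varepsilon,t+\varepsilon]\cap I}$ is a geodesic segment. In this statement a "geodesic in $X$" is a local geodesic $\mathbb{R}\to X$ (oriented by its parametrization) and a "geodesic ray" is a local geodesic $[0,\infty)\to X$. A closed geodesic is a local geodesic $c:\mathbb{R}\to X$ which is a periodic map, with period $\mathrm{period}(c)>0$. Geodesic flow: for $t\in\mathbb{R}$ (resp. $t\ge 0$ for rays), $t\gamma$ is defined by $(t\gamma)(s)=\gamma(s+t)$. Recurrent: $\gamma$ is recurrent if there is a sequence of real numbers $t_n\to+\infty$ such that $t_n\gamma\to\gamma$ uniformly on compact subsets of the domain of $\gamma$ ($\mathbb{R}$ for a geodesic, $[0,\infty)$ for a ray). Approximated by closed geodesics: $\gamma$ is approximated by closed geodesics if for every $\varepsilon>0$ and every $x\in\mathrm{Im}\,\gamma$ there exists a closed oriented geodesic $c$ such that for some point $y\in\mathrm{Im}\,c$, $$d\big(c(t+t_y),\gamma(t+t_x)\big)<\varepsilon\quad\text{for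 all } t\in[0,\mathrm{period}(c)],$$ where $t_x,t_y$ are parameters with $x=\gamma(t_x)$ and $y=c(t_y)$. *)

theory Defs
  imports "HOL-Analysis.Analysis"
begin

section \<open>Geodesics with respect to a distance function on a carrier\<close>

text \<open>The carrier \<open>M\<close> and the distance \<open>d\<close> are explicit, so that the same notions serve for a
  space given by a type of class \<^class>\<open>metric_space\<close> (with \<open>M = UNIV\<close> and \<open>d = dist\<close>)
  and for the hyperbolic comparison plane below.\<close>

definition isometric_embedding_on ::
    "'b set \<Rightarrow> ('b \<Rightarrow> 'b \<Rightarrow> real) \<Rightarrow> real set \<Rightarrow> (real \<Rightarrow> 'b) \<Rightarrow> bool" where
  "isometric_embedding_on M d S c \<longleftrightarrow>
     c ` S \<subseteq> M \<and> (\<forall>s\<in>S. \<forall>t\<in>S. d (c s) (c t) = \<bar>s - t\<bar>)"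

definition geodesic_segment_between ::
    "'b set \<Rightarrow> ('b \<Rightarrow> 'b \<Rightarrow> real) \<Rightarrow> 'b \<Rightarrow> 'b \<Rightarrow> (real \<Rightarrow> 'b) \<Rightarrow> bool" where
  "geodesic_segment_between M d x y c \<longleftrightarrow>
     isometric_embedding_on M d {0..d x y} c \<and> c 0 = x \<and> c (d x y) = y"

text \<open>A triangle consists of vertices \<open>v 0, v 1, v 2\<close> together with a chosen segment \<open>c i\<close>
  from \<open>v i\<close> to its cyclic successor, for each \<open>i < 3\<close>.\<close>

definition side_length :: "('b \<Rightarrow> 'b \<Rightarrow> real) \<Rightarrow> (nat \<Rightarrow> 'b) \<Rightarrow> nat \<Rightarrow> real" where
  "side_length d v i = d (v i) (v (Suc i mod 3))"

definition geodesic_triangle ::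
    "'b set \<Rightarrow> ('b \<Rightarrow> 'b \<Rightarrow> real) \<Rightarrow> (nat \<Rightarrow> 'b) \<Rightarrow> (nat \<Rightarrow> real \<Rightarrow> 'b) \<Rightarrow> bool" where
  "geodesic_triangle M d v c \<longleftrightarrow>
     (\<forall>i<3. geodesic_segment_between M d (v i) (v (Suc i mod 3)) (c i))"

definition geodesic_space :: "'a::metric_space itself \<Rightarrow> bool" where
  "geodesic_space (_ :: 'a itself) \<longleftrightarrow>
     (\<forall>x y :: 'a. \<exists>c. geodesic_segment_between UNIV dist x y c)"


section \<open>The hyperbolic plane of curvature \<open>\<kappa> < 0\<close>\<close>

text \<open>The hyperboloid model: the upper sheet of \<open>\<langle>u, u\<rangle> = -1\<close> for the Lorentz form, with
  \<open>cosh (d u v) = -\<langle>u, v\<rangle>\<close> in curvature \<open>-1\<close>; the metric of curvature \<open>\<kappa>\<close> is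
  obtained by rescaling with \<open>1 / sqrt (-\<kappa>)\<close>.\<close>

definition lorentz_form :: "real ^ 3 \<Rightarrow> real ^ 3 \<Rightarrow> real" where
  "lorentz_form u v = u $ 1 * v $ 1 + u $ 2 * v $ 2 - u $ 3 * v $ 3"

definition hyperbolic_plane :: "(real ^ 3) set" where
  "hyperbolic_plane = {u. lorentz_form u u = -1 \<and> u $ 3 > 0}"

definition hyperbolic_dist :: "real \<Rightarrow> real ^ 3 \<Rightarrow> real ^ 3 \<Rightarrow> real" where
  "hyperbolic_dist \<kappa> u v = arcosh (- lorentz_form u v) / sqrt (- \<kappa>)"


section \<open>Curvature bounded above\<close>

definition comparison_triangle ::
    "real \<Rightarrow> (nat \<Rightarrow> 'a::metric_space) \<Rightarrow>
     (nat \<Rightarrow> real ^ 3) \<Rightarrow> (nat \<Rightarrow> real \<Rightarrow> real ^ 3) \<Rightarrow> bool" where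
  "comparison_triangle \<kappa> v v' c' \<longleftrightarrow>
     geodesic_triangle hyperbolic_plane (hyperbolic_dist \<kappa>) v' c' \<and>
     (\<forall>i<3. side_length (hyperbolic_dist \<kappa>) v' i = side_length dist v i)"

text \<open>Comparison triangles for \<open>\<kappa> < 0\<close> exist and are unique up to isometry, so it does not matter
  which one is used. The comparison point of \<open>c i s\<close> is \<open>c' i s\<close>, as both sides are
  parametrized by arclength.\<close>

definition CAT_inequality ::
    "real \<Rightarrow> (nat \<Rightarrow> 'a::metric_space) \<Rightarrow> (nat \<Rightarrow> real \<Rightarrow> 'a) \<Rightarrow> bool" where
  "CAT_inequality \<kappa> v c \<longleftrightarrow>
     (\<exists>v' c'. comparison_triangle \<kappa> v v' c' \<and>
        (\<forall>i<3. \<forall>j<3. \<forall>s\<in>{0..side_length dist v i}. \<forall>t\<in>{0..side_length dist v j}.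
           dist (c i s) (c j t) \<le> hyperbolic_dist \<kappa> (c' i s) (c' j t)))"

definition curvature_le :: "'a::metric_space itself \<Rightarrow> real \<Rightarrow> bool" where
  "curvature_le (_ :: 'a itself) \<kappa> \<longleftrightarrow>
     (\<forall>x::'a. \<exists>V. x \<in> interior V \<and>
        (\<forall>v c. geodesic_triangle UNIV dist v c \<and>
               (\<forall>i<3. c i ` {0..side_length dist v i} \<subseteq> V)
             \<longrightarrow> CAT_inequality \<kappa> v c))"


section \<open>Local geodesics, recurrence and closed geodesics\<close>

text \<open>A map defined on an interval \<open>I\<close> is represented by a function on all of \<open>real\<close> of which only
  the values on \<open>I\<close> are relevant: \<open>I = UNIV\<close> for geodesics and \<open>I = {0..}\<close> for
  geodesic rays.\<close>

definition local_geodesic_on :: "real set \<Rightarrow> (real \<Rightarrow> 'a::metric_space) \<Rightarrow> bool" where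
  "local_geodesic_on I c \<longleftrightarrow>
     (\<forall>t\<in>I. \<exists>\<epsilon>>0. isometric_embedding_on UNIV dist ({t-\<epsilon>..t+\<epsilon>} \<inter> I) c)"

definition geodesic_flow :: "real \<Rightarrow> (real \<Rightarrow> 'a) \<Rightarrow> real \<Rightarrow> 'a" where
  "geodesic_flow t \<gamma> = (\<lambda>s. \<gamma> (s + t))"

text \<open>The condition \<open>\<tau> n \<in> I\<close> is void for geodesics and says \<open>\<tau> n \<ge> 0\<close> for rays, for which
  the flow is defined in nonnegative time only.\<close>

definition recurrent_on :: "real set \<Rightarrow> (real \<Rightarrow> 'a::metric_space) \<Rightarrow> bool" where
  "recurrent_on I \<gamma> \<longleftrightarrow>
     (\<exists>\<tau> :: nat \<Rightarrow> real. (\<forall>n. \<tau> n \<in> I) \<and> filterlim \<tau> at_top sequentially \<and>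
        (\<forall>K. compact K \<and> K \<subseteq> I \<longrightarrow>
           uniform_limit K (\<lambda>n. geodesic_flow (\<tau> n) \<gamma>) \<gamma> sequentially))"

definition is_period :: "(real \<Rightarrow> 'a) \<Rightarrow> real \<Rightarrow> bool" where
  "is_period c T \<longleftrightarrow> T > 0 \<and> (\<forall>t. c (t + T) = c t)"

definition closed_geodesic :: "(real \<Rightarrow> 'a::metric_space) \<Rightarrow> bool" where
  "closed_geodesic c \<longleftrightarrow> local_geodesic_on UNIV c \<and> (\<exists>T. is_period c T)"

definition period :: "(real \<Rightarrow> 'a) \<Rightarrow> real" where
  "period c = Inf {T. is_period c T}"

text \<open>For closed geodesics the infimum is attained, so it is the least positive period.\<close>

lemma is_period_period:
  assumes "closed_geodesic c"
  shows "is_period c (period c)"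
proof -
  let ?S = "{T. is_period c T}"
  from assms have "local_geodesic_on UNIV c" and ne: "?S \<noteq> {}"
    by (auto simp: closed_geodesic_def)
  then obtain \<epsilon> where "\<epsilon> > 0" "isometric_embedding_on UNIV dist ({0 - \<epsilon>..0 + \<epsilon>} \<inter> UNIV) c"
    unfolding local_geodesic_on_def by blast
  then have \<epsilon>: "\<epsilon> > 0" "isometric_embedding_on UNIV dist {- \<epsilon>..\<epsilon>} c"
    by simp_all
  have large: "\<epsilon> < T" if "is_period c T" for T
  proof (rule ccontr)
    assume "\<not> \<epsilon> < T"
    then have "0 < T" "T \<le> \<epsilon>" using that by (auto simp: is_period_def)
    then have "dist (c 0) (c T) = \<bar>0 - T\<bar>"
      using \<epsilon> by (simp add: isometric_embedding_on_def)
    moreover have "c (0 + T) = c 0" using that unfolding is_period_def by blast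
    ultimately show False using \<open>0 < T\<close> by simp
  qed
  have bdd: "bdd_below ?S" using large by (intro bdd_belowI[of _ \<epsilon>]) (simp add: less_imp_le)
  show ?thesis
  proof (rule ccontr)
    assume no: "\<not> ?thesis"
    obtain T1 where T1: "is_period c T1" "T1 < period c + \<epsilon>"
      using cInf_lessD[OF ne, of "period c + \<epsilon>"] \<epsilon>(1) by (auto simp: period_def)
    have "period c \<le> T1" using cInf_lower[OF _ bdd, of T1] T1 by (simp add: period_def)
    then have "period c < T1" using no T1 by (cases "period c = T1") auto
    then obtain T2 where T2: "is_period c T2" "T2 < T1"
      using cInf_lessD[OF ne, of T1] by (auto simp: period_def)
    have "period c \<le> T2" using cInf_lower[OF _ bdd, of T2] T2 by (simp add: period_def)
    have "c (t + (T1 - T2)) = c t" for t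
    proof -
      have "c (t + (T1 - T2) + T2) = c (t + (T1 - T2))" "c (t + T1) = c t"
        using T1(1) T2(1) unfolding is_period_def by blast+
      then show ?thesis by simp
    qed
    then have "is_period c (T1 - T2)" using T2 by (simp add: is_period_def)
    from large[OF this] show False using T1 \<open>period c \<le> T2\<close> by simp
  qed
qed

text \<open>The point \<open>x\<close> of the image is taken together with an arbitrary parameter \<open>t\<^sub>x\<close> at which
  \<open>\<gamma>\<close> passes through it, since \<open>\<gamma>\<close> need not be injective.\<close>

definition approximated_by_closed_geodesics ::
    "real set \<Rightarrow> (real \<Rightarrow> 'a::metric_space) \<Rightarrow> bool" where
  "approximated_by_closed_geodesics I \<gamma> \<longleftrightarrow>
     (\<forall>\<epsilon>>0. \<forall>x\<in>\<gamma> ` I. \<forall>t\<^sub>x\<in>I. x = \<gamma> t\<^sub>x \<longrightarrow>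
        (\<exists>c. closed_geodesic c \<and>
           (\<exists>y\<in>range c. \<exists>t\<^sub>y. y = c t\<^sub>y \<and>
              (\<forall>t\<in>{0..period c}. dist (c (t + t\<^sub>y)) (\<gamma> (t + t\<^sub>x)) < \<epsilon>))))"

end

theory Submission
  imports Defs
begin

text \<open>
  Let \<open>g\<close> be the geodesic based at a time \<open>b\<close> close to \<open>t\<^sub>x\<close>, and let \<open>T\<close> be a large return time.
  In the universal cover, the segment of \<open>g\<close> over \<open>{0..T}\<close> joins a point to almost its image under a
  deck transformation, whose axis is the closed geodesic sought. The cover is avoided as follows.
  Distances between local geodesics that are pointwise close are convex functions (a maximum
  principle), so the endpoints of this segment can be moved in a fixed convex ball, and the local
  geodesic follows by continuation; as the ball is simply connected, this gives a local geodesic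
  \<open>sig p q\<close> of length \<open>len p q\<close> depending in a Lipschitz way on \<open>p\<close> and \<open>q\<close>, no matter how small the
  convexity radius is further along \<open>g\<close>.

  Minimize the displacement \<open>len p p\<close> over the points at distance at most \<open>h\<close> from a short piece of \<open>g\<close>
  around \<open>g 0\<close>. A minimizer with distance less than \<open>h\<close> closes up without a corner, since a corner
  could be cut. Sliding the base point along \<open>sig p p\<close> does not increase the displacement, so if no
  minimizer had distance less than \<open>h\<close>, then \<open>sig p p\<close> would run parallel to \<open>g\<close> at distance almost \<open>h\<close>,
  and strict convexity excludes such flat strips.
\<close>

section \<open>Affine and local geodesics\<close>

text \<open>Replacing the cover by continuation requires a convexity radius along the whole segment
  of length \<open>T\<close>, and no such radius can be fixed before \<open>T\<close>. The constants
  are therefore chosen in the order \<open>a\<close>, \<open>\<eta>\<close>,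
  \<open>\<delta>\<close>, \<open>T\<close>, \<open>r\<close>, \<open>K\<close>. The strip argument
  takes place in one ball around \<open>g 0\<close> and depends only on the convexity there, while
  the possibly tiny radius \<open>r\<close> along the tube enters only through the number
  \<open>K\<close> of continuation steps and leaves no trace in the Lipschitz bounds for
  \<open>len\<close>.

  The slid base points are only known to lie within \<open>h + 3 * \<delta>\<close> of
  \<open>g\<close>, so they may leave the set over which the displacement is minimized; a slid point
  nearer than \<open>h\<close> is again a minimizer, and the exclusion of strips provides one. The
  summand \<open>a * a / \<delta>\<close> in the lower bound on \<open>T\<close> comes from this
  step: a loop of length \<open>m\<close> with \<open>\<bar>m - T\<bar> \<le> a\<close>, followed
  for a length up to \<open>a\<close>, gets out of step with \<open>g\<close> by at most
  \<open>a * a / m\<close>, and this must not exceed \<open>\<delta>\<close>.\<close>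

text \<open>Geodesics are parametrized proportionally to arclength over \<open>{0..1}\<close>, so that
  two of them can be compared at equal parameters; \<open>l\<close> in \<open>lgeo l c\<close> is the speed, hence the length.\<close>

definition ageo :: "(real \<Rightarrow> 'a::metric_space) \<Rightarrow> 'a \<Rightarrow> 'a \<Rightarrow> bool" where
  "ageo c x y \<longleftrightarrow> c 0 = x \<and> c 1 = y \<and>
     (\<forall>s\<in>{0..1}. \<forall>t\<in>{0..1}. dist (c s) (c t) = dist x y * \<bar>s - t\<bar>)"

definition lgeo :: "real \<Rightarrow> (real \<Rightarrow> 'a::metric_space) \<Rightarrow> bool" where
  "lgeo l c \<longleftrightarrow> 0 \<le> l \<and>
     (\<exists>e>0. \<forall>s\<in>{0..1}. \<forall>t\<in>{0..1}. \<bar>s - t\<bar> \<le> e \<longrightarrow> dist (c s) (c t) = l * \<bar>s - t\<bar>)"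

text \<open>Strict Busemann convexity is all that is used of the \<open>CAT(\<kappa>)\<close> inequality. Geodesics with
  endpoints in the ball may leave the ball.\<close>

definition npc :: "'a::metric_space \<Rightarrow> real \<Rightarrow> bool" where
  "npc w \<rho> \<longleftrightarrow> (\<forall>x\<in>ball w \<rho>. \<forall>y\<in>ball w \<rho>. \<forall>z\<in>ball w \<rho>. \<forall>a b. ageo a x y \<and> ageo b x z \<longrightarrow>
     dist (a (1/2)) (b (1/2)) \<le> dist y z / 2 \<and>
     (dist (a (1/2)) (b (1/2)) = dist y z / 2 \<longrightarrow>
        dist y z = dist x y + dist x z \<or> dist x y = dist x z + dist y z \<or>
        dist x z = dist x y + dist y z))"

lemma ageoD:
  assumes "ageo c x y"
  shows "c 0 = x" "c 1 = y"
    "\<And>s t. 0 \<le> s \<Longrightarrow> s \<le> 1 \<Longrightarrow> 0 \<le> t \<Longrightarrow> t \<le> 1 \<Longrightarrow> dist (c s) (c t) = dist x y * \<bar>s - t\<bar>"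
  using assms by (auto simp: ageo_def)

lemma ageo_imp_lgeo: "ageo c x y \<Longrightarrow> lgeo (dist x y) c"
  unfolding lgeo_def ageo_def by (auto intro!: exI[of _ 1])

lemma lgeo_const: "lgeo 0 (\<lambda>_. x)"
  by (auto simp: lgeo_def intro: exI[of _ 1])

lemma ageo_rev: "ageo c x y \<Longrightarrow> ageo (\<lambda>t. c (1 - t)) y x"
  unfolding ageo_def by (auto simp: dist_commute abs_minus_commute)

lemma lgeo_nonneg: "lgeo l c \<Longrightarrow> 0 \<le> l"
  by (simp add: lgeo_def)

lemma lgeo_sub:
  assumes "lgeo l c" "0 \<le> a" "a \<le> b" "b \<le> 1"
  shows "lgeo ((b - a) * l) (\<lambda>t. c (a + t * (b - a)))"
proof -
  obtain e where e: "e > 0" "\<And>s t. s \<in> {0..1} \<Longrightarrow> t \<in> {0..1} \<Longrightarrow> \<bar>s - t\<bar> \<le> e \<Longrightarrow> dist (c s) (c t) = l * \<bar>s - t\<bar>"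
    using assms(1) unfolding lgeo_def by blast
  have in01: "a + t * (b - a) \<in> {0..1}" if "t \<in> {0..1}" for t
  proof -
    have "t * (b - a) \<le> 1 * (b - a)" using that assms by (intro mult_right_mono) auto
    moreover have "0 \<le> t * (b - a)" using that assms by auto
    ultimately show ?thesis using assms by auto
  qed
  have "dist (c (a + s * (b - a))) (c (a + t * (b - a))) = (b - a) * l * \<bar>s - t\<bar>"
    if "s \<in> {0..1}" "t \<in> {0..1}" "\<bar>s - t\<bar> \<le> e" for s t
  proof -
    have *: "\<bar>(a + s * (b - a)) - (a + t * (b - a))\<bar> = \<bar>s - t\<bar> * (b - a)"
      using assms by (simp add: abs_mult flip: left_diff_distrib)
    also have "\<dots> \<le> \<bar>s - t\<bar> * 1" using assms by (intro mult_left_mono) auto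
    finally have "\<bar>(a + s * (b - a)) - (a + t * (b - a))\<bar> \<le> e" using that by simp
    from e(2)[OF in01[OF that(1)] in01[OF that(2)] this] show ?thesis
      unfolding * by (simp add: mult_ac)
  qed
  then show ?thesis using assms lgeo_nonneg[OF assms(1)] e(1)
    unfolding lgeo_def by (intro conjI exI[of _ e]) auto
qed

text \<open>\<open>Bolzano\<close> replaces the choice of a partition: the bound is additive over
  adjacent intervals and holds on short ones.\<close>

lemma local_lipschitz_imp_lipschitz:
  fixes f :: "real \<Rightarrow> 'a::metric_space"
  assumes "a \<le> b" "e > 0"
    and loc: "\<And>s t. a \<le> s \<Longrightarrow> s \<le> t \<Longrightarrow> t \<le> b \<Longrightarrow> t - s < e \<Longrightarrow> dist (f s) (f t) \<le> M * (t - s)"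
  shows "dist (f a) (f b) \<le> M * (b - a)"
proof -
  have "a \<le> a \<and> b \<le> b \<longrightarrow> dist (f a) (f b) \<le> M * (b - a)" using \<open>a \<le> b\<close>
  proof (induction rule: Bolzano[where P = "\<lambda>s t. a \<le> s \<and> t \<le> b \<longrightarrow> dist (f s) (f t) \<le> M * (t - s)"])
    case (trans s t u)
    show ?case
    proof
      assume "a \<le> s \<and> u \<le> b"
      then have "dist (f s) (f t) \<le> M * (t - s)" "dist (f t) (f u) \<le> M * (u - t)"
        using trans by auto
      then show "dist (f s) (f u) \<le> M * (u - s)"
        using dist_triangle[of "f s" "f u" "f t"] by (simp add: algebra_simps)
    qed
  next
    case (local x)
    show ?case by (rule exI[of _ e]) (use \<open>e > 0\<close> loc in auto)
  qed
  then show ?thesis by simp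
qed

lemma lgeo_dist_le:
  assumes "lgeo l c" "s \<in> {0..1}" "t \<in> {0..1}"
  shows "dist (c s) (c t) \<le> l * \<bar>s - t\<bar>"
proof -
  obtain e where e: "e > 0" "\<And>s t. s \<in> {0..1} \<Longrightarrow> t \<in> {0..1} \<Longrightarrow> \<bar>s - t\<bar> \<le> e \<Longrightarrow> dist (c s) (c t) = l * \<bar>s - t\<bar>"
    using assms(1) unfolding lgeo_def by blast
  have le: "dist (c s) (c t) \<le> l * (t - s)" if "0 \<le> s" "s \<le> t" "t \<le> 1" for s t
    using that e by (intro local_lipschitz_imp_lipschitz[of s t e]) auto
  show ?thesis
    using le[of s t] le[of t s] assms(2,3) by (cases "s \<le> t") (auto simp: dist_commute)
qed

lemma lgeo_continuous:
  assumes "lgeo l c" shows "continuous_on {0..1} c"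
proof -
  have "l-lipschitz_on {0..1} c"
    using lgeo_dist_le[OF assms] lgeo_nonneg[OF assms]
    by (intro lipschitz_onI) (auto simp: dist_real_def)
  then show ?thesis by (rule lipschitz_on_continuous_on)
qed

lemma lgeo_ageo_piece:
  assumes "lgeo l c"
  obtains e where "e > 0"
    "\<And>a b. 0 \<le> a \<Longrightarrow> a \<le> b \<Longrightarrow> b \<le> 1 \<Longrightarrow> b - a \<le> e \<Longrightarrow>
       ageo (\<lambda>t. c (a + t * (b - a))) (c a) (c b) \<and> dist (c a) (c b) = l * (b - a)"
proof -
  obtain e where e: "e > 0" "\<And>s t. s \<in> {0..1} \<Longrightarrow> t \<in> {0..1} \<Longrightarrow> \<bar>s - t\<bar> \<le> e \<Longrightarrow> dist (c s) (c t) = l * \<bar>s - t\<bar>"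
    using assms(1) unfolding lgeo_def by blast
  have "ageo (\<lambda>t. c (a + t * (b - a))) (c a) (c b) \<and> dist (c a) (c b) = l * (b - a)"
    if ab: "0 \<le> a" "a \<le> b" "b \<le> 1" "b - a \<le> e" for a b
  proof -
    have D: "dist (c a) (c b) = l * (b - a)" using e(2)[of a b] ab by auto
    have in01: "a + t * (b - a) \<in> {0..1}" if "t \<in> {0..1}" for t
    proof -
      have "t * (b - a) \<le> 1 * (b - a)" using that ab by (intro mult_right_mono) auto
      moreover have "0 \<le> t * (b - a)" using that ab by auto
      ultimately show ?thesis using ab by auto
    qed
    have "dist (c (a + s * (b - a))) (c (a + t * (b - a))) = dist (c a) (c b) * \<bar>s - t\<bar>"
      if "s \<in> {0..1}" "t \<in> {0..1}" for s t
    proof -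
      have *: "\<bar>(a + s * (b - a)) - (a + t * (b - a))\<bar> = \<bar>s - t\<bar> * (b - a)"
        using ab by (simp add: abs_mult flip: left_diff_distrib)
      also have "\<dots> \<le> 1 * (b - a)" using ab that by (intro mult_right_mono) auto
      finally have "\<bar>(a + s * (b - a)) - (a + t * (b - a))\<bar> \<le> e" using ab by simp
      from e(2)[OF in01[OF that(1)] in01[OF that(2)] this] show ?thesis
        unfolding * D by (simp add: mult_ac)
    qed
    then show ?thesis using D unfolding ageo_def by auto
  qed
  then show ?thesis using that e(1) by blast
qed

section \<open>Convexity of the distance between nearby local geodesics\<close>

lemma npcD:
  assumes "npc w \<rho>" "x \<in> ball w \<rho>" "y \<in> ball w \<rho>" "z \<in> ball w \<rho>" "ageo a x y" "ageo b x z"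
  shows "dist (a (1/2)) (b (1/2)) \<le> dist y z / 2"
    "dist (a (1/2)) (b (1/2)) = dist y z / 2 \<Longrightarrow>
        dist y z = dist x y + dist x z \<or> dist x y = dist x z + dist y z \<or> dist x z = dist x y + dist y z"
  using assms unfolding npc_def by blast+

lemma npc_subset: "npc w \<rho> \<Longrightarrow> ball w' \<rho>' \<subseteq> ball w \<rho> \<Longrightarrow> npc w' \<rho>'"
  unfolding npc_def by blast

text \<open>Maximum principle. After subtracting the chord, a positive maximum is attained in the
  interior; at the leftmost maximizer the midpoint inequality forces the maximum to be attained
  further left as well. The size \<open>e\<close> may depend on \<open>t\<close>.\<close>

lemma locally_midpoint_convex_le:
  fixes f :: "real \<Rightarrow> real"
  assumes cont: "continuous_on {0..1} f"
    and loc: "\<And>t. 0 < t \<Longrightarrow> t < 1 \<Longrightarrow> \<exists>e>0. \<forall>h. 0 < h \<and> h < e \<longrightarrow> f t \<le> (f (t - h) + f (t + h)) / 2"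
    and t: "t \<in> {0..1}"
  shows "f t \<le> (1 - t) * f 0 + t * f 1"
proof -
  define g where "g u = f u - ((1 - u) * f 0 + u * f 1)" for u
  have contg: "continuous_on {0..1} g" unfolding g_def by (intro continuous_intros cont)
  obtain m where m: "m \<in> {0..1}" "\<And>u. u \<in> {0..1} \<Longrightarrow> g u \<le> g m"
    using continuous_attains_sup[OF _ _ contg] by auto
  define S where "S = {0..1} \<inter> g -` {g m}"
  have "closed S" unfolding S_def by (intro continuous_closed_preimage contg) auto
  moreover have "S = {0..1} \<inter> S" by (auto simp: S_def)
  ultimately have "compact S" by (metis compact_Icc compact_Int_closed)
  moreover have "S \<noteq> {}" using m by (auto simp: S_def)
  ultimately obtain s where s: "s \<in> S" "\<And>u. u \<in> S \<Longrightarrow> s \<le> u" using compact_attains_inf by metis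
  have "g m \<le> 0"
  proof (rule ccontr)
    assume "\<not> g m \<le> 0"
    moreover have "g 0 = 0" "g 1 = 0" "g s = g m" using s by (auto simp: g_def S_def)
    ultimately have s01: "0 < s" "s < 1" using s(1) by (auto simp: S_def order_less_le)
    obtain e where e: "e > 0" "\<And>h. 0 < h \<Longrightarrow> h < e \<Longrightarrow> f s \<le> (f (s - h) + f (s + h)) / 2"
      using loc[OF s01] by blast
    define h where "h = min (e/2) (min s (1 - s))"
    have h: "0 < h" "h < e" "h \<le> s" "h \<le> 1 - s" using e s01 by (auto simp: h_def)
    have "g s \<le> (g (s - h) + g (s + h)) / 2"
      using e(2)[OF h(1,2)] unfolding g_def by (simp add: algebra_simps)
    moreover have "g (s + h) \<le> g m" "g (s - h) \<le> g m" using m(2) h s01 by auto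
    ultimately have "g (s - h) = g m" using \<open>g s = g m\<close> by auto
    then have "s - h \<in> S" using h s01 by (auto simp: S_def)
    from s(2)[OF this] h(1) show False by simp
  qed
  with m(2)[OF t] show ?thesis unfolding g_def by linarith
qed

locale geodesic_choice =
  fixes G :: "'a::metric_space \<Rightarrow> 'a \<Rightarrow> real \<Rightarrow> 'a"
  assumes ageo_G: "ageo (G x y) x y"
begin

lemma G_ends [simp]: "G x y 0 = x" "G x y 1 = y"
  using ageo_G by (auto dest: ageoD)

lemma dist_G: "0 \<le> s \<Longrightarrow> s \<le> 1 \<Longrightarrow> 0 \<le> t \<Longrightarrow> t \<le> 1 \<Longrightarrow> dist (G x y s) (G x y t) = dist x y * \<bar>s - t\<bar>"
  using ageo_G by (rule ageoD(3))

text \<open>The diagonal from \<open>x\<close> to \<open>y'\<close> splits the quadrilateral into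
  two triangles; the second has its apex at \<open>y'\<close>, so its sides are reversed.\<close>

lemma npc_midpoints:
  fixes x y x' y' w :: 'a
  assumes "npc w \<rho>" "x \<in> ball w \<rho>" "y \<in> ball w \<rho>" "x' \<in> ball w \<rho>" "y' \<in> ball w \<rho>"
    and "ageo a x y" "ageo b x' y'"
  shows "dist (a (1/2)) (b (1/2)) \<le> (dist x x' + dist y y') / 2"
proof -
  have "dist (a (1/2)) (G x y' (1/2)) \<le> dist y y' / 2"
    by (rule npcD(1)[OF assms(1,2,3,5,6) ageo_G])
  moreover have "dist (G x y' (1 - 1/2)) (b (1 - 1/2)) \<le> dist x x' / 2"
    using npcD(1)[OF assms(1,5,2,4) ageo_rev[OF ageo_G] ageo_rev[OF assms(7)]] .
  ultimately show ?thesis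
    using dist_triangle[of "a (1/2)" "b (1/2)" "G x y' (1/2)"] by simp
qed

text \<open>The maximum principle asks for the midpoint inequality only on small intervals around
  each \<open>t\<close>. So it suffices that \<open>c t\<close> and \<open>c' t\<close> share a
  convex ball; the curves may be far longer than any convexity radius.\<close>

lemma lgeo_dist_convex:
  fixes c c' :: "real \<Rightarrow> 'a"
  assumes c: "lgeo l c" and c': "lgeo l' c'"
    and npc: "\<And>t. 0 < t \<Longrightarrow> t < 1 \<Longrightarrow> \<exists>w \<rho>. npc w \<rho> \<and> c t \<in> ball w \<rho> \<and> c' t \<in> ball w \<rho>"
    and t: "t \<in> {0..1}"
  shows "dist (c t) (c' t) \<le> (1 - t) * dist (c 0) (c' 0) + t * dist (c 1) (c' 1)"
proof (rule locally_midpoint_convex_le[where f = "\<lambda>t. dist (c t) (c' t)", OF _ _ t])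
  show "continuous_on {0..1} (\<lambda>t. dist (c t) (c' t))"
    by (intro continuous_intros lgeo_continuous[OF c] lgeo_continuous[OF c'])
  fix t :: real assume t: "0 < t" "t < 1"
  obtain w \<rho> where w: "npc w \<rho>" "c t \<in> ball w \<rho>" "c' t \<in> ball w \<rho>" using npc[OF t] by blast
  obtain e where e: "e > 0" "\<And>a b. 0 \<le> a \<Longrightarrow> a \<le> b \<Longrightarrow> b \<le> 1 \<Longrightarrow> b - a \<le> e \<Longrightarrow>
       ageo (\<lambda>t. c (a + t * (b - a))) (c a) (c b) \<and> dist (c a) (c b) = l * (b - a)"
    using lgeo_ageo_piece[OF c] by metis
  obtain e' where e': "e' > 0" "\<And>a b. 0 \<le> a \<Longrightarrow> a \<le> b \<Longrightarrow> b \<le> 1 \<Longrightarrow> b - a \<le> e' \<Longrightarrow>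
       ageo (\<lambda>t. c' (a + t * (b - a))) (c' a) (c' b) \<and> dist (c' a) (c' b) = l' * (b - a)"
    using lgeo_ageo_piece[OF c'] by metis
  have isc: "isCont c t" "isCont c' t"
    using lgeo_continuous[OF c] lgeo_continuous[OF c'] t
    by (auto intro!: continuous_on_interior)
  have "\<forall>\<^sub>F s in nhds t. c s \<in> ball w \<rho>" "\<forall>\<^sub>F s in nhds t. c' s \<in> ball w \<rho>"
    using isc w topological_tendstoD[OF _ open_ball]
    unfolding isCont_def tendsto_at_iff_tendsto_nhds by blast+
  then have "\<forall>\<^sub>F s in nhds t. c s \<in> ball w \<rho> \<and> c' s \<in> ball w \<rho>" by (rule eventually_conj)
  then obtain d where d: "d > 0" "\<And>s. dist s t < d \<Longrightarrow> c s \<in> ball w \<rho> \<and> c' s \<in> ball w \<rho>"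
    by (auto simp: eventually_nhds_metric)
  show "\<exists>e>0. \<forall>h. 0 < h \<and> h < e \<longrightarrow> dist (c t) (c' t) \<le> (dist (c (t - h)) (c' (t - h)) + dist (c (t + h)) (c' (t + h))) / 2"
  proof (intro exI[of _ "min (min (e/2) (e'/2)) (min d (min t (1 - t)))"] conjI allI impI)
    show "0 < min (min (e/2) (e'/2)) (min d (min t (1 - t)))" using e e' d t by auto
    fix h assume h: "0 < h \<and> h < min (min (e/2) (e'/2)) (min d (min t (1 - t)))"
    have "ageo (\<lambda>u. c (t - h + u * (t + h - (t - h)))) (c (t - h)) (c (t + h))" using e(2)[of "t-h" "t+h"] h by auto
    moreover have "ageo (\<lambda>u. c' (t - h + u * (t + h - (t - h)))) (c' (t - h)) (c' (t + h))" using e'(2)[of "t-h" "t+h"] h by auto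
    moreover have "c (t - h) \<in> ball w \<rho>" "c (t + h) \<in> ball w \<rho>" "c' (t - h) \<in> ball w \<rho>" "c' (t + h) \<in> ball w \<rho>"
      using d(2)[of "t - h"] d(2)[of "t + h"] h by (auto simp: dist_real_def)
    ultimately show "dist (c t) (c' t) \<le> (dist (c (t - h)) (c' (t - h)) + dist (c (t + h)) (c' (t + h))) / 2"
      using npc_midpoints[OF w(1), of "c (t-h)" "c (t+h)" "c' (t-h)" "c' (t+h)"] by fastforce
  qed
qed

end

section \<open>Comparison of midpoints in the hyperbolic plane\<close>

lemma lorentz_form_commute: "lorentz_form u v = lorentz_form v u"
  by (simp add: lorentz_form_def mult.commute)

text \<open>Reversed Cauchy-Schwarz inequality, from Lagrange's identity for
  \<open>(u1, u2, 1)\<close> and \<open>(v1, v2, 1)\<close>, whose Euclidean norms are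
  \<open>u3\<close> and \<open>v3\<close>. It puts the argument of \<open>arcosh\<close> into its
  domain.\<close>

lemma lorentz_form_le:
  assumes "u \<in> hyperbolic_plane" "v \<in> hyperbolic_plane"
  shows "1 \<le> - lorentz_form u v"
proof -
  have u: "(u$1)^2 + (u$2)^2 + 1 = (u$3)^2" "u$3 > 0" and v: "(v$1)^2 + (v$2)^2 + 1 = (v$3)^2" "v$3 > 0"
    using assms by (auto simp: hyperbolic_plane_def lorentz_form_def power2_eq_square)
  have "(1 + u$1 * v$1 + u$2 * v$2)^2 + (u$1 - v$1)^2 + (u$2 - v$2)^2 + (u$1 * v$2 - u$2 * v$1)^2
      = ((u$1)^2 + (u$2)^2 + 1) * ((v$1)^2 + (v$2)^2 + 1)"
    by (simp add: power2_eq_square algebra_simps)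
  also have "\<dots> = (u$3 * v$3)^2" by (simp add: u v power_mult_distrib)
  finally have "(1 + u$1 * v$1 + u$2 * v$2)^2 \<le> (u$3 * v$3)^2"
    by (smt (verit) zero_le_power2)
  then have "1 + u$1 * v$1 + u$2 * v$2 \<le> u$3 * v$3"
    by (rule power2_le_imp_le) (use u v in simp)
  then show ?thesis by (simp add: lorentz_form_def)
qed

lemma cosh_hyperbolic_dist:
  assumes "u \<in> hyperbolic_plane" "v \<in> hyperbolic_plane" "\<kappa> < 0"
  shows "- lorentz_form u v = cosh (sqrt (- \<kappa>) * hyperbolic_dist \<kappa> u v)"
  using lorentz_form_le[OF assms(1,2)] assms(3) by (simp add: hyperbolic_dist_def)

text \<open>The distances alone determine the midpoint: \<open>w\<close> is null and
  Lorentz-orthogonal to the timelike vector \<open>m\<close>, and the form is positive definite on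
  the complement of \<open>m\<close>, so \<open>w = 0\<close>.\<close>

lemma lorentz_midpoint:
  assumes "m \<in> hyperbolic_plane" "u \<in> hyperbolic_plane" "v \<in> hyperbolic_plane"
    and "lorentz_form u v = - cosh (2 * b)" "lorentz_form m u = - cosh b" "lorentz_form m v = - cosh b"
  shows "u + v = (2 * cosh b) *\<^sub>R m"
proof -
  define B where "B = cosh b"
  have B: "B > 0" "cosh (2 * b) = 2 * B^2 - 1" by (auto simp: B_def cosh_double_cosh)
  define w where "w = u + v - (2 * B) *\<^sub>R m"
  have n: "lorentz_form m m = -1" "lorentz_form u u = -1" "lorentz_form v v = -1" "m$3 > 0"
    using assms by (auto simp: hyperbolic_plane_def)
  have lin: "lorentz_form w z = lorentz_form u z + lorentz_form v z - 2 * B * lorentz_form m z" for z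
    by (simp add: w_def lorentz_form_def algebra_simps)
  have wm: "lorentz_form w m = 0"
    using assms(5,6) n by (simp add: lin lorentz_form_commute[of u m] lorentz_form_commute[of v m] B_def)
  have "lorentz_form w w = lorentz_form u w + lorentz_form v w - 2 * B * lorentz_form m w" by (rule lin)
  also have "\<dots> = lorentz_form w u + lorentz_form w v"
    using wm by (simp add: lorentz_form_commute[of m w] lorentz_form_commute[of u w] lorentz_form_commute[of v w])
  also have "\<dots> = 0"
    using assms(4-6) n B unfolding lin lorentz_form_commute[of v u]
    by (simp add: B_def power2_eq_square algebra_simps)
  finally have ww: "lorentz_form w w = 0" .
  have e1: "w$1 * w$1 + w$2 * w$2 = w$3 * w$3" using ww by (simp add: lorentz_form_def)
  have e2: "w$1 * m$1 + w$2 * m$2 = w$3 * m$3" using wm by (simp add: lorentz_form_def)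
  have e3: "m$1 * m$1 + m$2 * m$2 + 1 = m$3 * m$3" using n by (simp add: lorentz_form_def)
  have "(w$3 * m$3)^2 + (w$1 * m$2 - w$2 * m$1)^2 = (w$1 * w$1 + w$2 * w$2) * (m$1 * m$1 + m$2 * m$2)"
    unfolding e2[symmetric] by (simp add: power2_eq_square algebra_simps)
  also have "m$1 * m$1 + m$2 * m$2 = m$3 * m$3 - 1" using e3 by simp
  also have "(w$1 * w$1 + w$2 * w$2) * (m$3 * m$3 - 1) = (w$3 * m$3)^2 - (w$3)^2"
    unfolding e1 by (simp add: power2_eq_square algebra_simps)
  finally have "(w$3)^2 \<le> 0" by (smt (verit) zero_le_power2)
  then have "w$3 = 0" by simp
  moreover from this have "w$1 = 0" "w$2 = 0" using e1 by (simp_all add: sum_squares_eq_zero_iff)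
  ultimately have "w = 0" by (simp add: vec_eq_iff forall_3)
  then show ?thesis by (simp add: w_def B_def)
qed

text \<open>\<open>2 * A\<close>, \<open>2 * B\<close>, \<open>2 * C\<close> are the rescaled sides,
  and the quotient is the hyperbolic cosine of the distance between the midpoints of the last two.
  Its difference from \<open>cosh A\<close> factors as in \<open>id\<close>, and each factor
  vanishes only for a degenerate triangle.\<close>

lemma cosh_triangle_aux:
  fixes A B C :: real
  assumes "0 \<le> A" "0 \<le> B" "0 \<le> C" "A \<le> B + C" "B \<le> A + C" "C \<le> A + B"
  shows "(1 + cosh (2*A) + cosh (2*B) + cosh (2*C)) / (4 * cosh B * cosh C) \<le> cosh A"
    and "(1 + cosh (2*A) + cosh (2*B) + cosh (2*C)) / (4 * cosh B * cosh C) = cosh A \<Longrightarrow>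
       A = B + C \<or> B = A + C \<or> C = A + B"
proof -
  have id: "4 * cosh B * cosh C * cosh A - (1 + cosh (2*A) + cosh (2*B) + cosh (2*C)) =
     2 * (cosh (B + C) - cosh A) * (cosh A - cosh (B - C))"
  proof -
    have s: "sinh B * sinh B = cosh B * cosh B - 1" "sinh C * sinh C = cosh C * cosh C - 1"
      using cosh_square_eq[of B] cosh_square_eq[of C] by (auto simp: power2_eq_square)
    have "(sinh B * sinh C) * (sinh B * sinh C) = (cosh B * cosh B - 1) * (cosh C * cosh C - 1)"
      by (simp flip: s add: mult_ac)
    then show ?thesis
      unfolding cosh_double_cosh cosh_add cosh_diff
      by (simp add: power2_eq_square algebra_simps)
  qed
  have cosh_abs: "cosh \<bar>x\<bar> = cosh x" for x :: real by (cases "0 \<le> x") auto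
  have p: "4 * cosh B * cosh C > 0" by (simp add: mult_pos_pos)
  have m1: "cosh A \<le> cosh (B + C)" using assms by (subst cosh_real_nonneg_le_iff) auto
  have "cosh \<bar>B - C\<bar> \<le> cosh A" using assms by (subst cosh_real_nonneg_le_iff) auto
  then have m2: "cosh (B - C) \<le> cosh A" by (simp add: cosh_abs)
  have "0 \<le> 2 * (cosh (B + C) - cosh A) * (cosh A - cosh (B - C))" using m1 m2 by simp
  with id p show "(1 + cosh (2*A) + cosh (2*B) + cosh (2*C)) / (4 * cosh B * cosh C) \<le> cosh A"
    by (simp add: divide_le_eq mult_ac)
  assume "(1 + cosh (2*A) + cosh (2*B) + cosh (2*C)) / (4 * cosh B * cosh C) = cosh A"
  then have "1 + cosh (2*A) + cosh (2*B) + cosh (2*C) = cosh A * (4 * cosh B * cosh C)"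
    using p by (simp add: divide_eq_eq)
  with id have "2 * (cosh (B + C) - cosh A) * (cosh A - cosh (B - C)) = 0" by (simp add: mult_ac)
  then have "cosh (B + C) = cosh A \<or> cosh A = cosh \<bar>B - C\<bar>"
    by (auto simp: cosh_abs)
  then have "B + C = A \<or> A = \<bar>B - C\<bar>"
  proof
    assume "cosh (B + C) = cosh A"
    then show ?thesis
      using assms cosh_real_nonneg_le_iff[of "B + C" A] cosh_real_nonneg_le_iff[of A "B + C"] by simp
  next
    assume "cosh A = cosh \<bar>B - C\<bar>"
    then show ?thesis
      using assms cosh_real_nonneg_le_iff[of "\<bar>B - C\<bar>" A] cosh_real_nonneg_le_iff[of A "\<bar>B - C\<bar>"] by simp
  qed
  then show "A = B + C \<or> B = A + C \<or> C = A + B" by (auto simp: abs_if split: if_splits)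
qed

lemma geodesic_segment_half:
  assumes "\<kappa> < 0" "geodesic_segment_between hyperbolic_plane (hyperbolic_dist \<kappa>) u v c"
    and "hyperbolic_dist \<kappa> u v = d" "0 \<le> d"
  shows "u \<in> hyperbolic_plane" "v \<in> hyperbolic_plane" "c (d/2) \<in> hyperbolic_plane"
    "u + v = (2 * cosh (sqrt (- \<kappa>) * (d / 2))) *\<^sub>R c (d/2)"
    "lorentz_form u v = - cosh (2 * (sqrt (- \<kappa>) * (d / 2)))"
proof -
  have c: "c ` {0..d} \<subseteq> hyperbolic_plane" "c 0 = u" "c d = v"
    "\<And>s t. s \<in> {0..d} \<Longrightarrow> t \<in> {0..d} \<Longrightarrow> hyperbolic_dist \<kappa> (c s) (c t) = \<bar>s - t\<bar>"
    using assms unfolding geodesic_segment_between_def isometric_embedding_on_def by auto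
  have "c 0 \<in> hyperbolic_plane" "c d \<in> hyperbolic_plane" and m: "c (d/2) \<in> hyperbolic_plane"
    using c(1) assms(4) by (auto simp: image_subset_iff)
  then show u: "u \<in> hyperbolic_plane" and v: "v \<in> hyperbolic_plane" and "c (d/2) \<in> hyperbolic_plane"
    using c by auto
  have d: "hyperbolic_dist \<kappa> (c (d/2)) u = d/2" "hyperbolic_dist \<kappa> (c (d/2)) v = d/2"
    using c(4)[of "d/2" 0] c(4)[of "d/2" d] c assms(4) by auto
  show uv: "lorentz_form u v = - cosh (2 * (sqrt (- \<kappa>) * (d / 2)))"
    using cosh_hyperbolic_dist[OF u v assms(1)] assms(3) by simp
  show "u + v = (2 * cosh (sqrt (- \<kappa>) * (d / 2))) *\<^sub>R c (d/2)"
    using cosh_hyperbolic_dist[OF m u assms(1)] cosh_hyperbolic_dist[OF m v assms(1)] d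
    by (intro lorentz_midpoint m u v uv) auto
qed

text \<open>The comparison midpoints are rescaled sums of vertices, so bilinearity of the form
  expresses their distance through the three sides. Equality in the space forces equality in the
  plane, hence a degenerate comparison triangle, which has the same side lengths.\<close>

lemma CAT_midpoints:
  fixes x y z :: "'a::metric_space"
  assumes "\<kappa> < 0" and cat: "CAT_inequality \<kappa> v c"
    and v: "v 0 = x" "v 1 = y" "v 2 = z"
  shows "dist (c 0 (dist x y / 2)) (c 2 (dist x z / 2)) \<le> dist y z / 2"
    and "dist (c 0 (dist x y / 2)) (c 2 (dist x z / 2)) = dist y z / 2 \<Longrightarrow>
        dist y z = dist x y + dist x z \<or> dist x y = dist x z + dist y z \<or> dist x z = dist x y + dist y z"
proof -
  define k where "k = sqrt (- \<kappa>)"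
  have k: "k > 0" using assms by (simp add: k_def)
  obtain v' c' where ct: "comparison_triangle \<kappa> v v' c'"
    and le: "\<And>i j s t. i < 3 \<Longrightarrow> j < 3 \<Longrightarrow> s \<in> {0..side_length dist v i} \<Longrightarrow> t \<in> {0..side_length dist v j} \<Longrightarrow>
           dist (c i s) (c j t) \<le> hyperbolic_dist \<kappa> (c' i s) (c' j t)"
    using cat unfolding CAT_inequality_def by metis
  have seg: "geodesic_segment_between hyperbolic_plane (hyperbolic_dist \<kappa>) (v' i) (v' (Suc i mod 3)) (c' i)"
    and sl: "hyperbolic_dist \<kappa> (v' i) (v' (Suc i mod 3)) = dist (v i) (v (Suc i mod 3))" if "i < 3" for i
    using ct that unfolding comparison_triangle_def geodesic_triangle_def side_length_def by auto
  have n: "Suc 0 mod 3 = 1" "Suc 1 mod 3 = 2" "Suc 2 mod 3 = 0" by auto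
  define A B C where "A = k * (dist y z / 2)" and "B = k * (dist x y / 2)" and "C = k * (dist x z / 2)"
  define m n' where "m = c' 0 (dist x y / 2)" and "n' = c' 2 (dist x z / 2)"
  note s0 = geodesic_segment_half[OF assms(1) seg[of 0] sl[of 0], unfolded n v, folded k_def B_def m_def]
  note s1 = geodesic_segment_half[OF assms(1) seg[of 1] sl[of 1], unfolded n v, folded k_def A_def]
  note s2 = geodesic_segment_half[OF assms(1) seg[of 2] sl[of 2], unfolded n v, unfolded dist_commute[of z x], folded k_def C_def n'_def]
  have hyp: "v' 0 \<in> hyperbolic_plane" "v' 1 \<in> hyperbolic_plane" "v' 2 \<in> hyperbolic_plane"
    "m \<in> hyperbolic_plane" "n' \<in> hyperbolic_plane"
    using s0 s1 s2 by simp_all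
  have lf: "lorentz_form (v' 0) (v' 1) = - cosh (2 * B)" "lorentz_form (v' 1) (v' 2) = - cosh (2 * A)"
    "lorentz_form (v' 2) (v' 0) = - cosh (2 * C)" using s0(5) s1(5) s2(5) by (simp_all add: A_def B_def C_def)
  have mm: "v' 0 + v' 1 = (2 * cosh B) *\<^sub>R m" "v' 2 + v' 0 = (2 * cosh C) *\<^sub>R n'"
    using s0(4) s2(4) by (simp_all add: B_def C_def)
  have "(2 * cosh B) * (2 * cosh C) * lorentz_form m n' = lorentz_form ((2 * cosh B) *\<^sub>R m) ((2 * cosh C) *\<^sub>R n')"
    by (simp add: lorentz_form_def algebra_simps)
  also have "\<dots> = lorentz_form (v' 0 + v' 1) (v' 2 + v' 0)" by (simp only: mm)
  also have "\<dots> = lorentz_form (v' 2) (v' 0) + lorentz_form (v' 0) (v' 0) + lorentz_form (v' 1) (v' 2) + lorentz_form (v' 0) (v' 1)"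
    by (simp add: lorentz_form_def algebra_simps)
  also have "\<dots> = - (1 + cosh (2*A) + cosh (2*B) + cosh (2*C))"
    using hyp by (simp add: lf hyperbolic_plane_def del: One_nat_def)
  finally have mn: "- lorentz_form m n' = (1 + cosh (2*A) + cosh (2*B) + cosh (2*C)) / (4 * cosh B * cosh C)"
    by (simp add: field_simps)
  have tri: "0 \<le> A" "0 \<le> B" "0 \<le> C" "A \<le> B + C" "B \<le> A + C" "C \<le> A + B"
    using mult_left_mono[of "dist y z" "dist x y + dist x z" "k / 2"]
      mult_left_mono[of "dist x y" "dist y z + dist x z" "k / 2"]
      mult_left_mono[of "dist x z" "dist y z + dist x y" "k / 2"]
      dist_triangle3[of y z x] dist_triangle2[of x y z] dist_triangle[of x z y] k
    unfolding A_def B_def C_def by (simp_all add: distrib_left add.commute)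
  define h where "h = hyperbolic_dist \<kappa> m n'"
  have coshh: "cosh (k * h) = (1 + cosh (2*A) + cosh (2*B) + cosh (2*C)) / (4 * cosh B * cosh C)"
    using cosh_hyperbolic_dist[OF hyp(4,5) assms(1)] mn by (simp add: h_def k_def)
  have h0: "h \<ge> 0" unfolding h_def hyperbolic_dist_def using lorentz_form_le[OF hyp(4,5)] assms(1)
    by (intro divide_nonneg_nonneg) auto
  have "cosh (k * h) \<le> cosh A" using cosh_triangle_aux(1)[OF tri] coshh by simp
  then have "k * h \<le> A" using cosh_real_nonneg_le_iff[of "k * h" A] h0 k tri by auto
  then have hle: "h \<le> dist y z / 2" using k by (simp add: A_def)
  have dle: "dist (c 0 (dist x y / 2)) (c 2 (dist x z / 2)) \<le> h"
    unfolding h_def m_def n'_def using v dist_commute[of x z]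
    by (intro le) (auto simp: side_length_def n simp del: One_nat_def)
  from dle hle show "dist (c 0 (dist x y / 2)) (c 2 (dist x z / 2)) \<le> dist y z / 2" by linarith
  assume "dist (c 0 (dist x y / 2)) (c 2 (dist x z / 2)) = dist y z / 2"
  with dle hle have "h = dist y z / 2" by linarith
  then have "k * h = A" by (simp add: A_def)
  then have "cosh (k * h) = cosh A" by simp
  then have "A = B + C \<or> B = A + C \<or> C = A + B" using cosh_triangle_aux(2)[OF tri] coshh by simp
  then show "dist y z = dist x y + dist x z \<or> dist x y = dist x z + dist y z \<or> dist x z = dist x y + dist y z"
  proof (elim disjE)
    assume "A = B + C"
    then have "k * dist y z = k * (dist x y + dist x z)" unfolding A_def B_def C_def by (simp add: distrib_left)
    with k show ?thesis by simp
  next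
    assume "B = A + C"
    then have "k * dist x y = k * (dist x z + dist y z)" unfolding A_def B_def C_def by (simp add: distrib_left)
    with k show ?thesis by simp
  next
    assume "C = A + B"
    then have "k * dist x z = k * (dist x y + dist y z)" unfolding A_def B_def C_def by (simp add: distrib_left)
    with k show ?thesis by simp
  qed
qed

section \<open>From the comparison inequality to convex balls\<close>

lemma ageo_imp_geodesic_segment:
  assumes "ageo a x y"
  shows "geodesic_segment_between UNIV dist x y (\<lambda>s. a (s / dist x y))"
proof (cases "x = y")
  \<comment> \<open>Here the quotient \<open>s / 0\<close> is \<open>0\<close>, and
    \<open>s = 0\<close> is the only parameter.\<close>
  case True
  then show ?thesis using assms
    by (auto simp: geodesic_segment_between_def isometric_embedding_on_def ageo_def)
next
  case False
  then have d: "dist x y > 0" by simp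
  have "dist (a (s / dist x y)) (a (t / dist x y)) = \<bar>s - t\<bar>" if "s \<in> {0..dist x y}" "t \<in> {0..dist x y}" for s t
  proof -
    have "dist (a (s / dist x y)) (a (t / dist x y)) = dist x y * \<bar>s / dist x y - t / dist x y\<bar>"
      using that d by (intro ageoD(3)[OF assms]) auto
    also have "\<dots> = \<bar>s - t\<bar>" using d by (simp flip: diff_divide_distrib add: abs_divide)
    finally show ?thesis .
  qed
  then show ?thesis using assms d
    by (auto simp: geodesic_segment_between_def isometric_embedding_on_def ageo_def)
qed

lemma geodesic_segment_imp_ageo:
  assumes "geodesic_segment_between UNIV dist x y c"
  shows "ageo (\<lambda>t. c (t * dist x y)) x y"
proof -
  have "dist (c (s * dist x y)) (c (t * dist x y)) = dist x y * \<bar>s - t\<bar>" if "s \<in> {0..1}" "t \<in> {0..1}" for s t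
  proof -
    have "dist (c (s * dist x y)) (c (t * dist x y)) = \<bar>s * dist x y - t * dist x y\<bar>"
      using assms that unfolding geodesic_segment_between_def isometric_embedding_on_def
      by (auto simp: mult_le_cancel_right1 mult_left_le_one_le)
    then show ?thesis by (simp flip: left_diff_distrib add: abs_mult)
  qed
  then show ?thesis using assms by (auto simp: ageo_def geodesic_segment_between_def)
qed

lemma ageo_in_ball:
  assumes "ageo a x y" "x \<in> ball w \<rho>" "y \<in> ball w \<rho>" "t \<in> {0..1}"
  shows "a t \<in> ball w (2 * \<rho>)"
proof -
  have a: "dist x (a t) = dist x y * t" "dist (a t) y = dist x y * (1 - t)"
    using ageoD(3)[OF assms(1), of 0 t] ageoD(3)[OF assms(1), of t 1] ageoD(1,2)[OF assms(1)] assms(4) by auto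
  have "dist x (a t) + dist (a t) y = dist x y" unfolding a by (simp add: algebra_simps)
  moreover have "dist x y \<le> dist w x + dist w y" by (metis dist_commute dist_triangle)
  moreover have "dist w (a t) \<le> dist w x + dist x (a t)" "dist w (a t) \<le> dist w y + dist (a t) y"
    using dist_triangle[of w "a t" x] dist_triangle[of w "a t" y] by (simp_all add: dist_commute)
  ultimately show ?thesis using assms by simp
qed

lemma curvature_le_imp_npc:
  assumes "\<kappa> < 0" "geodesic_space TYPE('a::metric_space)" "curvature_le TYPE('a) \<kappa>"
  shows "\<exists>\<rho>>0. npc (w::'a) \<rho>"
proof -
  obtain V where V: "w \<in> interior V" and tri: "\<And>v c. geodesic_triangle UNIV dist v c \<Longrightarrow>
      (\<And>i. i < 3 \<Longrightarrow> c i ` {0..side_length dist v i} \<subseteq> V) \<Longrightarrow> CAT_inequality \<kappa> v (c :: nat \<Rightarrow> real \<Rightarrow> 'a)"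
    using assms(3) unfolding curvature_le_def by metis
  obtain e where e: "e > 0" "ball w e \<subseteq> V" using V by (meson mem_interior)
  \<comment> \<open>Sides with endpoints in the ball of radius \<open>\<rho>\<close> stay in the
    ball of radius \<open>2 * \<rho> = e\<close>.\<close>
  define \<rho> where "\<rho> = e/2"
  have "\<rho> > 0" using e by (simp add: \<rho>_def)
  moreover have "npc w \<rho>" unfolding npc_def
  proof (intro ballI allI impI)
    fix x y z a b assume xyz: "x \<in> ball w \<rho>" "y \<in> ball w \<rho>" "z \<in> ball w \<rho>" and "ageo a x y \<and> ageo b x z"
    then have a: "ageo a x y" and b: "ageo b x z" by auto
    obtain c1 where c1: "geodesic_segment_between UNIV dist y z c1" using assms(2) unfolding geodesic_space_def by blast
    define f where "f = (\<lambda>t. c1 (t * dist y z))"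
    have f: "ageo f y z" unfolding f_def by (rule geodesic_segment_imp_ageo[OF c1])
    have b': "ageo (\<lambda>t. b (1 - t)) z x" by (rule ageo_rev[OF b])
    define v where "v i = (if i = 0 then x else if i = 1 then y else z)" for i :: nat
    define g where "g i = (if i = 0 then a else if i = 1 then f else (\<lambda>t. b (1 - t)))" for i :: nat
    have g: "ageo (g i) (v i) (v (Suc i mod 3))" "v i \<in> ball w \<rho>" "v (Suc i mod 3) \<in> ball w \<rho>" if "i < 3" for i
    proof -
      have "i = 0 \<or> i = 1 \<or> i = 2" using that by auto
      then show "ageo (g i) (v i) (v (Suc i mod 3))" "v i \<in> ball w \<rho>" "v (Suc i mod 3) \<in> ball w \<rho>"
        using a b' f xyz by (auto simp: g_def v_def)
    qed
    define c where "c i = (\<lambda>s. g i (s / side_length dist v i))" for i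
    have "geodesic_triangle UNIV dist v c"
      unfolding geodesic_triangle_def c_def side_length_def
      using g(1) ageo_imp_geodesic_segment by blast
    moreover have "c i ` {0..side_length dist v i} \<subseteq> V" if "i < 3" for i
    proof
      fix p assume "p \<in> c i ` {0..side_length dist v i}"
      then obtain s where s: "s \<in> {0..side_length dist v i}" "p = g i (s / side_length dist v i)" by (auto simp: c_def)
      have "s / side_length dist v i \<in> {0..1}" using s(1) by (auto simp: divide_le_eq_1)
      from ageo_in_ball[OF g(1)[OF that] g(2)[OF that] g(3)[OF that] this]
      have "p \<in> ball w (2 * \<rho>)" using s by simp
      then show "p \<in> V" using e by (auto simp: \<rho>_def)
    qed
    ultimately have cat: "CAT_inequality \<kappa> v c" by (rule tri)
    have v: "v 0 = x" "v 1 = y" "v 2 = z" by (auto simp: v_def)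
    \<comment> \<open>For a degenerate side the quotient is \<open>0 / 0 = 0\<close>, and the
      geodesic is constant.\<close>
    have half: "f' (dist x' y' / 2 / dist x' y') = f' (1/2)" if "ageo f' x' y'" for f' and x' y' :: 'a
    proof (cases "x' = y'")
      case True
      then show ?thesis using ageoD(3)[OF that, of 0 "1/2"] by simp
    qed simp
    have "c 0 (dist x y / 2) = a (1/2)"
      using half[OF a] by (simp add: c_def g_def v_def side_length_def)
    moreover have "c 2 (dist x z / 2) = b (1/2)"
      using half[OF b'] by (simp add: c_def g_def v_def side_length_def dist_commute[of z x])
    ultimately show "dist (a (1/2)) (b (1/2)) \<le> dist y z / 2 \<and>
     (dist (a (1/2)) (b (1/2)) = dist y z / 2 \<longrightarrow>
        dist y z = dist x y + dist x z \<or> dist x y = dist x z + dist y z \<or>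
        dist x z = dist x y + dist y z)"
      using CAT_midpoints[OF assms(1) cat v] by simp
  qed
  ultimately show ?thesis by blast
qed

section \<open>Perturbing the endpoints of a local geodesic\<close>

lemma geometric_Cauchy:
  fixes u :: "nat \<Rightarrow> 'a::metric_space"
  assumes \<theta>: "0 \<le> \<theta>" "\<theta> < 1" and u: "\<And>k. dist (u (Suc k)) (u k) \<le> C * \<theta> ^ k"
  shows "Cauchy u"
proof (rule metric_CauchyI)
  have C: "C \<ge> 0" using order_trans[OF zero_le_dist u[of 0]] by simp
  have B: "dist (u (m + n)) (u m) \<le> C * \<theta> ^ m * (1 - \<theta> ^ n) / (1 - \<theta>)" for m n
  proof (induction n)
    case (Suc n)
    have "dist (u (m + Suc n)) (u m) \<le> C * \<theta> ^ (m + n) + C * \<theta> ^ m * (1 - \<theta> ^ n) / (1 - \<theta>)"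
      using dist_triangle[of "u (m + Suc n)" "u m" "u (m + n)"] u[of "m + n"] Suc by simp
    also have "\<dots> = C * \<theta> ^ m * (1 - \<theta> ^ Suc n) / (1 - \<theta>)"
      using \<theta> by (simp add: field_simps power_add)
    finally show ?case .
  qed simp
  fix e :: real assume "0 < e"
  have "(\<lambda>m. C / (1 - \<theta>) * \<theta> ^ m) \<longlonglongrightarrow> C / (1 - \<theta>) * 0"
    using \<theta> by (intro tendsto_intros LIMSEQ_power_zero) auto
  then have "\<forall>\<^sub>F m in sequentially. C / (1 - \<theta>) * \<theta> ^ m < e / 2"
    by (rule order_tendstoD(2)) (use \<open>0 < e\<close> in simp)
  then obtain M where M: "\<And>m. m \<ge> M \<Longrightarrow> C / (1 - \<theta>) * \<theta> ^ m < e / 2" by (auto simp: eventually_sequentially)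
  have near: "dist (u n) (u M) < e / 2" if "n \<ge> M" for n
  proof -
    have "dist (u (M + (n - M))) (u M) \<le> C * \<theta> ^ M * (1 - \<theta> ^ (n - M)) / (1 - \<theta>)" by (rule B)
    also have "\<dots> \<le> C * \<theta> ^ M * 1 / (1 - \<theta>)"
      using \<theta> C by (intro divide_right_mono mult_left_mono) auto
    also have "\<dots> < e / 2" using M[of M] by simp
    finally show ?thesis using that by simp
  qed
  show "\<exists>M. \<forall>m\<ge>M. \<forall>n\<ge>M. dist (u m) (u n) < e"
    using near dist_triangle_half_l[of _ "u M" e] by (metis dist_commute)
qed

lemma grid_cell:
  fixes t :: real and N :: nat
  assumes "0 < N" "0 \<le> t" "t \<le> 1"
  obtains i where "i < N" "real i \<le> N * t" "N * t \<le> real i + 1"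
proof (cases "t = 1")
  case True
  then show ?thesis using that[of "N - 1"] assms(1) by (simp add: of_nat_diff)
next
  case False
  define i where "i = nat \<lfloor>N * t\<rfloor>"
  have "0 \<le> N * t" using assms by simp
  then have i: "real i = of_int \<lfloor>N * t\<rfloor>" unfolding i_def by simp
  have "real i \<le> N * t" "N * t \<le> real i + 1" unfolding i by linarith+
  moreover have "N * t < N" using False assms by simp
  then have "i < N" using \<open>real i \<le> N * t\<close> by linarith
  ultimately show ?thesis using that by blast
qed

locale complete_geodesic = geodesic_choice G for G :: "'a::metric_space \<Rightarrow> 'a \<Rightarrow> real \<Rightarrow> 'a" +
  assumes complete_UNIV: "complete (UNIV :: 'a set)"
begin

text \<open>Curve shortening in the manner of Birkhoff: all interior points are replaced
  simultaneously by the midpoints of their neighbours, again and again. The chain \<open>x\<close>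
  is reproduced by this operation, so by the midpoint inequality the iterates stay within
  \<open>e\<close> of it, inside the convex balls; the limit is a chain of midpoints.\<close>

lemma midpoint_chain_exists:
  fixes x :: "nat \<Rightarrow> 'a"
  assumes N: "2 \<le> N"
    and npc: "\<And>i. 0 < i \<Longrightarrow> i < N \<Longrightarrow> npc (x i) r"
    and mid: "\<And>i. 0 < i \<Longrightarrow> i < N \<Longrightarrow> \<exists>a. ageo a (x (i - 1)) (x (i + 1)) \<and> a (1/2) = x i"
    and step: "\<And>i. i < N \<Longrightarrow> dist (x i) (x (i + 1)) \<le> s"
    and p: "dist p (x 0) \<le> e" and q: "dist q (x N) \<le> e" and r: "s + e < r"
  obtains y where "y 0 = p" "\<And>i. N \<le> i \<Longrightarrow> y i = q" "\<And>i. i \<le> N \<Longrightarrow> dist (y i) (x i) \<le> e"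
    "\<And>i. 0 < i \<Longrightarrow> i < N \<Longrightarrow> dist (y i) (y (i - 1)) = dist (y (i - 1)) (y (i + 1)) / 2"
    "\<And>i. 0 < i \<Longrightarrow> i < N \<Longrightarrow> dist (y i) (y (i + 1)) = dist (y (i - 1)) (y (i + 1)) / 2"
proof -
  have e: "e \<ge> 0" using p zero_le_dist order_trans by blast
  have s: "s \<ge> 0" using step[of 0] N zero_le_dist[of "x 0" "x (0+1)"] by linarith
  define F where "F y i = (if i = 0 then p else if N \<le> i then q else G (y (i - 1)) (y (i + 1)) (1/2))"
    for y :: "nat \<Rightarrow> 'a" and i
  define Y where "Y k = (F ^^ k) (\<lambda>i. if i = 0 then p else if N \<le> i then q else x i)" for k
  have Y_Suc: "Y (Suc k) = F (Y k)" for k by (simp add: Y_def)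
  have Y_0: "Y k 0 = p" for k by (cases k) (auto simp: Y_def F_def)
  have Y_N: "Y k i = q" if "N \<le> i" for k i using that N by (cases k) (auto simp: Y_def F_def)
  have Y_mid: "Y (Suc k) i = G (Y k (i - 1)) (Y k (i + 1)) (1/2)" if "0 < i" "i < N" for k i
    using that by (simp add: Y_Suc F_def)
  have xball: "x (i - 1) \<in> ball (x i) (r - e)" "x (i + 1) \<in> ball (x i) (r - e)" if "0 < i" "i < N" for i
    using step[of i] step[of "i - 1"] that r less_imp_diff_less[OF that(2), of "Suc 0"] by (simp_all add: dist_commute)
  have ball_mono: "x j \<in> ball (x i) (r - e) \<Longrightarrow> dist z (x j) \<le> e \<Longrightarrow> z \<in> ball (x i) r" for z i j
    using dist_triangle[of "x i" z "x j"] by (auto simp: dist_commute)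
  have near: "dist (Y k i) (x i) \<le> e" if "i \<le> N" for k i
    using that
  proof (induction k arbitrary: i)
    case 0
    show ?case using p q e 0 by (auto simp: Y_def)
  next
    case (Suc k)
    consider "i = 0" | "i = N" | "0 < i" "i < N" using Suc.prems by linarith
    then show ?case
    proof cases
      case 3
      obtain a where a: "ageo a (x (i - 1)) (x (i + 1))" "a (1/2) = x i" using mid[OF 3] by blast
      have IH: "dist (Y k (i - 1)) (x (i - 1)) \<le> e" "dist (Y k (i + 1)) (x (i + 1)) \<le> e"
        using Suc.IH 3 by auto
      have "dist (G (Y k (i - 1)) (Y k (i + 1)) (1/2)) (a (1/2))
          \<le> (dist (Y k (i - 1)) (x (i - 1)) + dist (Y k (i + 1)) (x (i + 1))) / 2"
        using xball[OF 3] IH e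
        by (intro npc_midpoints[OF npc[OF 3] _ _ _ _ ageo_G a(1)])
          (auto intro: ball_mono simp del: mem_ball)
      then show ?thesis unfolding a(2) Y_mid[OF 3] using IH by simp
    qed (use Y_0 Y_N p q in auto)
  qed
  \<comment> \<open>Averaging is no strict contraction for the supremum norm. With the concave
    weight \<open>w\<close>, the mean of the neighbouring weights is \<open>w i - 1\<close>, and
    \<open>w i \<le> W\<close>, so weighted distances shrink by the factor
    \<open>\<theta> = 1 - 1 / W\<close>.\<close>
  define w where "w i = 1 + real i * (real N - real i)" for i
  define W where "W = 1 + real N * real N"
  define \<theta> where "\<theta> = 1 - 1 / W"
  have W: "W \<ge> 1" by (simp add: W_def)
  have \<theta>: "0 \<le> \<theta>" "\<theta> < 1" using W by (auto simp: \<theta>_def)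
  have w: "1 \<le> w i" "w i \<le> W" if "i \<le> N" for i
    using that by (auto simp: w_def W_def intro!: mult_mono)
  have w_mid: "w (i - 1) + w (i + 1) = 2 * (w i - 1)" if "0 < i" for i
    using that by (cases i) (auto simp: w_def algebra_simps)
  have contract: "dist (Y (Suc k) i) (Y k i) \<le> 2 * e * \<theta> ^ k * w i" if "i \<le> N" for k i
    using that
  proof (induction k arbitrary: i)
    case 0
    have "dist (Y (Suc 0) i) (Y 0 i) \<le> 2 * e"
      using near[OF 0, of "Suc 0"] near[OF 0, of 0] dist_triangle2[of "Y (Suc 0) i" "Y 0 i" "x i"] by linarith
    also have "\<dots> \<le> 2 * e * w i" using w(1)[OF 0] e mult_left_mono[of 1 "w i" "2 * e"] by simp
    finally show ?case by simp
  next
    case (Suc k)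
    have nn: "0 \<le> 2 * e * \<theta> ^ Suc k * w i" using e \<theta> w(1)[OF Suc.prems] by simp
    consider "i = 0" | "i = N" | "0 < i" "i < N" using Suc.prems by linarith
    then show ?case
    proof cases
      case 3
      have inb: "Y k' (i - 1) \<in> ball (x i) r" "Y k' (i + 1) \<in> ball (x i) r" for k'
        using ball_mono[OF xball(1)[OF 3] near] ball_mono[OF xball(2)[OF 3] near] 3 by auto
      have "dist (Y (Suc (Suc k)) i) (Y (Suc k) i)
          \<le> (dist (Y (Suc k) (i - 1)) (Y k (i - 1)) + dist (Y (Suc k) (i + 1)) (Y k (i + 1))) / 2"
        unfolding Y_mid[OF 3] by (rule npc_midpoints[OF npc[OF 3] inb inb ageo_G ageo_G])
      also have "\<dots> \<le> (2 * e * \<theta> ^ k * w (i - 1) + 2 * e * \<theta> ^ k * w (i + 1)) / 2"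
        using Suc.IH[of "i - 1"] Suc.IH[of "i + 1"] 3 by (intro divide_right_mono add_mono) auto
      also have "\<dots> = 2 * e * \<theta> ^ k * ((w (i - 1) + w (i + 1)) / 2)" by (simp add: algebra_simps)
      also have "(w (i - 1) + w (i + 1)) / 2 = w i - 1" using w_mid 3 by simp
      also have "2 * e * \<theta> ^ k * (w i - 1) \<le> 2 * e * \<theta> ^ k * (\<theta> * w i)"
      proof (intro mult_left_mono)
        show "w i - 1 \<le> \<theta> * w i" using w(2)[OF Suc.prems] W by (simp add: \<theta>_def left_diff_distrib)
      qed (use e \<theta> in auto)
      finally show ?thesis by (simp add: mult_ac)
    qed (use Y_0 Y_N nn in auto)
  qed
  have "\<exists>z. (\<lambda>k. Y k i) \<longlonglongrightarrow> z" for i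
  proof (cases "i \<le> N")
    case True
    have "Cauchy (\<lambda>k. Y k i)"
      by (rule geometric_Cauchy[OF \<theta>, where C = "2 * e * w i"]) (use contract[OF True] in \<open>simp add: mult_ac\<close>)
    then show ?thesis using complete_UNIV unfolding complete_def by blast
  next
    case False
    then show ?thesis using Y_N[of i] by (auto intro!: exI[of _ q])
  qed
  then obtain y where y: "\<And>i. (\<lambda>k. Y k i) \<longlonglongrightarrow> y i" by metis
  show ?thesis
  proof (rule that)
    show "y 0 = p" using y[of 0] unfolding Y_0 LIMSEQ_const_iff by simp
    show "y i = q" if "N \<le> i" for i using y[of i] unfolding Y_N[OF that] LIMSEQ_const_iff by simp
    show "dist (y i) (x i) \<le> e" if "i \<le> N" for i
      by (rule Lim_bounded[OF tendsto_dist[OF y tendsto_const]]) (use near[OF that] in auto)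
    fix i assume i: "0 < i" "i < N"
    have 1: "dist (Y (Suc k) i) (Y k (i - 1)) = dist (Y k (i - 1)) (Y k (i + 1)) / 2"
      and 2: "dist (Y (Suc k) i) (Y k (i + 1)) = dist (Y k (i - 1)) (Y k (i + 1)) / 2" for k
      using dist_G[of "1/2" 0 "Y k (i - 1)" "Y k (i + 1)"] dist_G[of "1/2" 1 "Y k (i - 1)" "Y k (i + 1)"]
      unfolding Y_mid[OF i] by simp_all
    have L: "(\<lambda>k. dist (Y k (i - 1)) (Y k (i + 1)) / 2) \<longlonglongrightarrow> dist (y (i - 1)) (y (i + 1)) / 2"
      by (intro tendsto_intros y) simp
    have "(\<lambda>k. dist (Y (Suc k) i) (Y k (i - 1))) \<longlonglongrightarrow> dist (y i) (y (i - 1))"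
      by (intro tendsto_intros LIMSEQ_Suc y)
    then show "dist (y i) (y (i - 1)) = dist (y (i - 1)) (y (i + 1)) / 2"
      unfolding 1 using L LIMSEQ_unique by blast
    have "(\<lambda>k. dist (Y (Suc k) i) (Y k (i + 1))) \<longlonglongrightarrow> dist (y i) (y (i + 1))"
      by (intro tendsto_intros LIMSEQ_Suc y)
    then show "dist (y i) (y (i + 1)) = dist (y (i - 1)) (y (i + 1)) / 2"
      unfolding 2 using L LIMSEQ_unique by blast
  qed
qed

text \<open>The midpoint relations make all steps equally long, and two consecutive steps together
  are as long as the distance of their outer ends, so the polygon has no corner.\<close>

lemma midpoint_chain_lgeo:
  fixes y :: "nat \<Rightarrow> 'a"
  assumes N: "2 \<le> N"
    and yN: "\<And>i. N \<le> i \<Longrightarrow> y i = y N"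
    and m1: "\<And>i. 0 < i \<Longrightarrow> i < N \<Longrightarrow> dist (y i) (y (i - 1)) = dist (y (i - 1)) (y (i + 1)) / 2"
    and m2: "\<And>i. 0 < i \<Longrightarrow> i < N \<Longrightarrow> dist (y i) (y (i + 1)) = dist (y (i - 1)) (y (i + 1)) / 2"
  obtains l c where "lgeo l c" "c 0 = y 0" "c 1 = y N"
    "\<And>i (t::real). i < N \<Longrightarrow> real i \<le> N * t \<Longrightarrow> N * t \<le> real i + 1 \<Longrightarrow> dist (c t) (y i) \<le> dist (y 0) (y 1)"
proof -
  define h where "h = dist (y 0) (y 1)"
  define c where "c t = G (y (nat \<lfloor>N * t\<rfloor>)) (y (Suc (nat \<lfloor>N * t\<rfloor>))) (N * t - nat \<lfloor>N * t\<rfloor>)" for t :: real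
  have h: "dist (y i) (y (Suc i)) = h" if "i < N" for i
    using that
  proof (induction i)
    case (Suc i)
    then show ?case using m1[of "Suc i"] m2[of "Suc i"] by (simp add: dist_commute)
  qed (simp add: h_def)
  have c_eq: "c t = G (y i) (y (Suc i)) (N * t - i)" if "real i \<le> N * t" "N * t \<le> real i + 1" "i < N" for i and t :: real
  proof (cases "N * t = real i + 1")
    \<comment> \<open>At the right end of a cell the floor already points to the next one, where the
      parameter is \<open>0\<close>.\<close>
    case True
    then have "\<lfloor>N * t\<rfloor> = int (Suc i)" by (simp add: floor_eq_iff)
    then have "nat \<lfloor>N * t\<rfloor> = Suc i" by (metis nat_int)
    then show ?thesis using True by (simp add: c_def)
  next
    case False
    then have "\<lfloor>N * t\<rfloor> = int i" using that by (simp add: floor_eq_iff)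
    then show ?thesis by (simp add: c_def)
  qed
  have cell: "dist (c s) (c t) = h * N * \<bar>s - t\<bar>"
    if "real i \<le> N * s" "N * s \<le> real i + 1" "real i \<le> N * t" "N * t \<le> real i + 1" "i < N" for i and s t :: real
  proof -
    have "dist (c s) (c t) = h * \<bar>(N * s - i) - (N * t - i)\<bar>"
      unfolding c_eq[OF that(1,2,5)] c_eq[OF that(3,4,5)] h[OF that(5), symmetric] using that by (intro dist_G) auto
    also have "(N * s - i) - (N * t - i) = N * (s - t)" by (simp add: algebra_simps)
    finally show ?thesis by (simp add: abs_mult)
  qed
  have N0: "real N > 0" using N by simp
  have c_y: "c (i / N) = y i" if "i \<le> N" for i
  proof (cases "i = N")
    case True
    then show ?thesis using c_eq[of "N - 1" 1] N by (simp add: of_nat_diff)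
  next
    case False
    then show ?thesis using c_eq[of i "i / N"] that N0 by simp
  qed
  have le: "dist (c s) (c t) = h * N * \<bar>s - t\<bar>" if st: "0 \<le> s" "s \<le> t" "t \<le> 1" "t - s \<le> 1 / N" for s t
  proof -
    obtain i where i: "real i \<le> N * s" "N * s \<le> real i + 1" "i < N"
      using grid_cell[of N s] st N by auto
    show ?thesis
    proof (cases "N * t \<le> real i + 1")
      case True
      have "real i \<le> N * t" using i st N0 by (meson mult_left_mono order_trans less_imp_le)
      then show ?thesis using cell[OF i(1,2) _ True i(3)] by blast
    next
      case False
      have Nt: "N * t \<le> N * s + 1" using st N0 by (simp add: field_simps)
      have "N * t \<le> N" using st N0 by simp
      with False have iN: "Suc i < N" by (metis N0 linorder_not_less of_nat_1 of_nat_add of_nat_le_iff order_trans plus_1_eq_Suc add.commute)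
      have t2: "real (Suc i) \<le> N * t" "N * t \<le> real (Suc i) + 1" using False Nt i by auto
      have a: "dist (c (i / N)) (c s) = h * N * \<bar>i / N - s\<bar>"
        using i N0 by (intro cell[of i]) auto
      have b: "dist (c s) (c (Suc i / N)) = h * N * \<bar>s - Suc i / N\<bar>"
        using i N0 by (intro cell[of i]) auto
      have b': "dist (c (Suc i / N)) (c t) = h * N * \<bar>Suc i / N - t\<bar>"
        using t2 iN N0 by (intro cell[of "Suc i"]) auto
      have a': "dist (c t) (c (Suc (Suc i) / N)) = h * N * \<bar>t - Suc (Suc i) / N\<bar>"
        using t2 iN N0 by (intro cell[of "Suc i"]) auto
      \<comment> \<open>The polygon over the two cells has length \<open>2 * h\<close> as well, so
        the triangle inequalities through \<open>c s\<close> and \<open>c t\<close> cannot be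
        strict.\<close>
      have "dist (c (i / N)) (c (Suc (Suc i) / N)) = 2 * h"
        using m2[of "Suc i"] h[of "Suc i"] iN c_y[of i] c_y[of "Suc (Suc i)"] by (simp del: of_nat_Suc)
      moreover have "\<bar>i / N - s\<bar> = s - i / N" "\<bar>s - Suc i / N\<bar> = Suc i / N - s" "\<bar>Suc i / N - t\<bar> = t - Suc i / N"
         "\<bar>t - Suc (Suc i) / N\<bar> = Suc (Suc i) / N - t" "\<bar>s - t\<bar> = t - s"
        using i t2 N0 st by (auto simp: field_simps)
      ultimately have ineq: "2 * h \<le> h * N * (s - i / N) + dist (c s) (c t) + h * N * (Suc (Suc i) / N - t)"
         "dist (c s) (c t) \<le> h * N * (Suc i / N - s) + h * N * (t - Suc i / N)"
         and st': "\<bar>s - t\<bar> = t - s"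
        using a b a' b' dist_triangle[of "c s" "c t" "c (Suc i / N)"]
          dist_triangle[of "c (i / N)" "c (Suc (Suc i) / N)" "c s"] dist_triangle[of "c s" "c (Suc (Suc i) / N)" "c t"]
        by auto
      have "h * N * (s - i / N) + h * N * (Suc (Suc i) / N - t) = 2 * h - h * N * (t - s)"
        "h * N * (Suc i / N - s) + h * N * (t - Suc i / N) = h * N * (t - s)"
        using N0 by (auto simp: field_simps)
      with ineq show ?thesis unfolding st' by linarith
    qed
  qed
  have "lgeo (h * N) c" unfolding lgeo_def
  proof (intro conjI exI[of _ "1 / N"] ballI impI)
    fix s t :: real assume "s \<in> {0..1}" "t \<in> {0..1}" "\<bar>s - t\<bar> \<le> 1 / N"
    then show "dist (c s) (c t) = h * N * \<bar>s - t\<bar>"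
      using le[of s t] le[of t s] by (cases "s \<le> t") (auto simp: dist_commute abs_minus_commute)
  qed (use N0 in \<open>auto simp: h_def\<close>)
  moreover have "c 0 = y 0" "c 1 = y N" using c_y[of 0] c_y[of N] N0 by auto
  moreover have "dist (c t) (y i) \<le> dist (y 0) (y 1)" if "i < N" "real i \<le> N * t" "N * t \<le> real i + 1" for i and t :: real
  proof -
    have "dist (c t) (y i) = dist (c t) (c (i / N))" using c_y that by simp
    also have "\<dots> = h * N * \<bar>t - i / N\<bar>" using that N0 by (intro cell[of i]) auto
    also have "\<dots> = h * \<bar>N * (t - i / N)\<bar>" using N0 by (simp add: abs_mult)
    also have "N * (t - i / N) = N * t - i" using N0 by (simp add: algebra_simps)
    also have "h * \<bar>N * t - i\<bar> \<le> h * 1" using that by (intro mult_left_mono) (auto simp: h_def)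
    finally show ?thesis by (simp add: h_def)
  qed
  ultimately show ?thesis by (rule that)
qed

lemma lgeo_perturb:
  fixes c :: "real \<Rightarrow> 'a"
  assumes c: "lgeo l c" and npc: "\<And>t. t \<in> {0..1} \<Longrightarrow> npc (c t) r"
    and p: "dist p (c 0) < r / 8" and q: "dist q (c 1) < r / 8"
  obtains l' c' where "lgeo l' c'" "c' 0 = p" "c' 1 = q" "\<And>t. t \<in> {0..1} \<Longrightarrow> dist (c t) (c' t) < r / 2"
proof -
  define e where "e = max (dist p (c 0)) (dist q (c 1))"
  have e: "0 \<le> e" "e < r / 8" using p q by (auto simp: e_def le_max_iff_disj)
  have l: "0 \<le> l" using lgeo_nonneg[OF c] .
  obtain \<epsilon> where \<epsilon>: "\<epsilon> > 0" "\<And>a b. 0 \<le> a \<Longrightarrow> a \<le> b \<Longrightarrow> b \<le> 1 \<Longrightarrow> b - a \<le> \<epsilon> \<Longrightarrow>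
       ageo (\<lambda>t. c (a + t * (b - a))) (c a) (c b) \<and> dist (c a) (c b) = l * (b - a)"
    using lgeo_ageo_piece[OF c] by metis
  \<comment> \<open>\<open>2 / \<epsilon>\<close> makes any two consecutive steps a geodesic;
    \<open>32 * l / r\<close> bounds a step by \<open>r / 32\<close>, so that the total error
    \<open>2 * l / N + 3 * e\<close> stays below \<open>r / 2\<close>.\<close>
  obtain N :: nat where Nb: "real N > max 2 (max (2 / \<epsilon>) (32 * l / r))" using reals_Archimedean2 by blast
  have r: "r > 0" using e by simp
  have N: "2 \<le> N" and N0: "real N > 0" using Nb by auto
  have N\<epsilon>: "2 / N \<le> \<epsilon>" using Nb \<epsilon> N0 by (simp add: field_simps)
  have lN: "l / N < r / 32" using Nb r N0 by (simp add: field_simps)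
  define x where "x i = c (real i / N)" for i :: nat
  have step: "dist (x i) (x (i + 1)) \<le> l / N" if "i < N" for i
    unfolding x_def using lgeo_dist_le[OF c, of "i / N" "(i + 1) / N"] that N0
    by (simp add: field_simps)
  have mid: "\<exists>a. ageo a (x (i - 1)) (x (i + 1)) \<and> a (1/2) = x i" if "0 < i" "i < N" for i
  proof -
    have d: "real (i + 1) / N - real (i - 1) / N = 2 / N" using that N0 by (simp add: of_nat_diff field_simps)
    have "ageo (\<lambda>t. c (real (i - 1) / N + t * (real (i + 1) / N - real (i - 1) / N))) (x (i - 1)) (x (i + 1))"
      unfolding x_def using \<epsilon>(2)[of "real (i - 1) / N" "real (i + 1) / N"] that N0 N\<epsilon>
      unfolding d by (simp add: divide_right_mono)
    moreover have "real (i - 1) / N + 1/2 * (real (i + 1) / N - real (i - 1) / N) = real i / N"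
      using that N0 by (simp add: of_nat_diff field_simps)
    ultimately show ?thesis unfolding x_def
      by (intro exI[of _ "\<lambda>t. c (real (i - 1) / N + t * (real (i + 1) / N - real (i - 1) / N))"]) simp
  qed
  have x0: "x 0 = c 0" and xN: "x N = c 1" using N0 by (auto simp: x_def)
  obtain y where y: "y 0 = p" "\<And>i. N \<le> i \<Longrightarrow> y i = q" "\<And>i. i \<le> N \<Longrightarrow> dist (y i) (x i) \<le> e"
    "\<And>i. 0 < i \<Longrightarrow> i < N \<Longrightarrow> dist (y i) (y (i - 1)) = dist (y (i - 1)) (y (i + 1)) / 2"
    "\<And>i. 0 < i \<Longrightarrow> i < N \<Longrightarrow> dist (y i) (y (i + 1)) = dist (y (i - 1)) (y (i + 1)) / 2"
  proof -
    have 1: "npc (x i) r" if "0 < i" "i < N" for i using that by (auto simp: x_def intro!: npc)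
    have 2: "dist p (x 0) \<le> e" "dist q (x N) \<le> e" by (auto simp: e_def x0 xN)
    have 3: "l / N + e < r" using lN e r by linarith
    show thesis by (rule midpoint_chain_exists[OF N 1 mid step 2 3]) (use that in blast)+
  qed
  have yN: "y i = y N" if "N \<le> i" for i using y(2)[OF that] y(2)[of N] by simp
  obtain l' c' where c': "lgeo l' c'" "c' 0 = y 0" "c' 1 = y N"
    "\<And>i (t::real). i < N \<Longrightarrow> real i \<le> N * t \<Longrightarrow> N * t \<le> real i + 1 \<Longrightarrow> dist (c' t) (y i) \<le> dist (y 0) (y 1)"
    using midpoint_chain_lgeo[OF N yN y(4,5)] by metis
  have h: "dist (y 0) (y 1) \<le> l / N + 2 * e"
    using y(3)[of 0] y(3)[of 1] step[of 0] N dist_triangle[of "y 0" "y 1" "x 0"] dist_triangle[of "x 0" "y 1" "x 1"]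
    by (simp add: dist_commute)
  have "dist (c t) (c' t) < r / 2" if t: "t \<in> {0..1}" for t
  proof -
    obtain i where i: "real i \<le> N * t" "N * t \<le> real i + 1" "i < N"
      using grid_cell[of N t] t N by auto
    have "dist (c t) (x i) \<le> l * \<bar>t - i / N\<bar>"
      unfolding x_def using t i N0 by (intro lgeo_dist_le[OF c]) auto
    also have "\<dots> \<le> l * (1 / N)"
    proof (intro mult_left_mono l)
      have "i / N \<le> t" "t \<le> (i + 1) / N" using i N0 by (simp_all add: divide_le_eq le_divide_eq mult.commute)
      then show "\<bar>t - i / N\<bar> \<le> 1 / N" by (simp add: add_divide_distrib)
    qed
    finally have "dist (c t) (x i) \<le> l / N" by simp
    moreover have "dist (x i) (y i) \<le> e" using y(3)[of i] i by (simp add: dist_commute)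
    moreover have "dist (y i) (c' t) \<le> l / N + 2 * e" using c'(4)[OF i(3,1,2)] h by (simp add: dist_commute)
    moreover have "dist (c t) (c' t) \<le> dist (c t) (x i) + dist (x i) (y i) + dist (y i) (c' t)"
      using dist_triangle[of "c t" "c' t" "y i"] dist_triangle[of "c t" "y i" "x i"] by linarith
    ultimately show ?thesis using lN e by linarith
  qed
  then show ?thesis using that c' y(1) y(2)[of N] by auto
qed

end

section \<open>Lengths, uniqueness and betweenness in a convex ball\<close>

lemma lgeo_length_unique:
  assumes "lgeo l c" "lgeo l' c'" "\<And>t. t \<in> {0..1} \<Longrightarrow> c t = c' t"
  shows "l = l'"
proof -
  obtain e where e: "e > 0" "\<And>s t. s \<in> {0..1} \<Longrightarrow> t \<in> {0..1} \<Longrightarrow> \<bar>s - t\<bar> \<le> e \<Longrightarrow> dist (c s) (c t) = l * \<bar>s - t\<bar>"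
    using assms(1) unfolding lgeo_def by blast
  obtain e' where e': "e' > 0" "\<And>s t. s \<in> {0..1} \<Longrightarrow> t \<in> {0..1} \<Longrightarrow> \<bar>s - t\<bar> \<le> e' \<Longrightarrow> dist (c' s) (c' t) = l' * \<bar>s - t\<bar>"
    using assms(2) unfolding lgeo_def by blast
  define d where "d = min 1 (min e e')"
  have d: "0 < d" "d \<le> 1" "d \<le> e" "d \<le> e'" using e e' by (auto simp: d_def)
  have "dist (c 0) (c d) = l * d" "dist (c' 0) (c' d) = l' * d" using e(2)[of 0 d] e'(2)[of 0 d] d by auto
  then show ?thesis using assms(3)[of 0] assms(3)[of d] d by auto
qed

text \<open>Near the common starting point, the distance from it is the speed times the parameter.
  Curves that separate at rate at most \<open>m\<close> therefore have speeds differing by at most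
  \<open>m\<close>.\<close>

lemma lgeo_length_diff:
  assumes "lgeo l c" "lgeo l' c'" "c 0 = c' 0" "\<And>t. t \<in> {0..1} \<Longrightarrow> dist (c t) (c' t) \<le> t * m"
  shows "\<bar>l - l'\<bar> \<le> m"
proof -
  obtain e where e: "e > 0" "\<And>s t. s \<in> {0..1} \<Longrightarrow> t \<in> {0..1} \<Longrightarrow> \<bar>s - t\<bar> \<le> e \<Longrightarrow> dist (c s) (c t) = l * \<bar>s - t\<bar>"
    using assms(1) unfolding lgeo_def by blast
  obtain e' where e': "e' > 0" "\<And>s t. s \<in> {0..1} \<Longrightarrow> t \<in> {0..1} \<Longrightarrow> \<bar>s - t\<bar> \<le> e' \<Longrightarrow> dist (c' s) (c' t) = l' * \<bar>s - t\<bar>"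
    using assms(2) unfolding lgeo_def by blast
  define d where "d = min 1 (min e e')"
  have d: "0 < d" "d \<le> 1" "d \<le> e" "d \<le> e'" using e e' by (auto simp: d_def)
  have 1: "dist (c 0) (c d) = l * d" "dist (c 0) (c' d) = l' * d" using e(2)[of 0 d] e'(2)[of 0 d] d assms(3) by auto
  have 2: "dist (c d) (c' d) \<le> d * m" using assms(4) d by simp
  have "l * d \<le> (l' + m) * d" "l' * d \<le> (l + m) * d"
    using 1 2 dist_triangle[of "c 0" "c d" "c' d"] dist_triangle[of "c 0" "c' d" "c d"]
    by (auto simp: dist_commute algebra_simps)
  then show ?thesis using d(1) by (auto simp: abs_le_iff)
qed

lemma lgeo_rev: "lgeo l c \<Longrightarrow> lgeo l (\<lambda>t. c (1 - t))"
  unfolding lgeo_def by (auto simp: abs_minus_commute)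

lemma lipschitz_imp_ageo:
  assumes "a 0 = x" "a 1 = y"
    and lip: "\<And>s t. 0 \<le> s \<Longrightarrow> s \<le> t \<Longrightarrow> t \<le> 1 \<Longrightarrow> dist (a s) (a t) \<le> dist x y * (t - s)"
  shows "ageo a x y"
proof -
  have *: "dist (a s) (a t) = dist x y * (t - s)" if "0 \<le> s" "s \<le> t" "t \<le> 1" for s t
  proof -
    have "dist x y \<le> dist (a 0) (a s) + dist (a s) (a t) + dist (a t) (a 1)"
      using assms(1,2) dist_triangle[of x y "a s"] dist_triangle[of "a s" y "a t"] by simp
    then show ?thesis using lip[of s t] lip[of 0 s] lip[of t 1] that by (simp add: algebra_simps)
  qed
  then have "dist (a s) (a t) = dist x y * \<bar>s - t\<bar>" if "s \<in> {0..1}" "t \<in> {0..1}" for s t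
    using that *[of s t] *[of t s] dist_commute[of "a s" "a t"] by (cases "s \<le> t") auto
  then show ?thesis unfolding ageo_def using assms(1,2) by auto
qed

context complete_geodesic
begin

lemma lgeo_ball_unique:
  fixes c c' :: "real \<Rightarrow> 'a"
  assumes "npc w \<rho>" "lgeo l c" "lgeo l' c'" "c 0 = c' 0" "c 1 = c' 1"
    and "\<And>t. t \<in> {0..1} \<Longrightarrow> c t \<in> ball w \<rho>" "\<And>t. t \<in> {0..1} \<Longrightarrow> c' t \<in> ball w \<rho>"
    and t: "t \<in> {0..1}"
  shows "c t = c' t"
proof -
  have "dist (c t) (c' t) \<le> (1 - t) * dist (c 0) (c' 0) + t * dist (c 1) (c' 1)"
    using assms(1,6,7) by (intro lgeo_dist_convex[OF assms(2,3) _ t] exI[of _ w] exI[of _ \<rho>]) auto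
  then show ?thesis by (simp add: assms)
qed

text \<open>\<open>G\<close> between the same ends stays in the ball of twice the radius, where
  local geodesics with common ends coincide.\<close>

lemma lgeo_ball_imp_ageo:
  fixes c :: "real \<Rightarrow> 'a"
  assumes "npc w (2 * \<rho>)" "lgeo l c" "\<And>t. t \<in> {0..1} \<Longrightarrow> c t \<in> ball w \<rho>"
  shows "ageo c (c 0) (c 1)" "dist (c 0) (c 1) = l"
proof -
  have eq: "c t = G (c 0) (c 1) t" if "t \<in> {0..1}" for t
  proof (rule lgeo_ball_unique[OF assms(1,2) ageo_imp_lgeo[OF ageo_G] _ _ _ _ that])
    show "c s \<in> ball w (2 * \<rho>)" if "s \<in> {0..1}" for s
      using assms(3)[OF that] zero_le_dist[of w "c s"] unfolding mem_ball by linarith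
    show "G (c 0) (c 1) s \<in> ball w (2 * \<rho>)" if "s \<in> {0..1}" for s
      by (rule ageo_in_ball[OF ageo_G _ _ that]) (auto intro: assms(3) simp del: mem_ball)
  qed auto
  have "dist (c s) (c t) = dist (c 0) (c 1) * \<bar>s - t\<bar>" if "s \<in> {0..1}" "t \<in> {0..1}" for s t
    unfolding eq[OF that(1)] eq[OF that(2)] using that by (intro dist_G) auto
  then show "ageo c (c 0) (c 1)" unfolding ageo_def by blast
  from lgeo_length_unique[OF ageo_imp_lgeo[OF this] assms(2)] show "dist (c 0) (c 1) = l" by simp
qed

text \<open>The constant curve at \<open>w\<close> is a geodesic of speed zero, so the distance to
  \<open>w\<close> is convex along \<open>a\<close>.\<close>

lemma ball_geodesically_convex:
  fixes w x y :: 'a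
  assumes "npc w (2 * \<rho>)" "x \<in> ball w \<rho>" "y \<in> ball w \<rho>" "ageo a x y" "t \<in> {0..1}"
  shows "a t \<in> ball w (\<rho>::real)"
proof -
  have \<rho>: "\<rho> > 0" using assms(2) zero_le_dist[of w x] unfolding mem_ball by linarith
  have "dist w (a t) \<le> (1 - t) * dist w (a 0) + t * dist w (a 1)"
  proof (intro lgeo_dist_convex[OF lgeo_const ageo_imp_lgeo[OF assms(4)] _ assms(5)] exI conjI)
    fix t :: real assume "0 < t" "t < 1"
    show "npc w (2 * \<rho>)" by fact
    show "w \<in> ball w (2 * \<rho>)" using \<rho> by simp
    show "a t \<in> ball w (2 * \<rho>)" using \<open>0 < t\<close> \<open>t < 1\<close> by (intro ageo_in_ball[OF assms(4,2,3)]) auto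
  qed
  also have "\<dots> < \<rho>"
    using assms by (intro convex_bound_lt) (auto dest: ageoD)
  finally show ?thesis by simp
qed

lemma between_imp_ageo:
  fixes x y z :: 'a
  assumes "dist x y + dist y z = dist x z"
  obtains a where "ageo a x z" "a (dist x y / dist x z) = y"
proof (cases "x = y \<or> y = z")
  case True
  then show ?thesis using that[OF ageo_G] by auto
next
  case False
  define d D where "d = dist x y" and "D = dist x z"
  have d: "0 < d" "d < D" "dist y z = D - d"
  proof -
    have "0 < dist x y" "0 < dist y z" using False by auto
    with assms show "0 < d" "d < D" "dist y z = D - d" unfolding d_def D_def by linarith+
  qed
  define a where "a u = (if u * D \<le> d then G x y (u * D / d) else G y z ((u * D - d) / (D - d)))" for u
  have le1: "dist (a s) (a t) \<le> D * (t - s)" if "0 \<le> s" "s \<le> t" "t * D \<le> d" for s t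
  proof -
    have sd: "s * D \<le> d" using that d by (meson mult_right_mono order_trans less_imp_le order_less_trans)
    have "dist (a s) (a t) = d * \<bar>s * D / d - t * D / d\<bar>"
      using that sd d(1) order_less_trans[OF d(1,2)] unfolding a_def d_def
      by (auto intro!: dist_G divide_nonneg_nonneg mult_nonneg_nonneg simp: divide_le_eq_1)
    also have "\<bar>s * D / d - t * D / d\<bar> = D * (t - s) / d"
      using that d by (subst abs_minus_commute, subst abs_of_nonneg) (auto simp: field_simps mult_left_mono)
    finally show ?thesis using d by simp
  qed
  have le2: "dist (a s) (a t) \<le> D * (t - s)" if "d \<le> s * D" "s \<le> t" "t \<le> 1" for s t
  proof -
    have td: "d \<le> t * D" using that d by (meson mult_right_mono order_trans less_imp_le order_less_trans)
    have t1: "t * D \<le> D" "s * D \<le> D" using that d by (auto simp: mult_le_cancel_right2)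
    have eq: "a u = G y z ((u * D - d) / (D - d))" if "d \<le> u * D" for u
      using that d by (cases "u * D = d") (auto simp: a_def)
    have "dist (a s) (a t) = (D - d) * \<bar>(s * D - d) / (D - d) - (t * D - d) / (D - d)\<bar>"
      unfolding eq[OF that(1)] eq[OF td] d(3)[symmetric] using that td t1 d by (intro dist_G) auto
    also have "\<bar>(s * D - d) / (D - d) - (t * D - d) / (D - d)\<bar> = D * (t - s) / (D - d)"
      using that d by (subst abs_minus_commute, subst abs_of_nonneg)
        (auto simp: mult_right_mono diff_divide_distrib[symmetric] algebra_simps intro!: divide_right_mono)
    finally show ?thesis using d by simp
  qed
  have ends: "a 0 = x" "a 1 = z" "a (d / D) = y" using d by (auto simp: a_def)
  have "ageo a x z"
  proof (rule lipschitz_imp_ageo)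
    fix s t :: real assume st: "0 \<le> s" "s \<le> t" "t \<le> 1"
    consider "t * D \<le> d" | "d \<le> s * D" | "s * D \<le> d" "d \<le> t * D" by linarith
    then show "dist (a s) (a t) \<le> dist x z * (t - s)" unfolding D_def[symmetric]
    proof cases
      case 3
      have dD: "d / D * D = d" "s \<le> d / D" "d / D \<le> t" using 3 d by (auto simp: field_simps)
      have "dist (a s) (a (d / D)) \<le> D * (d / D - s)" using dD st by (intro le1) auto
      moreover have "dist (a (d / D)) (a t) \<le> D * (t - d / D)" using dD st by (intro le2) auto
      moreover have "D * (d / D - s) + D * (t - d / D) = D * (t - s)" by (simp add: algebra_simps)
      ultimately show "dist (a s) (a t) \<le> D * (t - s)"
        using dist_triangle[of "a s" "a t" "a (d / D)"] by linarith
    qed (use st le1 le2 in auto)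
  qed (use ends in auto)
  then show ?thesis using that ends(3) by (simp add: d_def D_def)
qed

text \<open>Equality in the triangle inequality puts \<open>y\<close> on some geodesic from
  \<open>x\<close> to \<open>z\<close>, and there is only one. In this way the strip argument
  locates points by their distances.\<close>

lemma between_unique:
  fixes w x y z :: 'a
  assumes "npc w (2 * \<rho>)" "x \<in> ball w \<rho>" "z \<in> ball w \<rho>"
    and "dist x y + dist y z = dist x z" "ageo b x z"
  shows "y = b (dist x y / dist x z)"
proof -
  obtain a where a: "ageo a x z" "a (dist x y / dist x z) = y" using between_imp_ageo[OF assms(4)] by blast
  have "a t = b t" if "t \<in> {0..1}" for t
  proof (rule lgeo_ball_unique[OF assms(1) ageo_imp_lgeo[OF a(1)] ageo_imp_lgeo[OF assms(5)] _ _ _ _ that])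
    show "a 0 = b 0" "a 1 = b 1" by (simp_all add: ageoD(1,2)[OF a(1)] ageoD(1,2)[OF assms(5)])
    show "a s \<in> ball w (2 * \<rho>)" "b s \<in> ball w (2 * \<rho>)" if "s \<in> {0..1}" for s
      using ageo_in_ball[OF a(1) assms(2,3) that] ageo_in_ball[OF assms(5,2,3) that] .
  qed
  moreover have "dist x y / dist x z \<in> {0..1}"
  proof -
    have "dist x y \<le> dist x z" using assms(4) zero_le_dist[of y z] by linarith
    then show ?thesis by (simp add: divide_le_eq_1)
  qed
  ultimately show ?thesis using a(2) by metis
qed

end

section \<open>Continuation of local geodesics\<close>

text \<open>\<open>K\<close> is a number of continuation steps for which each step moves the endpoints by less than
  \<open>r / 16\<close>, within the range of \<open>lgeo_perturb\<close>.\<close>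

locale tube = complete_geodesic G for G :: "'a::metric_space \<Rightarrow> 'a \<Rightarrow> real \<Rightarrow> 'a" +
  fixes l0 :: real and c0 :: "real \<Rightarrow> 'a" and x0 :: 'a and \<rho> r :: real and K :: nat
  assumes c0: "lgeo l0 c0"
    and npc_x0: "npc x0 (2 * \<rho>)"
    and c0_ends: "c0 0 \<in> ball x0 \<rho>" "c0 1 \<in> ball x0 \<rho>"
    and tube_npc: "\<And>t z. t \<in> {0..1} \<Longrightarrow> dist (c0 t) z \<le> 2 * \<rho> \<Longrightarrow> npc z r"
    and r_pos: "0 < r"
    and K: "32 * \<rho> < K * r"
begin

text \<open>Discrete continuation: curve \<open>k\<close> has its ends at parameter
  \<open>k / K\<close> on the geodesics from \<open>c0 0\<close> to \<open>p\<close> and from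
  \<open>c0 1\<close> to \<open>q\<close>. Local geodesics with given ends need not be unique; the
  bound \<open>r / 2\<close> between successive curves singles out the branch.\<close>

definition chain :: "(nat \<Rightarrow> real \<Rightarrow> 'a) \<Rightarrow> 'a \<Rightarrow> 'a \<Rightarrow> nat \<Rightarrow> bool" where
  "chain f p q m \<longleftrightarrow> f 0 = c0 \<and>
     (\<forall>k\<le>m. (\<exists>l. lgeo l (f k)) \<and> f k 0 = G (c0 0) p (k / K) \<and> f k 1 = G (c0 1) q (k / K)) \<and>
     (\<forall>k<m. \<forall>t\<in>{0..1}. dist (f k t) (f (Suc k) t) < r / 2)"

lemma \<rho>_pos: "0 < \<rho>" using c0_ends(1) zero_le_dist[of x0 "c0 0"] unfolding mem_ball by linarith

lemma K_pos: "0 < real K"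
  using K \<rho>_pos r_pos by (cases "K = 0") auto

lemma ball_dist: "p \<in> ball x0 \<rho> \<Longrightarrow> q \<in> ball x0 \<rho> \<Longrightarrow> dist p q < 2 * \<rho>"
  using dist_triangle3[of p q x0] by auto

lemma G_ball: "p \<in> ball x0 \<rho> \<Longrightarrow> q \<in> ball x0 \<rho> \<Longrightarrow> 0 \<le> t \<Longrightarrow> t \<le> 1 \<Longrightarrow> G p q t \<in> ball x0 \<rho>"
  using ball_geodesically_convex[OF npc_x0 _ _ ageo_G] by auto

lemma step_small: "2 * \<rho> / K < r / 16"
  using K K_pos by (simp add: field_simps)

lemma G_step:
  assumes "p \<in> ball x0 \<rho>" "q \<in> ball x0 \<rho>" "k < K"
  shows "dist (G p q (real k / K)) (G p q (real (Suc k) / K)) \<le> 2 * \<rho> / K"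
proof -
  have "dist (G p q (real k / K)) (G p q (real (Suc k) / K)) = dist p q * \<bar>real k / K - real (Suc k) / K\<bar>"
    using assms K_pos by (intro dist_G) auto
  also have "\<bar>real k / K - real (Suc k) / K\<bar> = 1 / K" using K_pos by (simp add: diff_divide_distrib[symmetric])
  also have "dist p q * (1 / K) \<le> 2 * \<rho> / K" using ball_dist[OF assms(1,2)] K_pos by (simp add: divide_right_mono)
  finally show ?thesis .
qed

lemma lgeo_close_dist:
  fixes c c' :: "real \<Rightarrow> 'a"
  assumes "lgeo l c" "lgeo l' c'" "\<And>t. t \<in> {0..1} \<Longrightarrow> npc (c t) r"
    "\<And>t. t \<in> {0..1} \<Longrightarrow> dist (c t) (c' t) < r" "t \<in> {0..1}"
  shows "dist (c t) (c' t) \<le> (1 - t) * dist (c 0) (c' 0) + t * dist (c 1) (c' 1)"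
  using assms r_pos
  by (intro lgeo_dist_convex[OF assms(1,2) _ assms(5)]) (metis atLeastAtMost_iff less_imp_le centre_in_ball mem_ball)

lemma convex_combination_le:
  fixes t a b M :: real
  assumes "t \<in> {0..1}" "a \<le> M" "b \<le> M" shows "(1 - t) * a + t * b \<le> M"
  using assms by (intro convex_bound_le) auto

text \<open>Bootstrapping: the crude bound \<open>r / 2\<close> gives access to convexity, which
  sharpens it to the motion \<open>2 * \<rho> / K\<close> of the ends. Over at most \<open>K\<close>
  steps this adds up to at most \<open>2 * \<rho>\<close>, so the curves never leave the region
  where \<open>tube_npc\<close> provides the radius \<open>r\<close>.\<close>

lemma chain_near:
  assumes f: "chain f p q m" and pq: "p \<in> ball x0 \<rho>" "q \<in> ball x0 \<rho>" and m: "m \<le> K"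
  shows "k \<le> m \<Longrightarrow> t \<in> {0..1} \<Longrightarrow> dist (c0 t) (f k t) \<le> k * (2 * \<rho> / K)"
    and "k < m \<Longrightarrow> t \<in> {0..1} \<Longrightarrow> dist (f k t) (f (Suc k) t) \<le> 2 * \<rho> / K"
proof -
  have step: "dist (f k t) (f (Suc k) t) \<le> 2 * \<rho> / K"
    if k: "k < m" and t: "t \<in> {0..1}" and near: "\<And>t. t \<in> {0..1} \<Longrightarrow> dist (c0 t) (f k t) \<le> k * (2 * \<rho> / K)" for k t
  proof -
    have kK: "k * (2 * \<rho> / K) \<le> 2 * \<rho>" using k m K_pos \<rho>_pos by (simp add: divide_le_eq)
    obtain l l' where l: "lgeo l (f k)" "lgeo l' (f (Suc k))"
      using f k unfolding chain_def by (metis Suc_leI less_imp_le)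
    have "dist (f k t) (f (Suc k) t) \<le> (1 - t) * dist (f k 0) (f (Suc k) 0) + t * dist (f k 1) (f (Suc k) 1)"
    proof (rule lgeo_close_dist[OF l _ _ t])
      show "npc (f k s) r" if "s \<in> {0..1}" for s using tube_npc[OF that] near[OF that] kK by auto
      show "dist (f k s) (f (Suc k) s) < r" if "s \<in> {0..1}" for s
        using f k that r_pos unfolding chain_def by (smt (verit) field_sum_of_halves)
    qed
    also have "\<dots> \<le> 2 * \<rho> / K"
    proof (rule convex_combination_le[OF t])
      show "dist (f k 0) (f (Suc k) 0) \<le> 2 * \<rho> / K" "dist (f k 1) (f (Suc k) 1) \<le> 2 * \<rho> / K"
        using f k m G_step[OF c0_ends(1) pq(1), of k] G_step[OF c0_ends(2) pq(2), of k] unfolding chain_def by auto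
    qed
    finally show ?thesis .
  qed
  have near: "\<forall>t\<in>{0..1}. dist (c0 t) (f k t) \<le> k * (2 * \<rho> / K)" if "k \<le> m" for k
    using that
  proof (induction k)
    case 0
    then show ?case using f by (simp add: chain_def)
  next
    case (Suc k)
    show ?case
    proof
      fix t :: real assume t: "t \<in> {0..1}"
      have "dist (c0 t) (f (Suc k) t) \<le> k * (2 * \<rho> / K) + 2 * \<rho> / K"
        using Suc t step[of k t] dist_triangle[of "c0 t" "f (Suc k) t" "f k t"] by force
      then show "dist (c0 t) (f (Suc k) t) \<le> Suc k * (2 * \<rho> / K)" by (simp add: algebra_simps add_divide_distrib)
    qed
  qed
  then show "k \<le> m \<Longrightarrow> t \<in> {0..1} \<Longrightarrow> dist (c0 t) (f k t) \<le> k * (2 * \<rho> / K)" by blast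
  show "k < m \<Longrightarrow> t \<in> {0..1} \<Longrightarrow> dist (f k t) (f (Suc k) t) \<le> 2 * \<rho> / K"
    using step near by auto
qed

lemma chain_npc:
  assumes f: "chain f p q m" and pq: "p \<in> ball x0 \<rho>" "q \<in> ball x0 \<rho>" and m: "m \<le> K"
    and "k \<le> m" "t \<in> {0..1}"
  shows "npc (f k t) r"
proof -
  have "k * (2 * \<rho> / K) \<le> 2 * \<rho>" using assms K_pos \<rho>_pos by (simp add: divide_le_eq)
  then show ?thesis using chain_near(1)[OF assms(1-6)] tube_npc[OF assms(6)] by simp
qed

lemma chain_exists:
  assumes pq: "p \<in> ball x0 \<rho>" "q \<in> ball x0 \<rho>" and "m \<le> K"
  shows "\<exists>f. chain f p q m"
  using assms(3)
proof (induction m)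
  case 0
  show ?case using c0 by (intro exI[of _ "\<lambda>_. c0"]) (auto simp: chain_def)
next
  case (Suc m)
  then obtain f where f: "chain f p q m" by auto
  have m: "m < K" "m \<le> K" using Suc by auto
  obtain l where l: "lgeo l (f m)" using f unfolding chain_def by blast
  have ends: "f m 0 = G (c0 0) p (m / K)" "f m 1 = G (c0 1) q (m / K)" using f unfolding chain_def by auto
  have "dist (G (c0 0) p (Suc m / K)) (f m 0) < r / 8" "dist (G (c0 1) q (Suc m / K)) (f m 1) < r / 8"
    using G_step[OF c0_ends(1) pq(1) m(1)] G_step[OF c0_ends(2) pq(2) m(1)] step_small r_pos
    unfolding ends by (auto simp: dist_commute simp del: of_nat_Suc)
  from lgeo_perturb[OF l chain_npc[OF f pq m(2) order_refl] this]
  obtain l' c' where c': "lgeo l' c'" "c' 0 = G (c0 0) p (Suc m / K)" "c' 1 = G (c0 1) q (Suc m / K)"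
    "\<And>t. t \<in> {0..1} \<Longrightarrow> dist (f m t) (c' t) < r / 2" by metis
  have "chain (f(Suc m := c')) p q (Suc m)"
    using f c' unfolding chain_def by (auto simp: le_Suc_eq less_Suc_eq simp del: of_nat_Suc)
  then show ?case by blast
qed

text \<open>Two steps below \<open>r / 16\<close> and the inductive bound
  \<open>\<eta> < r / 8\<close> keep the next curves closer than \<open>r\<close>; convexity brings
  this back to \<open>\<eta>\<close>, so the error does not accumulate over the \<open>K\<close>
  steps.\<close>

lemma chain_close:
  assumes f: "chain f p q K" and f': "chain f' p' q' K"
    and pq: "p \<in> ball x0 \<rho>" "q \<in> ball x0 \<rho>" "p' \<in> ball x0 \<rho>" "q' \<in> ball x0 \<rho>"
    and \<eta>: "dist p p' \<le> \<eta>" "dist q q' \<le> \<eta>" "\<eta> < r / 8"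
  shows "k \<le> K \<Longrightarrow> t \<in> {0..1} \<Longrightarrow> dist (f k t) (f' k t) \<le> \<eta>"
proof (induction k arbitrary: t)
  case 0
  show ?case using f f' \<eta> zero_le_dist[of p p'] by (simp add: chain_def del: zero_le_dist)
next
  case (Suc k)
  obtain l l' where l: "lgeo l (f (Suc k))" "lgeo l' (f' (Suc k))"
    using f f' Suc.prems unfolding chain_def by blast
  have k: "k < K" "k \<le> K" using Suc by auto
  have end_le: "dist (G x p1 s) (G x p2 s) \<le> \<eta>"
    if "x \<in> ball x0 \<rho>" "p1 \<in> ball x0 \<rho>" "p2 \<in> ball x0 \<rho>" "dist p1 p2 \<le> \<eta>" "s \<in> {0..1}" for x p1 p2 s
  proof -
    have "dist (G x p1 s) (G x p2 s) \<le> (1 - s) * dist (G x p1 0) (G x p2 0) + s * dist (G x p1 1) (G x p2 1)"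
    proof (intro lgeo_dist_convex[OF ageo_imp_lgeo[OF ageo_G] ageo_imp_lgeo[OF ageo_G] _ that(5)] exI conjI)
      fix t :: real assume t: "0 < t" "t < 1"
      show "npc x0 (2 * \<rho>)" by (rule npc_x0)
      show "G x p1 t \<in> ball x0 (2 * \<rho>)" "G x p2 t \<in> ball x0 (2 * \<rho>)"
        using t that by (auto intro!: ageo_in_ball[OF ageo_G] simp del: mem_ball)
    qed
    also have "\<dots> \<le> \<eta>" using that(4) by (intro convex_combination_le[OF that(5)]) (auto intro: order_trans[OF zero_le_dist])
    finally show ?thesis .
  qed
  have "dist (f (Suc k) t) (f' (Suc k) t) \<le>
      (1 - t) * dist (f (Suc k) 0) (f' (Suc k) 0) + t * dist (f (Suc k) 1) (f' (Suc k) 1)"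
  proof (rule lgeo_close_dist[OF l _ _ Suc.prems(2)])
    show "npc (f (Suc k) s) r" if "s \<in> {0..1}" for s
      using chain_npc[OF f pq(1,2) order_refl Suc.prems(1) that] .
    show "dist (f (Suc k) s) (f' (Suc k) s) < r" if "s \<in> {0..1}" for s
    proof -
      have "dist (f k s) (f (Suc k) s) \<le> 2 * \<rho> / K" "dist (f' k s) (f' (Suc k) s) \<le> 2 * \<rho> / K" "dist (f k s) (f' k s) \<le> \<eta>"
        using chain_near(2)[OF f pq(1,2) order_refl k(1) that] chain_near(2)[OF f' pq(3,4) order_refl k(1) that]
          Suc.IH[OF k(2) that] by auto
      moreover have "dist (f (Suc k) s) (f' (Suc k) s) \<le> dist (f k s) (f (Suc k) s) + dist (f k s) (f' k s) + dist (f' k s) (f' (Suc k) s)"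
        using dist_triangle[of "f (Suc k) s" "f' (Suc k) s" "f k s"] dist_triangle[of "f k s" "f' (Suc k) s" "f' k s"]
        by (simp add: dist_commute)
      ultimately show ?thesis using step_small \<eta>(3) r_pos by linarith
    qed
  qed
  also have "\<dots> \<le> \<eta>"
  proof (rule convex_combination_le[OF Suc.prems(2)])
    have s: "real (Suc k) / real K \<in> {0..1}" using Suc.prems K_pos by auto
    show "dist (f (Suc k) 0) (f' (Suc k) 0) \<le> \<eta>" "dist (f (Suc k) 1) (f' (Suc k) 1) \<le> \<eta>"
      using end_le[OF c0_ends(1) pq(1,3) \<eta>(1) s] end_le[OF c0_ends(2) pq(2,4) \<eta>(2) s] f f' Suc.prems
      unfolding chain_def by auto
  qed
  finally show ?case .
qed

section \<open>The continued geodesics and their lengths\<close>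

text \<open>The choice is harmless: by \<open>chain_close\<close> with \<open>\<eta> = 0\<close>,
  all chains for \<open>p\<close> and \<open>q\<close> agree on \<open>{0..1}\<close>.\<close>

definition sig :: "'a \<Rightarrow> 'a \<Rightarrow> real \<Rightarrow> 'a" where
  "sig p q = (SOME f. chain f p q K) K"

text \<open>Well defined by \<open>lgeo_length_unique\<close>. It may exceed \<open>dist p q\<close>
  and plays the role of the distance in the universal cover between a point over \<open>p\<close>
  and a point over \<open>q\<close>.\<close>

definition len :: "'a \<Rightarrow> 'a \<Rightarrow> real" where
  "len p q = (SOME l. lgeo l (sig p q))"

lemma sig_chain:
  assumes "p \<in> ball x0 \<rho>" "q \<in> ball x0 \<rho>"
  obtains f where "chain f p q K" "sig p q = f K"
  using someI_ex[OF chain_exists[OF assms order_refl]] that unfolding sig_def by blast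

lemma sig_ends:
  assumes "p \<in> ball x0 \<rho>" "q \<in> ball x0 \<rho>"
  shows "sig p q 0 = p" "sig p q 1 = q"
  using K_pos by (rule_tac [!] sig_chain[OF assms]; force simp: chain_def)+

lemma sig_lgeo:
  assumes "p \<in> ball x0 \<rho>" "q \<in> ball x0 \<rho>"
  shows "lgeo (len p q) (sig p q)"
proof -
  obtain f where "chain f p q K" "sig p q = f K" by (rule sig_chain[OF assms])
  then have "\<exists>l. lgeo l (sig p q)" by (auto simp: chain_def)
  then show ?thesis unfolding len_def by (rule someI_ex)
qed

lemma sig_npc:
  assumes "p \<in> ball x0 \<rho>" "q \<in> ball x0 \<rho>" "t \<in> {0..1}"
  shows "npc (sig p q t) r"
proof -
  obtain f where f: "chain f p q K" "sig p q = f K" by (rule sig_chain[OF assms(1,2)])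
  then show ?thesis using chain_npc[OF f(1) assms(1,2) order_refl order_refl assms(3)] by simp
qed

lemma sig_close:
  assumes pq: "p \<in> ball x0 \<rho>" "q \<in> ball x0 \<rho>" "p' \<in> ball x0 \<rho>" "q' \<in> ball x0 \<rho>"
    and "dist p p' < r / 8" "dist q q' < r / 8" and t: "t \<in> {0..1}"
  shows "dist (sig p q t) (sig p' q' t) \<le> (1 - t) * dist p p' + t * dist q q'"
proof -
  obtain f where f: "chain f p q K" "sig p q = f K" by (rule sig_chain[OF assms(1,2)])
  obtain f' where f': "chain f' p' q' K" "sig p' q' = f' K" by (rule sig_chain[OF assms(3,4)])
  have "dist (sig p q s) (sig p' q' s) < r" if "s \<in> {0..1}" for s
  proof -
    have "dist (sig p q s) (sig p' q' s) \<le> max (dist p p') (dist q q')"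
      unfolding f(2) f'(2) using assms by (intro chain_close[OF f(1) f'(1) pq]) (use that in auto)
    then show ?thesis using assms(5,6) r_pos by linarith
  qed
  from lgeo_close_dist[OF sig_lgeo[OF pq(1,2)] sig_lgeo[OF pq(3,4)] sig_npc[OF pq(1,2)] this t]
  show ?thesis by (simp add: sig_ends[OF pq(1,2)] sig_ends[OF pq(3,4)])
qed

text \<open>The restriction to ends closer than \<open>r / 8\<close> is removed by moving both ends
  along \<open>G\<close> inside the convex ball and adding up the local bounds. The result no longer
  involves \<open>r\<close>.\<close>

lemma sig_dist:
  assumes pq: "p \<in> ball x0 \<rho>" "q \<in> ball x0 \<rho>" "p' \<in> ball x0 \<rho>" "q' \<in> ball x0 \<rho>" and t: "t \<in> {0..1}"
  shows "dist (sig p q t) (sig p' q' t) \<le> (1 - t) * dist p p' + t * dist q q'"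
proof -
  define M where "M = (1 - t) * dist p p' + t * dist q q'"
  define F where "F s = sig (G p p' s) (G q q' s) t" for s
  \<comment> \<open>The summand \<open>1\<close> keeps the divisor positive when both ends are
    fixed.\<close>
  define D where "D = dist p p' + dist q q' + 1"
  have D: "D > 0" "dist p p' \<le> D" "dist q q' \<le> D" unfolding D_def by (simp_all add: add_nonneg_pos)
  have "dist (F 0) (F 1) \<le> M * (1 - 0)"
  proof (rule local_lipschitz_imp_lipschitz)
    show "0 < r / 8 / D" using r_pos D by simp
    fix u v :: real assume uv: "0 \<le> u" "u \<le> v" "v \<le> 1" "v - u < r / 8 / D"
    have vu: "D * (v - u) < r / 8" using uv(4) D(1) by (simp add: pos_less_divide_eq mult_ac)
    have d: "dist (G p p' u) (G p p' v) = dist p p' * (v - u)" "dist (G q q' u) (G q q' v) = dist q q' * (v - u)"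
      using uv dist_G[of u v] by auto
    have "dist p p' * (v - u) \<le> D * (v - u)" "dist q q' * (v - u) \<le> D * (v - u)" using D uv by (auto intro: mult_right_mono)
    then have "dist (F u) (F v) \<le> (1 - t) * dist (G p p' u) (G p p' v) + t * dist (G q q' u) (G q q' v)"
      unfolding F_def using vu d uv by (intro sig_close t G_ball pq) auto
    then show "dist (F u) (F v) \<le> M * (v - u)" unfolding d M_def by (simp add: algebra_simps)
  qed simp
  then show ?thesis by (simp add: F_def M_def)
qed

text \<open>Both curves are close to \<open>sig p q\<close>, hence closer than \<open>r\<close> to
  each other, and they share their ends, so convexity identifies them. This is the local step of
  \<open>sig_family\<close>.\<close>

lemma sig_unique:
  assumes y: "lgeo l y" "y 0 \<in> ball x0 \<rho>" "y 1 \<in> ball x0 \<rho>"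
    and pq: "p \<in> ball x0 \<rho>" "q \<in> ball x0 \<rho>"
    and near: "\<And>t. t \<in> {0..1} \<Longrightarrow> dist (sig p q t) (y t) < r / 8" and t: "t \<in> {0..1}"
  shows "sig (y 0) (y 1) t = y t"
proof -
  have "dist p (y 0) < r / 8" "dist q (y 1) < r / 8" using near[of 0] near[of 1] by (simp_all add: sig_ends[OF pq])
  then have le: "dist (sig (y 0) (y 1) s) (sig p q s) \<le> r / 8" if "s \<in> {0..1}" for s
    using sig_close[OF y(2,3) pq _ _ that] convex_combination_le[OF that, of "dist (y 0) p" "r / 8" "dist (y 1) q"]
    by (fastforce simp: dist_commute)
  have "dist (sig (y 0) (y 1) s) (y s) < r" if "s \<in> {0..1}" for s
    using le[OF that] near[OF that] dist_triangle[of "sig (y 0) (y 1) s" "y s" "sig p q s"] r_pos by linarith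
  from lgeo_close_dist[OF sig_lgeo[OF y(2,3)] y(1) sig_npc[OF y(2,3)] this t]
  show ?thesis by (simp add: sig_ends[OF y(2,3)])
qed

lemma sig_base:
  assumes t: "t \<in> {0..1}" shows "sig (c0 0) (c0 1) t = c0 t"
proof -
  obtain f where f: "chain f (c0 0) (c0 1) K" "sig (c0 0) (c0 1) = f K" by (rule sig_chain[OF c0_ends])
  have G_const: "G x x s = x" if "s \<in> {0..1}" for x s
    using dist_G[of s 0 x x] that by simp
  have "\<forall>t\<in>{0..1}. f k t = c0 t" if "k \<le> K" for k
    using that
  proof (induction k)
    case 0
    then show ?case using f by (simp add: chain_def)
  next
    case (Suc k)
    obtain l where l: "lgeo l (f (Suc k))" using f Suc.prems unfolding chain_def by blast
    have s: "real (Suc k) / real K \<in> {0..1}" using Suc.prems K_pos by auto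
    have e: "f (Suc k) 0 = c0 0" "f (Suc k) 1 = c0 1" using f(1) Suc.prems G_const[OF s] unfolding chain_def by auto
    have npc: "npc (c0 t) r" if "t \<in> {0..1}" for t using tube_npc[OF that, of "c0 t"] \<rho>_pos by simp
    have near: "dist (c0 t) (f (Suc k) t) < r" if "t \<in> {0..1}" for t
    proof -
      have "dist (f k t) (f (Suc k) t) < r / 2" using f(1) Suc.prems that unfolding chain_def by auto
      then show ?thesis using Suc that r_pos by auto
    qed
    show ?case using lgeo_close_dist[OF c0 l npc near] by (auto simp: e)
  qed
  then show ?thesis using t f(2) by simp
qed

text \<open>A substitute for the uniqueness of lifts: being the continued geodesic of its own ends
  propagates along a Lipschitz family of local geodesics whose ends stay in the ball. It identifies
  pieces of the given geodesic and subsegments of \<open>sig p q\<close>.\<close>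

lemma sig_family:
  fixes H :: "real \<Rightarrow> real \<Rightarrow> 'a"
  assumes H: "\<And>u. u \<in> {0..1} \<Longrightarrow> \<exists>l. lgeo l (H u)" "\<And>u. u \<in> {0..1} \<Longrightarrow> H u 0 \<in> ball x0 \<rho>"
      "\<And>u. u \<in> {0..1} \<Longrightarrow> H u 1 \<in> ball x0 \<rho>"
    and lip: "\<And>u v t. u \<in> {0..1} \<Longrightarrow> v \<in> {0..1} \<Longrightarrow> t \<in> {0..1} \<Longrightarrow> dist (H u t) (H v t) \<le> C * \<bar>u - v\<bar>"
    and H0: "\<And>t. t \<in> {0..1} \<Longrightarrow> sig (H 0 0) (H 0 1) t = H 0 t"
    and t: "t \<in> {0..1}"
  shows "sig (H 1 0) (H 1 1) t = H 1 t"
proof -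
  define ok where "ok u \<longleftrightarrow> (\<forall>t\<in>{0..1}. sig (H u 0) (H u 1) t = H u t)" for u
  define d where "d = r / 8 / (\<bar>C\<bar> + 1)"
  have d: "d > 0" using r_pos by (simp add: d_def add_nonneg_pos)
  have "0 \<le> (0::real) \<and> (1::real) \<le> 1 \<and> ok 0 \<longrightarrow> ok 1"
  proof (rule Bolzano[where P = "\<lambda>a b. 0 \<le> a \<and> b \<le> 1 \<and> ok a \<longrightarrow> ok b" and a = "0::real" and b = 1])
    fix x :: real
    show "\<exists>d>0. \<forall>a b. a \<le> x \<and> x \<le> b \<and> b - a < d \<longrightarrow> 0 \<le> a \<and> b \<le> 1 \<and> ok a \<longrightarrow> ok b"
    proof (intro exI[of _ d] conjI allI impI d)
      fix a b assume ab: "a \<le> x \<and> x \<le> b \<and> b - a < d" "0 \<le> a \<and> b \<le> 1 \<and> ok a"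
      then have ab': "a \<in> {0..1}" "b \<in> {0..1}" by auto
      obtain l where l: "lgeo l (H b)" using H(1)[OF ab'(2)] by blast
      have "sig (H b 0) (H b 1) t = H b t" if "t \<in> {0..1}" for t
      proof (rule sig_unique[OF l H(2,3)[OF ab'(2)] H(2,3)[OF ab'(1)] _ that])
        fix s :: real assume s: "s \<in> {0..1}"
        have "dist (H a s) (H b s) \<le> C * \<bar>a - b\<bar>" using lip[OF ab' s] .
        also have "\<dots> \<le> (\<bar>C\<bar> + 1) * (b - a)" using ab by (intro mult_mono) auto
        also have "\<dots> < (\<bar>C\<bar> + 1) * d" using ab by (intro mult_strict_left_mono) auto
        also have "\<dots> = r / 8"
        proof -
          have "x * (r / 8 / x) = r / 8" if "x \<noteq> 0" for x :: real using that by simp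
          from this[of "\<bar>C\<bar> + 1"] show ?thesis by (simp add: d_def)
        qed
        finally show "dist (sig (H a 0) (H a 1) s) (H b s) < r / 8" using ab(2) s by (simp add: ok_def)
      qed
      then show "ok b" by (simp add: ok_def)
    qed
  qed auto
  then show ?thesis using H0 t by (simp add: ok_def)
qed

lemma len_eqI:
  assumes "lgeo l y" "y 0 \<in> ball x0 \<rho>" "y 1 \<in> ball x0 \<rho>" "\<And>t. t \<in> {0..1} \<Longrightarrow> sig (y 0) (y 1) t = y t"
  shows "len (y 0) (y 1) = l"
  using lgeo_length_unique[OF sig_lgeo[OF assms(2,3)] assms(1,4)] .

lemma len_diff_right:
  assumes "p \<in> ball x0 \<rho>" "q \<in> ball x0 \<rho>" "q' \<in> ball x0 \<rho>"
  shows "\<bar>len p q - len p q'\<bar> \<le> dist q q'"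
  using sig_dist[OF assms(1,2,1,3)]
  by (intro lgeo_length_diff[OF sig_lgeo sig_lgeo]) (auto simp: assms sig_ends simp del: mem_ball)

lemma len_diff_left:
  assumes "p \<in> ball x0 \<rho>" "q \<in> ball x0 \<rho>" "p' \<in> ball x0 \<rho>"
  shows "\<bar>len p q - len p' q\<bar> \<le> dist p p'"
proof (rule lgeo_length_diff[OF lgeo_rev[OF sig_lgeo] lgeo_rev[OF sig_lgeo]])
  fix t :: real assume "t \<in> {0..1}"
  then show "dist (sig p q (1 - t)) (sig p' q (1 - t)) \<le> t * dist p p'"
    using sig_dist[OF assms(1,2,3,2), of "1 - t"] by simp
qed (auto simp: assms sig_ends simp del: mem_ball)

lemma len_diff:
  assumes "p \<in> ball x0 \<rho>" "q \<in> ball x0 \<rho>" "p' \<in> ball x0 \<rho>" "q' \<in> ball x0 \<rho>"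
  shows "\<bar>len p q - len p' q'\<bar> \<le> dist p p' + dist q q'"
  using len_diff_left[OF assms(1,2,3)] len_diff_right[OF assms(3,2,4)] by linarith

text \<open>A priori, \<open>sig\<close> between two points of \<open>sig p q\<close> could be
  another local geodesic. Shrinking \<open>{0..1}\<close> continuously to \<open>{a..b}\<close>
  excludes this, as the moving ends remain in the ball.\<close>

lemma sig_sub:
  assumes pq: "p \<in> ball x0 \<rho>" "q \<in> ball x0 \<rho>" and ab: "0 \<le> a" "a \<le> b" "b \<le> 1"
    and A: "\<And>u. 0 \<le> u \<Longrightarrow> u \<le> a \<Longrightarrow> sig p q u \<in> ball x0 \<rho>"
    and B: "\<And>u. b \<le> u \<Longrightarrow> u \<le> 1 \<Longrightarrow> sig p q u \<in> ball x0 \<rho>"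
  shows "t \<in> {0..1} \<Longrightarrow> sig (sig p q a) (sig p q b) t = sig p q (a + t * (b - a))"
    and "len (sig p q a) (sig p q b) = (b - a) * len p q"
proof -
  let ?c = "sig p q"
  note c = sig_lgeo[OF pq]
  define al be where "al u = u * a" and "be u = 1 - u * (1 - b)" for u :: real
  have albe: "0 \<le> al u" "al u \<le> a" "b \<le> be u" "be u \<le> 1" "al u \<le> be u" if "u \<in> {0..1}" for u
  proof -
    have "u * a \<le> 1 * a" "u * (1 - b) \<le> 1 * (1 - b)" "0 \<le> u * a" "0 \<le> u * (1 - b)"
      using that ab by (intro mult_right_mono mult_nonneg_nonneg; simp)+
    moreover have "be u + u * (1 - b) = 1" "al u = u * a" by (simp_all add: al_def be_def)
    ultimately have h: "al u \<le> a" "0 \<le> al u" "b \<le> be u" "be u \<le> 1" using ab by simp_all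
    then show "0 \<le> al u" "al u \<le> a" "b \<le> be u" "be u \<le> 1" by auto
    from h ab show "al u \<le> be u" by simp
  qed
  define H where "H u t = ?c (al u + t * (be u - al u))" for u t
  have H0: "H u 0 = ?c (al u)" "H u 1 = ?c (be u)" for u by (simp_all add: H_def)
  have in01: "al u + t * (be u - al u) \<in> {0..1}" if u: "u \<in> {0..1}" and t: "t \<in> {0..1}" for u t
  proof -
    have "t * (be u - al u) \<le> 1 * (be u - al u)" "0 \<le> t * (be u - al u)"
      using t albe[OF u] by (intro mult_right_mono mult_nonneg_nonneg; simp)+
    then show ?thesis using albe[OF u] by auto
  qed
  have *: "sig (H 1 0) (H 1 1) t = H 1 t" if "t \<in> {0..1}" for t
  proof (rule sig_family[where C = "2 * len p q", OF _ _ _ _ _ that])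
    show "\<exists>l. lgeo l (H u)" if "u \<in> {0..1}" for u
      unfolding H_def using lgeo_sub[OF c albe(1,5,4)[OF that]] by blast
    show "H u 0 \<in> ball x0 \<rho>" "H u 1 \<in> ball x0 \<rho>" if "u \<in> {0..1}" for u
      unfolding H0 using A B albe[OF that] by blast+
    show "dist (H u t) (H v t) \<le> 2 * len p q * \<bar>u - v\<bar>" if "u \<in> {0..1}" "v \<in> {0..1}" "t \<in> {0..1}" for u v t
    proof -
      have "dist (H u t) (H v t) \<le> len p q * \<bar>(al u + t * (be u - al u)) - (al v + t * (be v - al v))\<bar>"
        unfolding H_def using that by (intro lgeo_dist_le[OF c] in01)
      also have "(al u + t * (be u - al u)) - (al v + t * (be v - al v)) = (u - v) * ((1 - t) * a - t * (1 - b))"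
        by (simp add: al_def be_def algebra_simps)
      also have "\<bar>\<dots>\<bar> \<le> \<bar>u - v\<bar> * 2"
      proof -
        have "(1 - t) * a \<le> 1 * 1" "t * (1 - b) \<le> 1 * 1" using that ab by (intro mult_mono; auto)+
        moreover have "0 \<le> (1 - t) * a" "0 \<le> t * (1 - b)" using that ab by auto
        ultimately have "\<bar>(1 - t) * a - t * (1 - b)\<bar> \<le> 2" by linarith
        then show ?thesis unfolding abs_mult by (intro mult_left_mono) auto
      qed
      finally show ?thesis using lgeo_nonneg[OF c] by (simp add: mult_left_mono mult_right_mono mult_ac)
    qed
    show "sig (H 0 0) (H 0 1) t = H 0 t" if "t \<in> {0..1}" for t
      using pq by (simp add: H_def al_def be_def sig_ends)
  qed
  then show "t \<in> {0..1} \<Longrightarrow> sig (sig p q a) (sig p q b) t = sig p q (a + t * (b - a))"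
    by (simp add: H_def al_def be_def)
  have "len (H 1 0) (H 1 1) = (b - a) * len p q"
  proof (rule len_eqI[OF _ _ _ *])
    show "lgeo ((b - a) * len p q) (H 1)" unfolding H_def al_def be_def using lgeo_sub[OF c ab] by simp
    show "H 1 0 \<in> ball x0 \<rho>" "H 1 1 \<in> ball x0 \<rho>" unfolding H0 using A[of a] B[of b] ab by (simp_all add: al_def be_def)
  qed
  then show "len (sig p q a) (sig p q b) = (b - a) * len p q" by (simp add: H_def al_def be_def)
qed

end

section \<open>Compactness\<close>

lemma Lebesgue_number_of_balls:
  fixes S :: "'a::metric_space set"
  assumes "compact S" "\<And>x. x \<in> S \<Longrightarrow> 0 < \<rho> x"
  obtains e where "0 < e" "\<And>x. x \<in> S \<Longrightarrow> \<exists>y\<in>S. ball x e \<subseteq> ball y (\<rho> y)"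
proof -
  obtain e where e: "0 < e" "\<And>x. x \<in> S \<Longrightarrow> \<exists>b\<in>(\<lambda>y. ball y (\<rho> y)) ` S. ball x e \<subseteq> b"
  proof (rule Heine_Borel_lemma[OF assms(1)])
    show "S \<subseteq> \<Union> ((\<lambda>y. ball y (\<rho> y)) ` S)" using assms(2) by force
    show "open b" if "b \<in> (\<lambda>y. ball y (\<rho> y)) ` S" for b using that by auto
  qed blast
  from e(2) have "\<exists>y\<in>S. ball x e \<subseteq> ball y (\<rho> y)" if "x \<in> S" for x using that by blast
  with e(1) show ?thesis using that by blast
qed

lemma uniform_npc:
  fixes Z :: "'a::metric_space set"
  assumes "compact Z" "\<And>w::'a. \<exists>\<rho>>0. npc w \<rho>"
  obtains r where "0 < r" "\<And>z. z \<in> Z \<Longrightarrow> npc z r"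
proof -
  obtain \<rho> where \<rho>: "\<And>w::'a. 0 < \<rho> w \<and> npc w (\<rho> w)" using assms(2) by metis
  obtain e where e: "0 < e" "\<And>x. x \<in> Z \<Longrightarrow> \<exists>y\<in>Z. ball x e \<subseteq> ball y (\<rho> y)"
    using Lebesgue_number_of_balls[OF assms(1)] \<rho> by metis
  show ?thesis
  proof (rule that[OF e(1)])
    fix z assume "z \<in> Z"
    then obtain y where "ball z e \<subseteq> ball y (\<rho> y)" using e(2) by blast
    then show "npc z e" using npc_subset[of y "\<rho> y"] \<rho> by blast
  qed
qed

text \<open>The radius in \<open>local_geodesic_on\<close> depends on the time; a Lebesgue number of
  the compact interval makes it uniform.\<close>

lemma local_geodesic_imp_lgeo:
  assumes "local_geodesic_on I \<gamma>" "a < b" "{a..b} \<subseteq> I"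
  shows "lgeo (b - a) (\<lambda>t. \<gamma> (a + t * (b - a)))"
proof -
  obtain \<epsilon> where \<epsilon>: "\<And>t. t \<in> I \<Longrightarrow> 0 < \<epsilon> t"
    "\<And>t u v. t \<in> I \<Longrightarrow> u \<in> {t - \<epsilon> t..t + \<epsilon> t} \<inter> I \<Longrightarrow> v \<in> {t - \<epsilon> t..t + \<epsilon> t} \<inter> I \<Longrightarrow> dist (\<gamma> u) (\<gamma> v) = \<bar>u - v\<bar>"
    using assms(1) unfolding local_geodesic_on_def isometric_embedding_on_def by metis
  obtain e where e: "0 < e" "\<And>x. x \<in> {a..b} \<Longrightarrow> \<exists>y\<in>{a..b}. ball x e \<subseteq> ball y (\<epsilon> y)"
    using Lebesgue_number_of_balls[of "{a..b}" \<epsilon>] \<epsilon>(1) assms(3) by (metis compact_Icc subsetD)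
  have "dist (\<gamma> (a + s * (b - a))) (\<gamma> (a + t * (b - a))) = (b - a) * \<bar>s - t\<bar>"
    if "s \<in> {0..1}" "t \<in> {0..1}" "\<bar>s - t\<bar> \<le> e / (2 * (b - a))" for s t
  proof -
    have in_ab: "a + u * (b - a) \<in> {a..b}" if "u \<in> {0..1}" for u
    proof -
      have "u * (b - a) \<le> 1 * (b - a)" "0 \<le> u * (b - a)"
        using that assms(2) by (intro mult_right_mono mult_nonneg_nonneg; simp)+
      then show ?thesis by simp
    qed
    note st01 = that(1)
    have *: "\<bar>(a + s * (b - a)) - (a + t * (b - a))\<bar> = (b - a) * \<bar>s - t\<bar>"
      using assms(2) by (simp add: abs_mult mult.commute flip: left_diff_distrib)
    have "(b - a) * \<bar>s - t\<bar> \<le> (b - a) * (e / (2 * (b - a)))" using that assms(2) by (intro mult_left_mono) auto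
    also have "\<dots> < e"
    proof -
      have "x * (e / (2 * x)) = e / 2" if "x \<noteq> 0" for x :: real using that by simp
      from this[of "b - a"] show ?thesis using assms(2) e(1) by simp
    qed
    finally have d: "dist (a + s * (b - a)) (a + t * (b - a)) < e" unfolding dist_real_def * .
    obtain y where y: "y \<in> {a..b}" "ball (a + s * (b - a)) e \<subseteq> ball y (\<epsilon> y)" using e(2) in_ab[OF st01] by blast
    have "a + s * (b - a) \<in> ball y (\<epsilon> y)" "a + t * (b - a) \<in> ball y (\<epsilon> y)" using y(2) d e(1) by (meson subsetD centre_in_ball mem_ball)+
    then have "a + s * (b - a) \<in> {y - \<epsilon> y..y + \<epsilon> y} \<inter> I" "a + t * (b - a) \<in> {y - \<epsilon> y..y + \<epsilon> y} \<inter> I"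
      using in_ab[OF that(1)] in_ab[OF that(2)] assms(3) by (auto simp: dist_real_def abs_le_iff)
    from \<epsilon>(2)[OF _ this] y(1) assms(3) show ?thesis unfolding * by auto
  qed
  then show ?thesis unfolding lgeo_def using assms(2) e(1)
    by (intro conjI exI[of _ "e / (2 * (b - a))"]) auto
qed

context complete_geodesic
begin

text \<open>Hopf-Rinow theorem in the form of Cohn-Vossen. For the supremum \<open>S\<close> of the
  radii of compact balls, the ball of radius \<open>S\<close> is totally bounded, because geodesics
  pull its points into slightly smaller balls; a finite cover by compact balls then yields a compact
  ball of radius beyond \<open>S\<close>.\<close>

lemma compact_cball_geodesic:
  assumes "locally compact (UNIV :: 'a set)"
  shows "compact (cball (x::'a) R)"
proof (rule ccontr)
  assume R: "\<not> compact (cball x R)"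
  have mono: "compact (cball y a)" if "compact (cball y b)" "a \<le> b" for y :: 'a and a b
  proof -
    have "cball y a = cball y b \<inter> cball y a" using that(2) by auto
    then show ?thesis using compact_Int_closed[OF that(1) closed_cball] by metis
  qed
  have loc: "\<exists>e>0. compact (cball y e)" for y :: 'a
  proof -
    obtain u v where uv: "open u" "compact v" "y \<in> u" "u \<subseteq> v"
      using assms unfolding locally_def by (metis UNIV_I openin_subtopology_self subtopology_UNIV open_openin topspace_euclidean openin_topspace)
    obtain e where e: "0 < e" "cball y e \<subseteq> u" using open_contains_cball uv by blast
    then have "cball y e = v \<inter> cball y e" using uv by auto
    then show ?thesis using e compact_Int_closed[OF uv(2) closed_cball] by metis
  qed
  define A where "A = {a. compact (cball x a)}"
  have "a \<le> R" if "a \<in> A" for a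
    using R mono[of x a R] that by (cases "a \<le> R") (auto simp: A_def)
  then have bdd: "bdd_above A" by (rule bdd_aboveI)
  have A0: "0 \<in> A" by (simp add: A_def)
  define S where "S = Sup A"
  have S0: "0 \<le> S" unfolding S_def by (rule cSup_upper[OF A0 bdd])
  have shrink: "\<exists>z'\<in>cball x a. dist z' z \<le> b - a" if "0 \<le> a" "a \<le> b" "z \<in> cball x b" for a b z
  proof (cases "dist x z \<le> a")
    case True
    then show ?thesis using that by (intro bexI[of _ z]) auto
  next
    case False
    have d: "dist x z > 0" using False that by linarith
    have q: "0 \<le> a / dist x z" "a / dist x z \<le> 1" using False that d by auto
    have "dist x (G x z (a / dist x z)) = a" "dist (G x z (a / dist x z)) z = dist x z - a"
      using dist_G[of 0 "a / dist x z" x z] dist_G[of "a / dist x z" 1 x z] q d that(1)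
      by (auto simp: right_diff_distrib)
    then show ?thesis using that by (intro bexI[of _ "G x z (a / dist x z)"]) auto
  qed
  have "compact (cball x S)" unfolding compact_eq_totally_bounded
  proof (intro conjI allI impI)
    show "complete (cball x S)" using complete_UNIV closed_cball by (metis complete_Int_closed Int_UNIV_left)
    fix e :: real assume e: "0 < e"
    obtain a' where a': "a' \<in> A" "S - e / 4 < a'"
      using less_cSupE[of "S - e / 4" A] A0 e unfolding S_def by auto
    \<comment> \<open>\<open>a'\<close> may be negative, since balls of negative radius are empty
      and so compact; \<open>shrink\<close> asks for a radius at least \<open>0\<close>.\<close>
    define a where "a = max a' 0"
    have a: "a \<in> A" "S - e / 4 < a" "0 \<le> a" using a' A0 by (auto simp: a_def max_def)
    have aS: "a \<le> S" unfolding S_def by (rule cSup_upper[OF a(1) bdd])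
    have "compact (cball x a)" using a(1) by (simp add: A_def)
    then obtain k where k: "finite k" "cball x a \<subseteq> (\<Union>y\<in>k. ball y (e / 2))"
      unfolding compact_eq_totally_bounded using e half_gt_zero by metis
    have "cball x S \<subseteq> (\<Union>y\<in>k. ball y e)"
    proof
      fix z assume "z \<in> cball x S"
      then obtain z' where z': "z' \<in> cball x a" "dist z' z \<le> S - a" using shrink[OF a(3) aS] by blast
      then obtain y where y: "y \<in> k" "dist y z' < e / 2" using k(2) by auto
      have "dist y z < e" using dist_triangle[of y z z'] y z' a e by linarith
      then show "z \<in> (\<Union>y\<in>k. ball y e)" using y by auto
    qed
    then show "\<exists>k. finite k \<and> cball x S \<subseteq> (\<Union>y\<in>k. ball y e)" using k by blast
  qed
  obtain \<epsilon> where \<epsilon>: "\<And>y::'a. 0 < \<epsilon> y \<and> compact (cball y (\<epsilon> y))" using loc by metis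
  obtain D where D: "D \<subseteq> cball x S" "finite D" "cball x S \<subseteq> (\<Union>y\<in>D. ball y (\<epsilon> y))"
  proof (rule compactE_image[OF \<open>compact (cball x S)\<close>, of "cball x S" "\<lambda>y. ball y (\<epsilon> y)"])
    show "cball x S \<subseteq> (\<Union>y\<in>cball x S. ball y (\<epsilon> y))" using \<epsilon> by force
  qed (use that in auto)
  obtain d where d: "0 < d" "(\<Union>y\<in>cball x S. ball y d) \<subseteq> (\<Union>y\<in>D. ball y (\<epsilon> y))"
    using compact_subset_open_imp_ball_epsilon_subset[OF \<open>compact (cball x S)\<close> _ D(3)] by blast
  have "cball x (S + d / 2) \<subseteq> (\<Union>y\<in>D. cball y (\<epsilon> y))"
  proof
    fix z assume z: "z \<in> cball x (S + d / 2)"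
    have "S \<le> S + d / 2" using d by simp
    then obtain z' where "z' \<in> cball x S" "dist z' z \<le> S + d / 2 - S" using shrink[OF S0 _ z] by blast
    then have "z \<in> (\<Union>y\<in>cball x S. ball y d)" using d by force
    with d(2) show "z \<in> (\<Union>y\<in>D. cball y (\<epsilon> y))" using ball_subset_cball by blast
  qed
  moreover have "compact (\<Union>y\<in>D. cball y (\<epsilon> y))" using D(2) \<epsilon> by (intro compact_UN) auto
  ultimately have "compact (cball x (S + d / 2))"
    by (metis closed_cball compact_Int_closed inf.absorb2)
  then have "S + d / 2 \<le> S" unfolding S_def[symmetric] using cSup_upper[OF _ bdd, of "S + d / 2"] by (simp add: A_def S_def)
  then show False using d by simp
qed

section \<open>Excluding flat strips\<close>

lemma G_dist_le:
  fixes p p' q q' w :: 'a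
  assumes "npc w (2 * \<rho>)" "p \<in> ball w \<rho>" "q \<in> ball w \<rho>" "p' \<in> ball w \<rho>" "q' \<in> ball w \<rho>" "t \<in> {0..1}"
  shows "dist (G p q t) (G p' q' t) \<le> (1 - t) * dist p p' + t * dist q q'"
proof -
  have "dist (G p q t) (G p' q' t) \<le> (1 - t) * dist (G p q 0) (G p' q' 0) + t * dist (G p q 1) (G p' q' 1)"
  proof (intro lgeo_dist_convex[OF ageo_imp_lgeo[OF ageo_G] ageo_imp_lgeo[OF ageo_G] _ assms(6)] exI conjI)
    fix t :: real assume t: "0 < t" "t < 1"
    show "npc w (2 * \<rho>)" by fact
    show "G p q t \<in> ball w (2 * \<rho>)" "G p' q' t \<in> ball w (2 * \<rho>)"
      using t assms by (auto intro!: ageo_in_ball[OF ageo_G] simp del: mem_ball)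
  qed
  then show ?thesis by simp
qed

text \<open>The last two hypotheses say that \<open>Q2\<close> and \<open>Q0\<close> do not come closer than \<open>r\<close> to the
  segment from \<open>P0\<close> to \<open>P2\<close>; they rule out the two degenerate triangles left by the equality case
  of the midpoint inequality, in particular a branching of geodesics.\<close>

lemma no_flat_strip:
  fixes w P0 P1 P2 Q0 Q1 Q2 :: 'a
  assumes npc: "npc w (2 * \<rho>)"
    and ball: "P0 \<in> ball w \<rho>" "P1 \<in> ball w \<rho>" "P2 \<in> ball w \<rho>" "Q0 \<in> ball w \<rho>" "Q1 \<in> ball w \<rho>" "Q2 \<in> ball w \<rho>"
    and r: "0 < r" "r < R"
    and P: "dist P0 P1 = R" "dist P1 P2 = R" "dist P0 P2 = 2 * R"
    and Q: "dist Q0 Q1 = R" "dist Q1 Q2 = R" "dist Q0 Q2 = 2 * R"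
    and PQ: "dist P0 Q0 = r" "dist P1 Q1 = r" "dist P2 Q2 = r"
    and far: "r \<le> dist Q2 (G P0 P2 ((2 * R - r) / (2 * R)))" "r \<le> dist Q0 (G P0 P2 (r / (2 * R)))"
  shows False
proof -
  have big: "x \<in> ball w (2 * \<rho>)" if "x \<in> ball w \<rho>" for x
    using that zero_le_dist[of w x] unfolding mem_ball by linarith
  define z where "z = dist P0 Q2"
  define M where "M = G P0 Q2 (1/2)"
  have P1: "P1 = G P0 P2 (1/2)"
    using between_unique[OF npc ball(1,3) _ ageo_G, of P1] P r by simp
  have Q1: "Q1 = G Q0 Q2 (1/2)"
    using between_unique[OF npc ball(4,6) _ ageo_G, of Q1] Q r by simp
  have 1: "dist P1 M \<le> r / 2"
    using npcD(1)[OF npc big[OF ball(1)] big[OF ball(3)] big[OF ball(6)] ageo_G ageo_G] unfolding P1 M_def PQ .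
  have "dist (G P0 Q2 (1 - 1/2)) (G Q0 Q2 (1 - 1/2)) \<le> dist P0 Q0 / 2"
    by (rule npcD(1)[OF npc big[OF ball(6)] big[OF ball(1)] big[OF ball(4)] ageo_rev[OF ageo_G] ageo_rev[OF ageo_G]])
  then have 2: "dist M Q1 \<le> r / 2" unfolding Q1 M_def PQ by simp
  \<comment> \<open>Two segments of length at most \<open>r / 2\<close> span the width
    \<open>r\<close> of the strip, so the midpoint inequality in the triangle
    \<open>P0 P2 Q2\<close> is an equality and this triangle is degenerate.\<close>
  have "dist P1 M = r / 2" using 1 2 dist_triangle[of P1 Q1 M] PQ(2) by simp
  then have "dist P2 Q2 = dist P0 P2 + dist P0 Q2 \<or> dist P0 P2 = dist P0 Q2 + dist P2 Q2 \<or> dist P0 Q2 = dist P0 P2 + dist P2 Q2"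
    using npcD(2)[OF npc big[OF ball(1)] big[OF ball(3)] big[OF ball(6)] ageo_G ageo_G] unfolding P1 M_def PQ by blast
  then consider "2 * R = z + r" | "z = 2 * R + r"
    using r zero_le_dist[of P0 Q2] unfolding P PQ z_def by linarith
  then show False
  proof cases
    case 1
    then have "Q2 = G P0 P2 (z / (2 * R))"
      using between_unique[OF npc ball(1,3) _ ageo_G, of Q2] P PQ by (simp add: z_def dist_commute)
    moreover have "z = 2 * R - r" using 1 by simp
    ultimately show False using far(1) r by simp
  next
    case 2
    \<comment> \<open>\<open>Y\<close> and \<open>Q0\<close> both lie on the geodesic from
      \<open>P0\<close> to \<open>Q2\<close> at distance \<open>r\<close> from \<open>P0\<close>, so
      they coincide, against \<open>far\<close>.\<close>
    define Y where "Y = G P0 P2 (r / (2 * R))"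
    have q: "0 \<le> r / (2 * R)" "r / (2 * R) \<le> 1" using r by (auto simp: divide_le_eq)
    have Y: "dist P0 Y = r" "dist Y P2 = 2 * R - r"
      using dist_G[of 0 "r / (2 * R)" P0 P2] dist_G[of "r / (2 * R)" 1 P0 P2] q r P
      unfolding Y_def by (auto simp: right_diff_distrib)
    have "dist Y Q2 = 2 * R"
      using dist_triangle[of Y Q2 P2] dist_triangle[of P0 Q2 Y] Y PQ 2 unfolding z_def by linarith
    then have "Y = G P0 Q2 (r / z)"
      using between_unique[OF npc ball(1,6) _ ageo_G, of Y] Y 2 by (simp add: z_def)
    moreover have "Q0 = G P0 Q2 (r / z)"
      using between_unique[OF npc ball(1,6) _ ageo_G, of Q0] PQ Q 2 by (simp add: z_def)
    ultimately show False using far(2) r by (simp add: Y_def)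
  qed
qed

text \<open>Counterexamples for \<open>\<eta> = 1 / (n + 1)\<close> subconverge to a flat strip. A
  strip is recorded by six points instead of curves, so that the limit is taken in a compact
  product; the lower bounds make the limiting width exactly \<open>r\<close>.\<close>

lemma no_almost_flat_strip:
  fixes w :: 'a
  assumes npc: "npc w (2 * \<rho>)" and cpt: "compact (cball w \<rho>')" and \<rho>: "\<rho>' < \<rho>" and r: "0 < r" "r < R"
  obtains \<eta> where "0 < \<eta>"
    "\<And>P0 P1 P2 Q0 Q1 Q2. {P0, P1, P2, Q0, Q1, Q2} \<subseteq> cball w \<rho>' \<Longrightarrow>
      dist P0 P1 = R \<Longrightarrow> dist P1 P2 = R \<Longrightarrow> dist P0 P2 = 2 * R \<Longrightarrow>
      dist Q0 Q1 = R \<Longrightarrow> dist Q1 Q2 = R \<Longrightarrow> dist Q0 Q2 = 2 * R \<Longrightarrow>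
      dist P0 Q0 \<le> r + \<eta> \<Longrightarrow> dist P1 Q1 \<le> r + \<eta> \<Longrightarrow> dist P2 Q2 \<le> r + \<eta> \<Longrightarrow>
      r \<le> dist P0 Q0 \<Longrightarrow> r \<le> dist P1 Q1 \<Longrightarrow> r \<le> dist P2 Q2 \<Longrightarrow>
      r \<le> dist Q2 (G P0 P2 ((2 * R - r) / (2 * R))) \<Longrightarrow> r \<le> dist Q0 (G P0 P2 (r / (2 * R))) \<Longrightarrow> False"
proof (rule ccontr)
  assume no: "\<not> thesis"
  note witness = that
  define C where "C = cball w \<rho>'"
  define bad where "bad \<eta> = (\<lambda>(P0, P1, P2, Q0, Q1, Q2). {P0, P1, P2, Q0, Q1, Q2} \<subseteq> C \<and>
      dist P0 P1 = R \<and> dist P1 P2 = R \<and> dist P0 P2 = 2 * R \<and>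
      dist Q0 Q1 = R \<and> dist Q1 Q2 = R \<and> dist Q0 Q2 = 2 * R \<and>
      dist P0 Q0 \<le> r + \<eta> \<and> dist P1 Q1 \<le> r + \<eta> \<and> dist P2 Q2 \<le> r + \<eta> \<and>
      r \<le> dist P0 Q0 \<and> r \<le> dist P1 Q1 \<and> r \<le> dist P2 Q2 \<and>
      r \<le> dist Q2 (G P0 P2 ((2 * R - r) / (2 * R))) \<and> r \<le> dist Q0 (G P0 P2 (r / (2 * R))))" for \<eta> :: real
  have "\<exists>x. bad \<eta> x" if "0 < \<eta>" for \<eta>
  proof (rule ccontr)
    assume "\<nexists>x. bad \<eta> x"
    then have "thesis" unfolding bad_def C_def by (intro witness[OF \<open>0 < \<eta>\<close>]) (simp, blast)
    with no show False ..
  qed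
  then have "\<forall>n. \<exists>x. bad (1 / real (Suc n)) x" by simp
  then obtain X where X: "\<And>n. bad (1 / real (Suc n)) (X n)" by metis
  have "compact (C \<times> C \<times> C \<times> C \<times> C \<times> C)" using cpt unfolding C_def by (intro compact_Times)
  moreover have "X n \<in> C \<times> C \<times> C \<times> C \<times> C \<times> C" for n
    using X[of n] unfolding bad_def by (cases "X n") auto
  ultimately obtain L \<phi> where L: "L \<in> C \<times> C \<times> C \<times> C \<times> C \<times> C" "strict_mono \<phi>" "(X \<circ> \<phi>) \<longlonglongrightarrow> L"
    unfolding compact_eq_seq_compact_metric seq_compact_def by metis
  obtain P0 P1 P2 Q0 Q1 Q2 where Leq: "L = (P0, P1, P2, Q0, Q1, Q2)" by (cases L)
  define p0 where "p0 n = fst (X (\<phi> n))" for n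
  define p1 where "p1 n = fst (snd (X (\<phi> n)))" for n
  define p2 where "p2 n = fst (snd (snd (X (\<phi> n))))" for n
  define q0 where "q0 n = fst (snd (snd (snd (X (\<phi> n)))))" for n
  define q1 where "q1 n = fst (snd (snd (snd (snd (X (\<phi> n))))))" for n
  define q2 where "q2 n = snd (snd (snd (snd (snd (X (\<phi> n))))))" for n
  have Xeq: "X (\<phi> n) = (p0 n, p1 n, p2 n, q0 n, q1 n, q2 n)" for n
    by (simp add: p0_def p1_def p2_def q0_def q1_def q2_def)
  have lim: "p0 \<longlonglongrightarrow> P0" "p1 \<longlonglongrightarrow> P1" "p2 \<longlonglongrightarrow> P2" "q0 \<longlonglongrightarrow> Q0" "q1 \<longlonglongrightarrow> Q1" "q2 \<longlonglongrightarrow> Q2"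
    using L(3) tendsto_fst[OF L(3)] tendsto_fst[OF tendsto_snd[OF L(3)]] tendsto_fst[OF tendsto_snd[OF tendsto_snd[OF L(3)]]]
      tendsto_fst[OF tendsto_snd[OF tendsto_snd[OF tendsto_snd[OF L(3)]]]]
      tendsto_fst[OF tendsto_snd[OF tendsto_snd[OF tendsto_snd[OF tendsto_snd[OF L(3)]]]]]
      tendsto_snd[OF tendsto_snd[OF tendsto_snd[OF tendsto_snd[OF tendsto_snd[OF L(3)]]]]]
    unfolding Leq by (simp_all add: p0_def[abs_def] p1_def[abs_def] p2_def[abs_def] q0_def[abs_def] q1_def[abs_def] q2_def[abs_def] o_def)
  have CB: "x \<in> ball w \<rho>" if "x \<in> C" for x using that \<rho> by (simp add: C_def)
  have inC: "P0 \<in> C" "P1 \<in> C" "P2 \<in> C" "Q0 \<in> C" "Q1 \<in> C" "Q2 \<in> C" using L(1) by (auto simp: Leq)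
  have b: "bad (1 / real (Suc (\<phi> n))) (p0 n, p1 n, p2 n, q0 n, q1 n, q2 n)" for n
    using X[of "\<phi> n"] by (simp add: Xeq)
  have pC: "p0 n \<in> C" "p2 n \<in> C" for n using b[of n] by (auto simp: bad_def)
  have limG: "(\<lambda>n. G (p0 n) (p2 n) v) \<longlonglongrightarrow> G P0 P2 v" if v: "v \<in> {0..1}" for v
  proof -
    have "(\<lambda>n. (1 - v) * dist (p0 n) P0 + v * dist (p2 n) P2) \<longlonglongrightarrow> (1 - v) * dist P0 P0 + v * dist P2 P2"
      by (intro tendsto_intros lim)
    then have *: "(\<lambda>n. (1 - v) * dist (p0 n) P0 + v * dist (p2 n) P2) \<longlonglongrightarrow> 0" by simp
    have "(\<lambda>n. dist (G (p0 n) (p2 n) v) (G P0 P2 v)) \<longlonglongrightarrow> 0"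
    proof (rule tendsto_sandwich[OF _ _ tendsto_const *])
      show "\<forall>\<^sub>F n in sequentially. dist (G (p0 n) (p2 n) v) (G P0 P2 v) \<le> (1 - v) * dist (p0 n) P0 + v * dist (p2 n) P2"
        using G_dist_le[OF npc CB[OF pC(1)] CB[OF pC(2)] CB[OF inC(1)] CB[OF inC(3)] v] by (intro always_eventually) blast
    qed simp
    then show ?thesis by (rule iffD2[OF tendsto_dist_iff])
  qed
  have lim0: "(\<lambda>n. r + 1 / real (Suc (\<phi> n))) \<longlonglongrightarrow> r + 0"
    using LIMSEQ_subseq_LIMSEQ[OF LIMSEQ_inverse_real_of_nat L(2)]
    by (intro tendsto_intros) (simp add: o_def inverse_eq_divide)
  have eq: "dist x y = c" if "f \<longlonglongrightarrow> x" "g \<longlonglongrightarrow> y" "\<And>n. dist (f n) (g n) = c" for f g and x y :: 'a and c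
    using tendsto_dist[OF that(1,2)] unfolding that(3) by (simp add: LIMSEQ_const_iff)
  have ge: "c \<le> dist x y" if "f \<longlonglongrightarrow> x" "g \<longlonglongrightarrow> y" "\<And>n. c \<le> dist (f n) (g n)" for f g and x y :: 'a and c
    using LIMSEQ_le_const[OF tendsto_dist[OF that(1,2)]] that(3) by blast
  have le: "dist x y \<le> r" if "f \<longlonglongrightarrow> x" "g \<longlonglongrightarrow> y" "\<And>n. dist (f n) (g n) \<le> r + 1 / real (Suc (\<phi> n))" for f g and x y :: 'a
    using LIMSEQ_le[OF tendsto_dist[OF that(1,2)] lim0] that(3) by auto
  have v: "(2 * R - r) / (2 * R) \<in> {0..1}" "r / (2 * R) \<in> {0..1}" using r by (auto simp: divide_le_eq)
  note B = b[unfolded bad_def prod.case]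
  show False
  proof (rule no_flat_strip[OF npc inC[THEN CB] r])
    show "dist P0 P1 = R" by (rule eq[OF lim(1,2)]) (use B in blast)
    show "dist P1 P2 = R" by (rule eq[OF lim(2,3)]) (use B in blast)
    show "dist P0 P2 = 2 * R" by (rule eq[OF lim(1,3)]) (use B in blast)
    show "dist Q0 Q1 = R" by (rule eq[OF lim(4,5)]) (use B in blast)
    show "dist Q1 Q2 = R" by (rule eq[OF lim(5,6)]) (use B in blast)
    show "dist Q0 Q2 = 2 * R" by (rule eq[OF lim(4,6)]) (use B in blast)
    show "dist P0 Q0 = r" by (rule antisym[OF le[OF lim(1,4)] ge[OF lim(1,4)]]) (use B in blast)+
    show "dist P1 Q1 = r" by (rule antisym[OF le[OF lim(2,5)] ge[OF lim(2,5)]]) (use B in blast)+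
    show "dist P2 Q2 = r" by (rule antisym[OF le[OF lim(3,6)] ge[OF lim(3,6)]]) (use B in blast)+
    show "r \<le> dist Q2 (G P0 P2 ((2 * R - r) / (2 * R)))" by (rule ge[OF lim(6) limG[OF v(1)]]) (use B in blast)
    show "r \<le> dist Q0 (G P0 P2 (r / (2 * R)))" by (rule ge[OF lim(4) limG[OF v(2)]]) (use B in blast)
  qed
qed

end

section \<open>Closing a loop without a corner\<close>

text \<open>\<open>joint\<close> says that the loop passes through its base point without a corner.
  The number \<open>m\<close> is a period of the result, but possibly a multiple of the least
  one.\<close>

lemma closed_geodesic_of_loop:
  fixes c :: "real \<Rightarrow> 'a::metric_space"
  assumes c: "lgeo m c" and m: "0 < m" and loop: "c 0 = c 1"
    and s0: "0 < s0" "s0 \<le> 1/2" and joint: "\<And>s. 0 < s \<Longrightarrow> s \<le> s0 \<Longrightarrow> dist (c s) (c (1 - s)) = 2 * s * m"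
  shows "closed_geodesic (\<lambda>t. c (frac (t / m)))" "is_period (\<lambda>t. c (frac (t / m))) m"
proof -
  show per: "is_period (\<lambda>t. c (frac (t / m))) m"
    using m by (simp add: is_period_def add_divide_distrib frac_def)
  obtain e where e: "e > 0" "\<And>s t. s \<in> {0..1} \<Longrightarrow> t \<in> {0..1} \<Longrightarrow> \<bar>s - t\<bar> \<le> e \<Longrightarrow> dist (c s) (c t) = m * \<bar>s - t\<bar>"
    using c unfolding lgeo_def by blast
  define d where "d = min e s0"
  have d: "0 < d" "d \<le> e" "d \<le> s0" using e s0 by (auto simp: d_def)
  \<comment> \<open>From equal to unequal arms: lengthening the shorter arm to \<open>\<mu>\<close>
    gives a minimizing path, and parts of minimizing paths are minimizing.\<close>
  have corner: "dist (c (1 - \<sigma>)) (c \<tau>) = m * (\<sigma> + \<tau>)" if "0 \<le> \<sigma>" "0 \<le> \<tau>" "\<sigma> + \<tau> \<le> d" for \<sigma> \<tau>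
  proof -
    define \<mu> where "\<mu> = max \<sigma> \<tau>"
    have \<mu>: "0 \<le> \<mu>" "\<mu> \<le> s0" "\<sigma> \<le> \<mu>" "\<tau> \<le> \<mu>" using that d by (auto simp: \<mu>_def)
    have j: "dist (c \<mu>) (c (1 - \<mu>)) = 2 * \<mu> * m"
      using joint[of \<mu>] \<mu> loop by (cases "\<mu> = 0") auto
    have "dist (c (1 - \<mu>)) (c (1 - \<sigma>)) \<le> m * (\<mu> - \<sigma>)" "dist (c \<tau>) (c \<mu>) \<le> m * (\<mu> - \<tau>)"
      using lgeo_dist_le[OF c, of "1 - \<mu>" "1 - \<sigma>"] lgeo_dist_le[OF c, of \<tau> \<mu>] \<mu> that s0 by auto
    moreover have "2 * \<mu> * m = m * (\<mu> - \<sigma>) + m * (\<mu> - \<tau>) + m * (\<sigma> + \<tau>)" by (simp add: algebra_simps)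
    ultimately have ge: "m * (\<sigma> + \<tau>) \<le> dist (c (1 - \<sigma>)) (c \<tau>)"
      using j dist_triangle[of "c (1 - \<mu>)" "c \<mu>" "c (1 - \<sigma>)"] dist_triangle[of "c (1 - \<sigma>)" "c \<mu>" "c \<tau>"]
      by (simp add: dist_commute)
    have "dist (c (1 - \<sigma>)) (c 1) \<le> m * \<sigma>" "dist (c 0) (c \<tau>) \<le> m * \<tau>"
      using lgeo_dist_le[OF c, of "1 - \<sigma>" 1] lgeo_dist_le[OF c, of 0 \<tau>] \<mu> that s0 by auto
    with ge show ?thesis
      using dist_triangle[of "c (1 - \<sigma>)" "c \<tau>" "c 1"] loop by (simp add: distrib_left)
  qed
  \<comment> \<open>As \<open>d < 1\<close>, at most one integer lies between \<open>A\<close> and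
    \<open>B\<close>; there the path passes the base point and \<open>corner\<close>
    applies.\<close>
  have main: "dist (c (frac A)) (c (frac B)) = m * (B - A)" if AB: "A \<le> B" "B - A \<le> d" for A B :: real
  proof (cases "\<lfloor>A\<rfloor> = \<lfloor>B\<rfloor>")
    case True
    then have "frac A - frac B = A - B" by (simp add: frac_def)
    then show ?thesis using e(2)[of "frac A" "frac B"] AB d
      by (auto simp: frac_ge_0 less_imp_le[OF frac_lt_1])
  next
    case False
    have "d < 1" using d s0 by simp
    have fl: "of_int \<lfloor>A\<rfloor> \<le> A" "A < of_int \<lfloor>A\<rfloor> + 1" by linarith+
    have "\<lfloor>A\<rfloor> \<le> \<lfloor>B\<rfloor>" using AB by (simp add: floor_mono)
    with False have "\<lfloor>A\<rfloor> + 1 \<le> \<lfloor>B\<rfloor>" by simp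
    moreover have "\<lfloor>B\<rfloor> \<le> \<lfloor>A\<rfloor> + 1"
    proof -
      have "B < A + 1" using AB \<open>d < 1\<close> by simp
      then have "B < of_int (\<lfloor>A\<rfloor> + 2)" using fl unfolding of_int_add of_int_numeral by linarith
      then have "\<lfloor>B\<rfloor> < \<lfloor>A\<rfloor> + 2" by (simp add: floor_less_iff)
      then show ?thesis by simp
    qed
    ultimately have "\<lfloor>B\<rfloor> = \<lfloor>A\<rfloor> + 1" by simp
    then have sum: "(1 - frac A) + frac B = B - A" by (simp add: frac_def)
    have "dist (c (1 - (1 - frac A))) (c (frac B)) = m * ((1 - frac A) + frac B)"
      using sum AB less_imp_le[OF frac_lt_1[of A]] by (intro corner) (auto simp: frac_ge_0)
    then show ?thesis unfolding sum by simp
  qed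
  have "local_geodesic_on UNIV (\<lambda>t. c (frac (t / m)))"
    unfolding local_geodesic_on_def
  proof (intro ballI exI[of _ "d * m / 2"] conjI)
    fix t
    show "0 < d * m / 2" using d m by simp
    have "dist (c (frac (u / m))) (c (frac (v / m))) = v - u"
      if "t - d * m / 2 \<le> u" "u \<le> v" "v \<le> t + d * m / 2" for u v
    proof -
      have "v - u \<le> d * m" using that by (simp add: field_simps)
      then have "v / m - u / m \<le> d" using m by (simp add: divide_le_eq flip: diff_divide_distrib)
      then have "dist (c (frac (u / m))) (c (frac (v / m))) = m * (v / m - u / m)"
        using that m by (intro main) (auto simp: divide_right_mono)
      also have "\<dots> = v - u" using m by (simp add: right_diff_distrib)
      finally show ?thesis .
    qed
    note * = this
    have "dist (c (frac (u / m))) (c (frac (v / m))) = \<bar>u - v\<bar>"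
      if "u \<in> {t - d * m / 2..t + d * m / 2} \<inter> UNIV" "v \<in> {t - d * m / 2..t + d * m / 2} \<inter> UNIV" for u v
      using that *[of u v] *[of v u] dist_commute[of "c (frac (u / m))" "c (frac (v / m))"]
      by (cases "u \<le> v") auto
    then show "isometric_embedding_on UNIV dist ({t - d * m / 2..t + d * m / 2} \<inter> UNIV) (\<lambda>t. c (frac (t / m)))"
      unfolding isometric_embedding_on_def by blast
  qed
  then show "closed_geodesic (\<lambda>t. c (frac (t / m)))" using per unfolding closed_geodesic_def by blast
qed

lemma period_le: "is_period c T \<Longrightarrow> period c \<le> T"
  unfolding period_def by (rule cInf_lower) (auto simp: is_period_def intro!: bdd_belowI[of _ 0])

context complete_geodesic
begin

text \<open>The form that suits the minimization: closeness at three equal parameters yields a point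
  of \<open>qa\<close> nearer than \<open>r\<close> to some point of \<open>pa\<close>. The
  parameter \<open>s\<close> is free because the constraint there asks only for the distance to some
  point of a piece of \<open>g\<close>.\<close>

definition no_strip :: "'a \<Rightarrow> real \<Rightarrow> real \<Rightarrow> real \<Rightarrow> real \<Rightarrow> bool" where
  "no_strip w \<rho>' L r \<eta> \<longleftrightarrow> (\<forall>pa qa. ageo pa (pa 0) (pa 1) \<and> ageo qa (qa 0) (qa 1) \<and>
      dist (pa 0) (pa 1) = L \<and> dist (qa 0) (qa 1) = L \<and>
      (\<forall>t\<in>{0..1}. pa t \<in> cball w \<rho>' \<and> qa t \<in> cball w \<rho>') \<and>
      (\<forall>t\<in>{0, 1/2, 1}. dist (pa t) (qa t) \<le> r + \<eta>) \<longrightarrow>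
      (\<exists>t\<in>{0, 1/2, 1}. \<exists>s\<in>{0..1}. dist (qa t) (pa s) < r))"

lemma no_strip_exists:
  fixes w :: 'a
  assumes npc: "npc w (2 * \<rho>)" and cpt: "compact (cball w \<rho>')" and \<rho>: "\<rho>' < \<rho>" and r: "0 < r" "r < R"
  obtains \<eta> where "0 < \<eta>" "no_strip w \<rho>' (2 * R) r \<eta>"
proof -
  obtain \<eta> where \<eta>: "0 < \<eta>"
    "\<And>P0 P1 P2 Q0 Q1 Q2. {P0, P1, P2, Q0, Q1, Q2} \<subseteq> cball w \<rho>' \<Longrightarrow>
      dist P0 P1 = R \<Longrightarrow> dist P1 P2 = R \<Longrightarrow> dist P0 P2 = 2 * R \<Longrightarrow>
      dist Q0 Q1 = R \<Longrightarrow> dist Q1 Q2 = R \<Longrightarrow> dist Q0 Q2 = 2 * R \<Longrightarrow>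
      dist P0 Q0 \<le> r + \<eta> \<Longrightarrow> dist P1 Q1 \<le> r + \<eta> \<Longrightarrow> dist P2 Q2 \<le> r + \<eta> \<Longrightarrow>
      r \<le> dist P0 Q0 \<Longrightarrow> r \<le> dist P1 Q1 \<Longrightarrow> r \<le> dist P2 Q2 \<Longrightarrow>
      r \<le> dist Q2 (G P0 P2 ((2 * R - r) / (2 * R))) \<Longrightarrow> r \<le> dist Q0 (G P0 P2 (r / (2 * R))) \<Longrightarrow> False"
    by (rule no_almost_flat_strip[OF assms]) blast
  show ?thesis
  proof (rule that[OF \<eta>(1)], unfold no_strip_def, intro allI impI, elim conjE, rule ccontr)
    fix pa qa :: "real \<Rightarrow> 'a"
    assume pa: "ageo pa (pa 0) (pa 1)" and qa: "ageo qa (qa 0) (qa 1)"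
      and d: "dist (pa 0) (pa 1) = 2 * R" "dist (qa 0) (qa 1) = 2 * R"
      and inC: "\<forall>t\<in>{0..1}. pa t \<in> cball w \<rho>' \<and> qa t \<in> cball w \<rho>'"
      and close: "\<forall>t\<in>{0, 1/2, 1}. dist (pa t) (qa t) \<le> r + \<eta>"
      and no: "\<not> (\<exists>t\<in>{0, 1/2, 1}. \<exists>s\<in>{0..1}. dist (qa t) (pa s) < r)"
    have pin: "pa t \<in> cball w \<rho>'" and qin: "qa t \<in> cball w \<rho>'" if "t \<in> {0..1}" for t
      using inC that by blast+
    have far: "r \<le> dist (qa t) (pa s)" if "t \<in> {0, 1/2, 1}" "s \<in> {0..1}" for t s
      using no that by (meson not_less)
    have inb: "x \<in> ball w (2 * \<rho>)" "x \<in> ball w \<rho>" if "x \<in> cball w \<rho>'" for x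
      using that \<rho> zero_le_dist[of w x] unfolding mem_ball mem_cball by linarith+
    have G_eq: "G (pa 0) (pa 1) t = pa t" if "t \<in> {0..1}" for t
    proof (rule lgeo_ball_unique[OF npc ageo_imp_lgeo[OF ageo_G] ageo_imp_lgeo[OF pa] _ _ _ _ that])
      show "G (pa 0) (pa 1) s \<in> ball w (2 * \<rho>)" if "s \<in> {0..1}" for s
        using inb(2)[OF pin] by (intro ageo_in_ball[OF ageo_G _ _ that]) auto
      show "pa s \<in> ball w (2 * \<rho>)" if "s \<in> {0..1}" for s by (rule inb(1)[OF pin[OF that]])
    qed auto
    have v: "(2 * R - r) / (2 * R) \<in> {0..1}" "r / (2 * R) \<in> {0..1}" using r by (auto simp: divide_le_eq)
    have half: "dist (pa 0) (pa (1/2)) = R" "dist (pa (1/2)) (pa 1) = R" "dist (qa 0) (qa (1/2)) = R" "dist (qa (1/2)) (qa 1) = R"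
      using ageoD(3)[OF pa, of 0 "1/2"] ageoD(3)[OF pa, of "1/2" 1] ageoD(3)[OF qa, of 0 "1/2"] ageoD(3)[OF qa, of "1/2" 1] d
      by simp_all
    show False
    proof (rule \<eta>(2)[of "pa 0" "pa (1/2)" "pa 1" "qa 0" "qa (1/2)" "qa 1"])
      show "{pa 0, pa (1/2), pa 1, qa 0, qa (1/2), qa 1} \<subseteq> cball w \<rho>'" using pin qin by simp
      show "r \<le> dist (pa 0) (qa 0)" "r \<le> dist (pa (1/2)) (qa (1/2))" "r \<le> dist (pa 1) (qa 1)"
        using far[of 0 0] far[of "1/2" "1/2"] far[of 1 1] by (simp_all add: dist_commute)
      show "r \<le> dist (qa 1) (G (pa 0) (pa 1) ((2 * R - r) / (2 * R)))" "r \<le> dist (qa 0) (G (pa 0) (pa 1) (r / (2 * R)))"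
        unfolding G_eq[OF v(1)] G_eq[OF v(2)] using far v by auto
    qed (use half d close in auto)
  qed
qed

end

section \<open>Closing a recurrent geodesic\<close>

text \<open>\<open>T\<close> is the return time. Base points lie within \<open>2 * a\<close> of
  \<open>g 0\<close> and are slid by at most \<open>a\<close>, so they stay in the balls of radius
  \<open>5 * a\<close> and \<open>6 * a\<close>. The window of \<open>iso\<close> and
  \<open>rec\<close> is larger than \<open>{-a..a}\<close> in order to absorb the drift between loop
  and \<open>g\<close>, which the bound on \<open>T\<close> keeps below
  \<open>\<delta>\<close>.\<close>

locale closing_tube = tube G T "\<lambda>t. g (t * T)" "g 0" "6 * a" r K
  for G :: "'a::metric_space \<Rightarrow> 'a \<Rightarrow> real \<Rightarrow> 'a" and T g a r K +
  fixes \<delta> \<eta> :: real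
  assumes a: "0 < a"
    and iso: "\<And>s t. s \<in> {-2*a..2*a} \<Longrightarrow> t \<in> {-2*a..2*a} \<Longrightarrow> dist (g s) (g t) = \<bar>s - t\<bar>"
    and lg: "\<And>s t. -2*a \<le> s \<Longrightarrow> s < t \<Longrightarrow> lgeo (t - s) (\<lambda>u. g (s + u * (t - s)))"
    and rec: "\<And>s. s \<in> {-2*a..2*a} \<Longrightarrow> dist (g (s + T)) (g s) < \<delta>"
    and \<delta>: "0 < \<delta>" "\<delta> \<le> a / 16" "3 * \<delta> \<le> \<eta>"
    and T: "2 * a + a * a / \<delta> \<le> T"
    and cpt: "compact (cball (g 0) (5 * a))"
    and strip: "no_strip (g 0) (5 * a) a (a / 16) \<eta>"
begin

abbreviation "h \<equiv> a / 16"

lemma T_large: "2 * a < T" "0 < T"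
proof -
  have "0 < a * a / \<delta>" using a \<delta> by simp
  then show "2 * a < T" using T by linarith
  then show "0 < T" using a by linarith
qed

lemma g_dist_le:
  assumes "-2*a \<le> s" "-2*a \<le> t"
  shows "dist (g s) (g t) \<le> \<bar>s - t\<bar>"
proof -
  have *: "dist (g s) (g t) \<le> t - s" if "-2*a \<le> s" "s < t" for s t
    using lgeo_dist_le[OF lg[OF that], of 0 1] by simp
  show ?thesis using *[of s t] *[of t s] assms by (cases s t rule: linorder_cases) (auto simp: dist_commute)
qed

lemma g_ball:
  assumes "v \<in> {-2*a..2*a}" shows "g v \<in> ball (g 0) (6 * a)" "g (v + T) \<in> ball (g 0) (6 * a)"
proof -
  have "dist (g 0) (g v) \<le> 2 * a" using iso[of 0 v] assms a by auto
  moreover have "dist (g v) (g (v + T)) \<le> a" using rec[OF assms] \<delta> a by (simp add: dist_commute)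
  ultimately show "g v \<in> ball (g 0) (6 * a)" "g (v + T) \<in> ball (g 0) (6 * a)"
    using dist_triangle[of "g 0" "g (v + T)" "g v"] a by auto
qed

lemma near_ball:
  assumes "v \<in> {-a..a}" "dist q (g v) \<le> h"
  shows "dist (g 0) q \<le> 2 * a" "q \<in> ball (g 0) (6 * a)"
proof -
  have "dist (g 0) (g v) \<le> a" using iso[of 0 v] assms a by auto
  then show "dist (g 0) q \<le> 2 * a" using dist_triangle[of "g 0" q "g v"] assms(2) a by (simp add: dist_commute)
  then show "q \<in> ball (g 0) (6 * a)" using a by simp
qed

text \<open>The base time slides from \<open>0\<close>, where \<open>sig_base\<close> applies, to
  \<open>v\<close>; all members of the family are pieces of \<open>g\<close> of the same length
  \<open>T\<close>.\<close>

lemma sig_g: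
  assumes v: "v \<in> {-2*a..2*a}"
  shows "t \<in> {0..1} \<Longrightarrow> sig (g v) (g (v + T)) t = g (v + t * T)" "len (g v) (g (v + T)) = T"
proof -
  define H where "H u t = g (u * v + t * T)" for u t
  have uv: "u * v \<in> {-2*a..2*a}" if "u \<in> {0..1}" for u
  proof -
    have "\<bar>u * v\<bar> \<le> 1 * (2 * a)" unfolding abs_mult using that v by (intro mult_mono) auto
    then show ?thesis by auto
  qed
  have lgH: "lgeo T (H u)" if "u \<in> {0..1}" for u
    using lg[of "u * v" "u * v + T"] uv[OF that] T_large by (simp add: H_def[abs_def])
  have *: "sig (H 1 0) (H 1 1) t = H 1 t" if "t \<in> {0..1}" for t
  proof (rule sig_family[OF _ _ _ _ _ that])
    show "\<exists>l. lgeo l (H u)" if "u \<in> {0..1}" for u using lgH[OF that] by blast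
    show "H u 0 \<in> ball (g 0) (6 * a)" "H u 1 \<in> ball (g 0) (6 * a)" if "u \<in> {0..1}" for u
      using g_ball[OF uv[OF that]] by (simp_all add: H_def)
    show "dist (H u t) (H u' t) \<le> \<bar>v\<bar> * \<bar>u - u'\<bar>" if "u \<in> {0..1}" "u' \<in> {0..1}" "t \<in> {0..1}" for u u' t
    proof -
      have "0 \<le> t * T" using that T_large by simp
      then have "dist (H u t) (H u' t) \<le> \<bar>(u * v + t * T) - (u' * v + t * T)\<bar>"
        unfolding H_def using uv[OF that(1)] uv[OF that(2)] by (intro g_dist_le) auto
      also have "(u * v + t * T) - (u' * v + t * T) = v * (u - u')" by (simp add: algebra_simps)
      finally show ?thesis by (simp add: abs_mult)
    qed
    show "sig (H 0 0) (H 0 1) t = H 0 t" if "t \<in> {0..1}" for t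
      using sig_base[OF that] by (simp add: H_def)
  qed
  then show "t \<in> {0..1} \<Longrightarrow> sig (g v) (g (v + T)) t = g (v + t * T)" by (simp add: H_def)
  show "len (g v) (g (v + T)) = T"
    using len_eqI[OF lgH[of 1] _ _ *] g_ball[OF v] by (simp add: H_def)
qed

text \<open>\<open>sig q q\<close> is a loop, possibly with a corner at \<open>q\<close>. It is
  compared with the piece of \<open>g\<close> from \<open>v\<close> to \<open>v + T\<close>, whose
  ends are less than \<open>\<delta>\<close> apart.\<close>

lemma loop_near:
  assumes v: "v \<in> {-a..a}" and q: "dist q (g v) \<le> h"
  shows "\<bar>len q q - T\<bar> \<le> 2 * h + \<delta>"
    and "t \<in> {0..1} \<Longrightarrow> dist (sig q q t) (g (v + t * T)) \<le> h + \<delta>"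
proof -
  have v2: "v \<in> {-2*a..2*a}" using v a by auto
  have d: "dist q (g (v + T)) \<le> h + \<delta>"
    using dist_triangle[of q "g (v + T)" "g v"] rec[OF v2] q by (simp add: dist_commute)
  note qb = near_ball(2)[OF v q]
  show "\<bar>len q q - T\<bar> \<le> 2 * h + \<delta>"
    using len_diff[OF qb qb g_ball[OF v2]] sig_g(2)[OF v2] q d by simp
  assume t: "t \<in> {0..1}"
  have "dist (sig q q t) (g (v + t * T)) \<le> (1 - t) * dist q (g v) + t * dist q (g (v + T))"
    using sig_dist[OF qb qb g_ball[OF v2] t] sig_g(1)[OF v2 t] by simp
  also have "\<dots> \<le> h + \<delta>" using q d \<delta> by (intro convex_combination_le[OF t]) auto
  finally show "dist (sig q q t) (g (v + t * T)) \<le> h + \<delta>" .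
qed

lemma minimal_loop:
  obtains p u where "u \<in> {-a..a}" "dist p (g u) \<le> h"
    "\<And>q v. v \<in> {-a..a} \<Longrightarrow> dist q (g v) \<le> h \<Longrightarrow> len p p \<le> len q q"
proof -
  define D where "D = cball (g 0) (5 * a) \<times> {-a..a}"
  \<comment> \<open>Keeping the time \<open>v\<close> as a second coordinate turns the constraint
    into a closed condition on a compact product.\<close>
  define C where "C = {z \<in> D. dist (fst z) (g (snd z)) \<le> h}"
  have cD: "compact D" unfolding D_def using cpt by (intro compact_Times) auto
  have cg: "continuous_on {-a..a} g"
  proof -
    have "1-lipschitz_on {-a..a} g" using iso a by (intro lipschitz_onI) (auto simp: dist_real_def)
    then show ?thesis by (rule lipschitz_on_continuous_on)
  qed
  have "continuous_on D (\<lambda>z. dist (fst z) (g (snd z)))"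
    by (intro continuous_intros continuous_on_compose2[OF cg]) (auto simp: D_def)
  then have "closed (D \<inter> (\<lambda>z. dist (fst z) (g (snd z))) -` {..h})"
    using compact_imp_closed[OF cD] by (intro continuous_closed_preimage) auto
  moreover have "C = D \<inter> (D \<inter> (\<lambda>z. dist (fst z) (g (snd z))) -` {..h})" by (auto simp: C_def)
  ultimately have "compact C" using compact_Int_closed[OF cD] by metis
  have Cb: "fst z \<in> ball (g 0) (6 * a)" if "z \<in> C" for z
    using that near_ball(2)[of "snd z" "fst z"] by (auto simp: C_def D_def)
  have "2-lipschitz_on C (\<lambda>z. len (fst z) (fst z))"
  proof (rule lipschitz_onI)
    fix z z' assume zz: "z \<in> C" "z' \<in> C"
    have "dist (len (fst z) (fst z)) (len (fst z') (fst z')) \<le> dist (fst z) (fst z') + dist (fst z) (fst z')"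
      unfolding dist_real_def using Cb[OF zz(1)] Cb[OF zz(2)] by (intro len_diff)
    also have "\<dots> \<le> 2 * dist z z'" using dist_fst_le[of z z'] by simp
    finally show "dist (len (fst z) (fst z)) (len (fst z') (fst z')) \<le> 2 * dist z z'" .
  qed simp
  then have cont: "continuous_on C (\<lambda>z. len (fst z) (fst z))" by (rule lipschitz_on_continuous_on)
  have mem: "(q, v) \<in> C" if "v \<in> {-a..a}" "dist q (g v) \<le> h" for q v
    using near_ball(1)[OF that] that a by (auto simp: C_def D_def)
  have "(g 0, 0) \<in> C" using a by (intro mem) auto
  then have "C \<noteq> {}" by blast
  then obtain z where z: "z \<in> C" "\<And>z'. z' \<in> C \<Longrightarrow> len (fst z) (fst z) \<le> len (fst z') (fst z')"
    using continuous_attains_inf[OF \<open>compact C\<close> _ cont] by blast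
  show ?thesis
  proof (rule that[of "snd z" "fst z"])
    show "snd z \<in> {-a..a}" "dist (fst z) (g (snd z)) \<le> h" using z(1) by (auto simp: C_def D_def)
    show "len (fst z) (fst z) \<le> len q q" if "v \<in> {-a..a}" "dist q (g v) \<le> h" for q v
      using z(2)[OF mem[OF that]] by simp
  qed
qed

text \<open>Cutting off a piece of length \<open>s\<close> at one end of the loop leaves a path of
  length \<open>len p p - s\<close> between \<open>p\<close> and the new base point; moving its end
  from \<open>p\<close> to the new base point costs at most \<open>s\<close>.\<close>

lemma shifted_loop:
  assumes v: "v \<in> {-a..a}" and p: "dist p (g v) \<le> h" and s: "0 \<le> s" "s \<le> a"
  shows "len (sig p p (s / len p p)) (sig p p (s / len p p)) \<le> len p p"
    and "len (sig p p (1 - s / len p p)) (sig p p (1 - s / len p p)) \<le> len p p"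
    and "dist (g 0) (sig p p (s / len p p)) \<le> 3 * a"
    and "dist (g 0) (sig p p (1 - s / len p p)) \<le> 3 * a"
    and "0 \<le> s / len p p" "s / len p p \<le> 1"
proof -
  define m where "m = len p p"
  note pb = near_ball(2)[OF v p]
  note c = sig_lgeo[OF pb pb, folded m_def]
  have m: "a < m" "0 < m" using loop_near(1)[OF v p] \<delta> T_large a unfolding m_def by linarith+
  define x where "x = s / m"
  have x: "0 \<le> x" "x \<le> 1" "x * m = s" using s m by (auto simp: x_def divide_le_eq)
  have near1: "dist p (sig p p y) \<le> s" if "0 \<le> y" "y \<le> x" for y
  proof -
    have "dist (sig p p 0) (sig p p y) \<le> m * \<bar>0 - y\<bar>" using that x by (intro lgeo_dist_le[OF c]) auto
    also have "\<dots> \<le> m * x" using that m by (intro mult_left_mono) auto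
    finally show ?thesis using x by (simp add: sig_ends[OF pb pb] mult.commute)
  qed
  have near2: "dist p (sig p p y) \<le> s" if "1 - x \<le> y" "y \<le> 1" for y
  proof -
    have "dist (sig p p 1) (sig p p y) \<le> m * \<bar>1 - y\<bar>" using that x by (intro lgeo_dist_le[OF c]) auto
    also have "\<dots> \<le> m * x" using that m by (intro mult_left_mono) auto
    finally show ?thesis using x by (simp add: sig_ends[OF pb pb] mult.commute)
  qed
  have inball: "z \<in> ball (g 0) (6 * a)" "dist (g 0) z \<le> 3 * a" if "dist p z \<le> s" for z
    using near_ball(1)[OF v p] dist_triangle[of "g 0" z p] that s a by auto
  show "dist (g 0) (sig p p (s / len p p)) \<le> 3 * a" "dist (g 0) (sig p p (1 - s / len p p)) \<le> 3 * a"
    unfolding m_def[symmetric] x_def[symmetric] using near1[of x] near2[of "1 - x"] x by (auto intro: inball)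
  show "0 \<le> s / len p p" "s / len p p \<le> 1" using x by (auto simp: x_def m_def)
  have "len (sig p p x) (sig p p 1) = (1 - x) * m"
    unfolding m_def using x near1 pb by (intro sig_sub(2)[OF pb pb]) (auto intro: inball simp: sig_ends[OF pb pb] simp del: mem_ball)
  moreover have "\<bar>len (sig p p x) p - len (sig p p x) (sig p p x)\<bar> \<le> dist p (sig p p x)"
    using near1[of x] x pb by (intro len_diff_right) (auto intro: inball simp del: mem_ball)
  ultimately show "len (sig p p (s / len p p)) (sig p p (s / len p p)) \<le> len p p"
    using near1[of x] x unfolding m_def[symmetric] x_def[symmetric] by (simp add: sig_ends[OF pb pb] left_diff_distrib)
  have "len (sig p p 0) (sig p p (1 - x)) = (1 - x - 0) * m"
    unfolding m_def using x near2 pb by (intro sig_sub(2)[OF pb pb]) (auto intro: inball simp: sig_ends[OF pb pb] simp del: mem_ball)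
  moreover have "\<bar>len p (sig p p (1 - x)) - len (sig p p (1 - x)) (sig p p (1 - x))\<bar> \<le> dist p (sig p p (1 - x))"
    using near2[of "1 - x"] x pb by (intro len_diff_left) (auto intro: inball simp del: mem_ball)
  ultimately show "len (sig p p (1 - s / len p p)) (sig p p (1 - s / len p p)) \<le> len p p"
    using near2[of "1 - x"] x unfolding m_def[symmetric] x_def[symmetric] by (simp add: sig_ends[OF pb pb] left_diff_distrib)
qed

lemma interior_minimal_loop:
  obtains p u where "u \<in> {-a..a}" "dist p (g u) < h"
    "\<And>q v. v \<in> {-a..a} \<Longrightarrow> dist q (g v) \<le> h \<Longrightarrow> len p p \<le> len q q"
proof -
  obtain p u where u: "u \<in> {-a..a}" and p: "dist p (g u) \<le> h"
    and min: "\<And>q v. v \<in> {-a..a} \<Longrightarrow> dist q (g v) \<le> h \<Longrightarrow> len p p \<le> len q q"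
    by (rule minimal_loop) blast
  define m where "m = len p p"
  note pb = near_ball(2)[OF u p]
  note c = sig_lgeo[OF pb pb, folded m_def]
  note sh = shifted_loop[OF u p, folded m_def]
  have mT: "\<bar>m - T\<bar> \<le> 2 * h + \<delta>" using loop_near(1)[OF u p] by (simp add: m_def)
  have m: "a + a * a / \<delta> \<le> m" "0 < m" "a < m"
  proof -
    have "0 < a * a / \<delta>" using a \<delta> by simp
    then show "a + a * a / \<delta> \<le> m" "0 < m" "a < m" using mT T \<delta> a by linarith+
  qed
  \<comment> \<open>Loop and \<open>g\<close> are both parametrized over \<open>{0..1}\<close> with
    lengths \<open>m\<close> and \<open>T\<close>; this bounds how far they get out of step over a
    length \<open>s\<close>.\<close>
  have drift: "\<bar>s / m * T - s\<bar> \<le> \<delta>" if "0 \<le> s" "s \<le> a" for s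
  proof -
    have "s / m * T - s = s * (T - m) / m" using m by (simp add: field_simps)
    also have "\<bar>\<dots>\<bar> = s * \<bar>T - m\<bar> / m" using that m by (simp add: abs_mult)
    also have "\<dots> \<le> a * a / m" using that m mT \<delta> a by (intro divide_right_mono mult_mono) auto
    also have "\<dots> \<le> \<delta>"
    proof -
      have "a * a / \<delta> \<le> m" using m a by simp
      then show ?thesis using m \<delta> by (simp add: field_simps)
    qed
    finally show ?thesis .
  qed
  note witness = that
  \<comment> \<open>Since sliding does not increase the displacement, a slid point nearer than
    \<open>h\<close> to \<open>g\<close> is again a minimizer, now in the interior.\<close>
  have found: ?thesis
    if q: "q = sig p p (s / m) \<or> q = sig p p (1 - s / m)" and s: "0 \<le> s" "s \<le> a" and v: "v \<in> {-a..a}" "dist q (g v) < h" for q s v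
  proof (rule witness[OF v])
    fix q' v' assume v': "v' \<in> {-a..a}" "dist q' (g v') \<le> h"
    have "len q q \<le> m" using sh(1,2)[OF s] q by auto
    then show "len q q \<le> len q' q'" using min[OF v'] by (simp add: m_def)
  qed
  \<comment> \<open>The points slid over a length \<open>a\<close> form a geodesic \<open>qa\<close>
    beside the piece \<open>pa\<close> of \<open>g\<close>, and \<open>strip\<close> provides one of
    them nearer than \<open>h\<close>.\<close>
  have key: ?thesis
    if qa: "lgeo a qa" "\<And>t. t \<in> {0..1} \<Longrightarrow> qa t = sig p p (t * a / m) \<or> qa t = sig p p (1 - t * a / m)"
      and pa: "\<And>s t. s \<in> {0..1} \<Longrightarrow> t \<in> {0..1} \<Longrightarrow> dist (pa s) (pa t) = a * \<bar>s - t\<bar>"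
        "\<And>t. t \<in> {0..1} \<Longrightarrow> \<exists>v\<in>{-a..a}. pa t = g v"
      and close: "\<And>t. t \<in> {0..1} \<Longrightarrow> dist (pa t) (qa t) \<le> h + 3 * \<delta>" for pa qa
  proof -
    have ta: "0 \<le> t * a" "t * a \<le> a" if "t \<in> {0..1}" for t using that a by auto
    have q5: "dist (g 0) (qa t) \<le> 3 * a" if "t \<in> {0..1}" for t
      using qa(2)[OF that] sh(3,4)[OF ta[OF that]] by auto
    have g5: "dist (g 0) (g v) \<le> a" if "v \<in> {-a..a}" for v using iso[of 0 v] a that by auto
    have p5: "dist (g 0) (pa t) \<le> a" if "t \<in> {0..1}" for t
      using pa(2)[OF that] g5 by metis
    have aq: "ageo qa (qa 0) (qa 1)" "dist (qa 0) (qa 1) = a"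
      using a q5 by (intro lgeo_ball_imp_ageo[OF npc_x0 qa(1)]; force)+
    have ap: "dist (pa 0) (pa 1) = a" using pa(1)[of 0 1] by simp
    then have "ageo pa (pa 0) (pa 1)" unfolding ageo_def using pa(1) by simp
    moreover have "\<forall>t\<in>{0..1}. pa t \<in> cball (g 0) (5 * a) \<and> qa t \<in> cball (g 0) (5 * a)"
      using p5 q5 a by force
    moreover have "\<forall>t\<in>{0, 1/2, 1}. dist (pa t) (qa t) \<le> h + \<eta>"
      using close[of 0] close[of "1/2"] close[of 1] \<delta>(3) by simp
    ultimately obtain t s where ts: "t \<in> {0, 1/2, 1}" "s \<in> {0..1}" "dist (qa t) (pa s) < h"
      using strip aq ap unfolding no_strip_def by blast
    have t01: "t \<in> {0..1}" using ts(1) by auto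
    obtain v where v: "v \<in> {-a..a}" "pa s = g v" using pa(2)[OF ts(2)] by blast
    show ?thesis by (rule found[OF qa(2)[OF t01] ta[OF t01] v(1)]) (use ts(3) v(2) in simp)
  qed
  have am: "0 < a / m" "a / m \<le> 1" using a m by (auto simp: divide_le_eq)
  have scale: "0 \<le> t * a / m" "t * a / m \<le> 1" "0 \<le> t * a" "t * a \<le> a" if "t \<in> {0..1}" for t
  proof -
    show ta: "0 \<le> t * a" "t * a \<le> a" using that a by auto
    then have "t * a \<le> m" using m by simp
    then show "0 \<le> t * a / m" "t * a / m \<le> 1" using ta m by (auto simp: divide_le_eq)
  qed
  show ?thesis
  \<comment> \<open>The sliding goes towards the middle of \<open>{-a..a}\<close>, so that the
    accompanying piece of \<open>g\<close> stays inside: backwards from the end of the loop for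
    \<open>0 \<le> u\<close>, forwards from its start otherwise.\<close>
  proof (cases "0 \<le> u")
    case True
    show ?thesis
    proof (rule key[of "\<lambda>t. sig p p (1 - t * a / m)" "\<lambda>t. g (u - t * a)"])
      have "lgeo ((1 - (1 - a / m)) * m) (\<lambda>t. sig p p ((1 - a / m) + t * (1 - (1 - a / m))))"
        using am by (intro lgeo_sub[OF c]) auto
      then have "lgeo ((1 - (1 - a / m)) * m) (\<lambda>t. sig p p ((1 - a / m) + (1 - t) * (1 - (1 - a / m))))"
        by (rule lgeo_rev)
      moreover have "(1 - (1 - a / m)) * m = a" using m by simp
      moreover have "(1 - a / m) + (1 - t) * (1 - (1 - a / m)) = 1 - t * a / m" for t
        by (simp add: algebra_simps diff_divide_distrib)
      ultimately show "lgeo a (\<lambda>t. sig p p (1 - t * a / m))" by (simp only:)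
      have in2: "u - t * a \<in> {-a..a}" if "t \<in> {0..1}" for t using scale[OF that] True u by auto
      show "\<exists>v\<in>{-a..a}. g (u - t * a) = g v" if "t \<in> {0..1}" for t using in2[OF that] by blast
      show "dist (g (u - s * a)) (g (u - t * a)) = a * \<bar>s - t\<bar>" if "s \<in> {0..1}" "t \<in> {0..1}" for s t
      proof -
        have "dist (g (u - s * a)) (g (u - t * a)) = \<bar>(u - s * a) - (u - t * a)\<bar>"
          using in2[OF that(1)] in2[OF that(2)] a by (intro iso) auto
        also have "(u - s * a) - (u - t * a) = a * (t - s)" by (simp add: algebra_simps)
        finally show ?thesis using a by (simp add: abs_mult abs_minus_commute)
      qed
      \<comment> \<open>One \<open>\<delta>\<close> each for the loop against \<open>g\<close> near
        time \<open>T\<close>, for the return from \<open>w + T\<close> to \<open>w\<close>, and for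
        the drift from \<open>w\<close> to \<open>u - t * a\<close>.\<close>
      show "dist (g (u - t * a)) (sig p p (1 - t * a / m)) \<le> h + 3 * \<delta>" if "t \<in> {0..1}" for t
      proof -
        note sc = scale[OF that]
        define w where "w = u - t * a / m * T"
        have w: "\<bar>w - (u - t * a)\<bar> \<le> \<delta>" using drift[OF sc(3,4)] unfolding w_def by (simp add: abs_minus_commute)
        have "x \<in> {-2*a..2*a}" if "\<bar>x - y\<bar> \<le> \<delta>" "y \<in> {-a..a}" for x y
          using that \<delta> a unfolding atLeastAtMost_iff abs_le_iff by linarith
        from this[OF w in2[OF that]] have w2: "w \<in> {-2*a..2*a}" .
        have e: "u + (1 - t * a / m) * T = w + T" by (simp add: w_def algebra_simps)
        have "dist (sig p p (1 - t * a / m)) (g (w + T)) \<le> h + \<delta>"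
          using loop_near(2)[OF u p, of "1 - t * a / m"] sc unfolding e by auto
        moreover have "dist (g (w + T)) (g w) \<le> \<delta>" using rec[OF w2] by simp
        moreover have "dist (g w) (g (u - t * a)) \<le> \<delta>"
          using g_dist_le[of w "u - t * a"] w w2 in2[OF that] a by auto
        moreover have "dist (g (u - t * a)) (sig p p (1 - t * a / m)) \<le>
            dist (sig p p (1 - t * a / m)) (g (w + T)) + dist (g (w + T)) (g w) + dist (g w) (g (u - t * a))"
          using dist_triangle[of "sig p p (1 - t * a / m)" "g (u - t * a)" "g (w + T)"]
            dist_triangle[of "g (w + T)" "g (u - t * a)" "g w"] by (simp add: dist_commute)
        ultimately show ?thesis by linarith
      qed
    qed auto
  next
    case False
    show ?thesis
    proof (rule key[of "\<lambda>t. sig p p (t * a / m)" "\<lambda>t. g (u + t * a)"])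
      have "lgeo ((a / m - 0) * m) (\<lambda>t. sig p p (0 + t * (a / m - 0)))"
        using am by (intro lgeo_sub[OF c]) auto
      then show "lgeo a (\<lambda>t. sig p p (t * a / m))" using m by simp
      have in2: "u + t * a \<in> {-a..a}" if "t \<in> {0..1}" for t
        using scale(3,4)[OF that] False u unfolding atLeastAtMost_iff by linarith
      show "\<exists>v\<in>{-a..a}. g (u + t * a) = g v" if "t \<in> {0..1}" for t using in2[OF that] by blast
      show "dist (g (u + s * a)) (g (u + t * a)) = a * \<bar>s - t\<bar>" if "s \<in> {0..1}" "t \<in> {0..1}" for s t
      proof -
        have "dist (g (u + s * a)) (g (u + t * a)) = \<bar>(u + s * a) - (u + t * a)\<bar>"
          using in2[OF that(1)] in2[OF that(2)] a by (intro iso) auto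
        also have "(u + s * a) - (u + t * a) = a * (s - t)" by (simp add: algebra_simps)
        finally show ?thesis using a by (simp add: abs_mult)
      qed
      show "dist (g (u + t * a)) (sig p p (t * a / m)) \<le> h + 3 * \<delta>" if "t \<in> {0..1}" for t
      proof -
        note sc = scale[OF that]
        define w where "w = u + t * a / m * T"
        have w: "\<bar>w - (u + t * a)\<bar> \<le> \<delta>" using drift[OF sc(3,4)] unfolding w_def by simp
        have "-2*a \<le> x" if "\<bar>x - y\<bar> \<le> \<delta>" "y \<in> {-a..a}" for x y
          using that \<delta> a unfolding atLeastAtMost_iff abs_le_iff by linarith
        from this[OF w in2[OF that]] have w2: "-2*a \<le> w" .
        have "dist (sig p p (t * a / m)) (g w) \<le> h + \<delta>"
          using loop_near(2)[OF u p, of "t * a / m"] sc unfolding w_def by auto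
        moreover have "dist (g w) (g (u + t * a)) \<le> \<delta>"
          using g_dist_le[of w "u + t * a"] w w2 in2[OF that] a by auto
        ultimately show ?thesis
          using dist_triangle[of "sig p p (t * a / m)" "g (u + t * a)" "g w"] \<delta>(1) by (simp add: dist_commute)
      qed
    qed auto
  qed
qed

lemma closed_geodesic_near:
  assumes \<epsilon>: "4 * a < \<epsilon>"
  shows "\<exists>c. closed_geodesic c \<and> (\<forall>t\<in>{0..period c}. dist (c t) (g (t - 2 * a)) < \<epsilon>)"
proof -
  obtain p u where u: "u \<in> {-a..a}" and p': "dist p (g u) < h"
    and min: "\<And>q v. v \<in> {-a..a} \<Longrightarrow> dist q (g v) \<le> h \<Longrightarrow> len p p \<le> len q q"
    by (rule interior_minimal_loop) blast
  have p: "dist p (g u) \<le> h" using p' by simp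
  define m where "m = len p p"
  note pb = near_ball(2)[OF u p]
  note c = sig_lgeo[OF pb pb, folded m_def]
  note ends = sig_ends[OF pb pb]
  have mT: "\<bar>m - T\<bar> \<le> 2 * h + \<delta>" using loop_near(1)[OF u p] by (simp add: m_def)
  have m: "0 < m" using mT T_large \<delta> a by linarith
  \<comment> \<open>The slack in the strict inequality: for \<open>s \<le> k / (4 * m)\<close> the
    shortcut below moves the base point by at most \<open>k / 2\<close>.\<close>
  define k where "k = h - dist p (g u)"
  have k: "0 < k" "k \<le> h" using p' by (auto simp: k_def)
  define s0 where "s0 = min (1/2) (k / (4 * m))"
  have s0: "0 < s0" "s0 \<le> 1/2" "s0 \<le> k / (4 * m)" using k m by (auto simp: s0_def)
  \<comment> \<open>Cutting the corner: for the midpoint \<open>q\<close> of \<open>x\<close> and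
    \<open>y\<close>, \<open>len q q\<close> is at most \<open>(1 - 2 * s) * m + dist x y\<close>.
    Minimality then makes \<open>dist x y\<close> at least as long as the way through
    \<open>p\<close>.\<close>
  have joint: "dist (sig p p s) (sig p p (1 - s)) = 2 * s * m" if s: "0 < s" "s \<le> s0" for s
  proof -
    have "s \<le> k / (4 * m)" using s s0 by linarith
    then have sm: "4 * (s * m) \<le> k" using m by (simp add: le_divide_eq mult_ac)
    have s1: "s \<le> 1 - s" using s s0 by linarith
    have near: "dist p (sig p p w) \<le> s * m" if "0 \<le> w \<and> w \<le> s \<or> 1 - s \<le> w \<and> w \<le> 1" for w
    proof -
      have w01: "w \<in> {0..1}" using that s s0 by auto
      have "dist p (sig p p w) \<le> m * s"
      proof (cases "w \<le> s")
        case True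
        have "dist (sig p p 0) (sig p p w) \<le> m * \<bar>0 - w\<bar>" using w01 by (intro lgeo_dist_le[OF c]) auto
        also have "\<dots> \<le> m * s" using True w01 m by (intro mult_left_mono) auto
        finally show ?thesis by (simp add: ends)
      next
        case False
        have "dist (sig p p 1) (sig p p w) \<le> m * \<bar>1 - w\<bar>" using w01 by (intro lgeo_dist_le[OF c]) auto
        also have "\<dots> \<le> m * s" using False that w01 m by (intro mult_left_mono) auto
        finally show ?thesis by (simp add: ends)
      qed
      then show ?thesis by (simp add: mult.commute)
    qed
    have inball: "z \<in> ball (g 0) (6 * a)" if "dist p z \<le> s * m" for z
      using near_ball(1)[OF u p] dist_triangle[of "g 0" z p] that sm k a by auto
    define x y where "x = sig p p s" and "y = sig p p (1 - s)"
    have lxy: "len x y = (1 - s - s) * m"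
      unfolding x_def y_def m_def using s s1 near by (intro sig_sub(2)[OF pb pb]) (auto intro: inball simp del: mem_ball)
    have px: "dist p x \<le> s * m" and py: "dist p y \<le> s * m" unfolding x_def y_def using near s s1 by auto
    define q where "q = G x y (1/2)"
    have q: "dist x q = dist x y / 2" "dist q y = dist x y / 2"
      using dist_G[of 0 "1/2" x y] dist_G[of "1/2" 1 x y] by (simp_all add: q_def)
    have xy: "dist x y \<le> 2 * (s * m)" using dist_triangle3[of x y p] px py by simp
    have "dist q (g u) < h"
      using dist_triangle[of q "g u" p] dist_triangle[of p q x] px q xy sm k by (simp add: k_def dist_commute)
    then have mq: "m \<le> len q q" and qb: "q \<in> ball (g 0) (6 * a)"
      using min[OF u] near_ball(2)[OF u] by (simp_all add: m_def)
    have "\<bar>len x y - len q q\<bar> \<le> dist x q + dist y q"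
      by (rule len_diff[OF inball[OF px] inball[OF py] qb qb])
    then have "2 * (s * m) \<le> dist x y" using mq q unfolding lxy by (simp add: dist_commute algebra_simps)
    with xy show ?thesis unfolding x_def y_def by simp
  qed
  define c where "c t = sig p p (frac (t / m))" for t
  have closed: "closed_geodesic c" and per: "is_period c m"
    using closed_geodesic_of_loop[OF \<open>lgeo m (sig p p)\<close> m _ s0(1,2) joint] ends unfolding c_def[abs_def] by auto
  \<comment> \<open>The loop follows \<open>g\<close> from time \<open>u\<close>, the claim starts
    at \<open>-2 * a\<close>. As \<open>u \<le> a\<close>, this shift costs at most
    \<open>3 * a\<close>; the other errors add up to \<open>3 * h + 2 * \<delta>\<close>, less than
    \<open>a\<close>.\<close>
  have "dist (c t) (g (t - 2 * a)) < \<epsilon>" if "t \<in> {0..period c}" for t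
  proof -
    have t: "0 \<le> t" "t \<le> m" using that period_le[OF per] by auto
    have x: "t / m \<in> {0..1}" using t m by (auto simp: divide_le_eq)
    have ct: "c t = sig p p (t / m)"
    proof (cases "t = m")
      case True
      then show ?thesis using m ends by (simp add: c_def)
    next
      case False
      then have "frac (t / m) = t / m" using t m by (simp add: frac_eq divide_less_eq)
      then show ?thesis by (simp add: c_def)
    qed
    have 1: "dist (c t) (g (u + t / m * T)) \<le> h + \<delta>" unfolding ct by (rule loop_near(2)[OF u p x])
    have "\<bar>t / m * T - t\<bar> \<le> 2 * h + \<delta>"
    proof -
      have "t / m * T - t = t / m * (T - m)" using m by (simp add: field_simps)
      also have "\<bar>\<dots>\<bar> = t / m * \<bar>m - T\<bar>" unfolding abs_mult using x by (simp only: abs_minus_commute[of T m] atLeastAtMost_iff abs_of_nonneg)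
      also have "\<dots> \<le> 1 * \<bar>m - T\<bar>" using x by (intro mult_right_mono) auto
      finally show ?thesis using mT by simp
    qed
    moreover have "0 \<le> t / m * T" using x T_large by (intro mult_nonneg_nonneg) auto
    ultimately have "dist (g (u + t / m * T)) (g (t - 2 * a)) \<le> 2 * h + \<delta> + 3 * a"
      using g_dist_le[of "u + t / m * T" "t - 2 * a"] u t a by (simp add: abs_le_iff) linarith
    with 1 show ?thesis
      using dist_triangle[of "c t" "g (t - 2 * a)" "g (u + t / m * T)"] \<epsilon> \<delta> a by simp
  qed
  with closed show ?thesis by blast
qed

end

section \<open>Choice of the constants and conclusion\<close>

context complete_geodesic
begin

lemma recurrent_imp_close_closed_geodesic:
  fixes \<gamma> :: "real \<Rightarrow> 'a"
  assumes loc: "locally compact (UNIV :: 'a set)" and npc: "\<And>w::'a. \<exists>\<rho>>0. npc w \<rho>"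
    and I: "I = UNIV \<or> I = {0..}" and \<gamma>: "local_geodesic_on I \<gamma>" and rec: "recurrent_on I \<gamma>"
    and tx: "tx \<in> I" and \<epsilon>: "0 < \<epsilon>"
  shows "\<exists>c. closed_geodesic c \<and> (\<forall>t\<in>{0..period c}. dist (c t) (\<gamma> (t + tx)) < \<epsilon>)"
proof -
  have Iup: "t \<in> I" if "tx \<le> t" for t using I tx that by auto
  obtain e1 where "0 < e1" "isometric_embedding_on UNIV dist ({tx - e1..tx + e1} \<inter> I) \<gamma>"
    using \<gamma> tx unfolding local_geodesic_on_def by blast
  then have e1: "0 < e1" "\<And>s t. s \<in> {tx - e1..tx + e1} \<inter> I \<Longrightarrow> t \<in> {tx - e1..tx + e1} \<inter> I \<Longrightarrow> dist (\<gamma> s) (\<gamma> t) = \<bar>s - t\<bar>"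
    unfolding isometric_embedding_on_def by auto
  obtain \<rho>1 where \<rho>1: "0 < \<rho>1" "npc (\<gamma> tx) \<rho>1" using npc by blast
  \<comment> \<open>\<open>4 * a \<le> e1\<close> makes \<open>\<gamma>\<close> isometric on
    \<open>{tx..tx + 4 * a}\<close>; \<open>5 * a \<le> \<epsilon>\<close> serves the final
    estimate; \<open>14 * a\<close> is the radius \<open>12 * a\<close> of the convex ball around
    \<open>g 0\<close> plus the distance \<open>2 * a\<close> of \<open>g 0\<close> from
    \<open>\<gamma> tx\<close>.\<close>
  define a where "a = min (e1 / 4) (min (\<epsilon> / 5) (\<rho>1 / 14))"
  have a: "0 < a" "4 * a \<le> e1" "4 * a < \<epsilon>" "14 * a \<le> \<rho>1" using e1 \<epsilon> \<rho>1 by (auto simp: a_def min_def)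
  \<comment> \<open>The shift by \<open>2 * a\<close> turns the window \<open>{-2*a..2*a}\<close>
    into \<open>{tx..tx + 4 * a}\<close>, which lies in \<open>I\<close> even for a ray starting at
    \<open>tx\<close>.\<close>
  define g where "g s = \<gamma> (tx + 2 * a + s)" for s
  have iso: "dist (g s) (g t) = \<bar>s - t\<bar>" if "s \<in> {-2*a..2*a}" "t \<in> {-2*a..2*a}" for s t
    using e1(2)[of "tx + 2 * a + s" "tx + 2 * a + t"] that a Iup by (auto simp: g_def)
  have lg: "lgeo (t - s) (\<lambda>u. g (s + u * (t - s)))" if "-2*a \<le> s" "s < t" for s t
  proof -
    have "{tx + 2 * a + s..tx + 2 * a + t} \<subseteq> I" using that Iup by auto
    then show ?thesis
      using local_geodesic_imp_lgeo[OF \<gamma>, of "tx + 2 * a + s" "tx + 2 * a + t"] that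
      by (simp add: g_def add.assoc)
  qed
  have npc0: "npc (g 0) (2 * (6 * a))"
  proof (rule npc_subset[OF \<rho>1(2)])
    have "dist (\<gamma> tx) (g 0) = 2 * a" using iso[of "-2*a" 0] a by (simp add: g_def)
    then have "dist (\<gamma> tx) z < \<rho>1" if "dist (g 0) z < 2 * (6 * a)" for z
      using dist_triangle[of "\<gamma> tx" z "g 0"] a that by linarith
    then show "ball (g 0) (2 * (6 * a)) \<subseteq> ball (\<gamma> tx) \<rho>1" by auto
  qed
  have cpt: "compact (cball (g 0) R)" for R by (rule compact_cball_geodesic[OF loc])
  have "5 * a < 6 * a" "0 < a / 16" "a / 16 < a / 2" using a by auto
  then obtain \<eta> where \<eta>: "0 < \<eta>" "no_strip (g 0) (5 * a) (2 * (a / 2)) (a / 16) \<eta>"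
    using no_strip_exists[OF npc0 cpt] by metis
  define \<delta> where "\<delta> = min (a / 16) (\<eta> / 3)"
  have \<delta>: "0 < \<delta>" "\<delta> \<le> a / 16" "3 * \<delta> \<le> \<eta>" using a \<eta> by (auto simp: \<delta>_def)
  obtain T where T: "2 * a + a * a / \<delta> \<le> T" "\<And>s. s \<in> {-2*a..2*a} \<Longrightarrow> dist (g (s + T)) (g s) < \<delta>"
  proof -
    obtain \<tau> :: "nat \<Rightarrow> real" where \<tau>: "filterlim \<tau> at_top sequentially"
      "\<And>K. compact K \<Longrightarrow> K \<subseteq> I \<Longrightarrow> uniform_limit K (\<lambda>n. geodesic_flow (\<tau> n) \<gamma>) \<gamma> sequentially"
      using rec unfolding recurrent_on_def by blast
    have "uniform_limit {tx..tx + 4 * a} (\<lambda>n. geodesic_flow (\<tau> n) \<gamma>) \<gamma> sequentially"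
      using Iup by (intro \<tau>(2)) auto
    then have "\<forall>\<^sub>F n in sequentially. \<forall>x\<in>{tx..tx + 4 * a}. dist (geodesic_flow (\<tau> n) \<gamma> x) (\<gamma> x) < \<delta>"
      using \<delta>(1) by (rule uniform_limitD)
    moreover have "\<forall>\<^sub>F n in sequentially. 2 * a + a * a / \<delta> \<le> \<tau> n"
      using \<tau>(1) unfolding filterlim_at_top by blast
    ultimately have "\<forall>\<^sub>F n in sequentially. (\<forall>x\<in>{tx..tx + 4 * a}. dist (geodesic_flow (\<tau> n) \<gamma> x) (\<gamma> x) < \<delta>) \<and> 2 * a + a * a / \<delta> \<le> \<tau> n"
      by (rule eventually_conj)
    then obtain n where n: "\<And>x. x \<in> {tx..tx + 4 * a} \<Longrightarrow> dist (\<gamma> (x + \<tau> n)) (\<gamma> x) < \<delta>" "2 * a + a * a / \<delta> \<le> \<tau> n"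
      unfolding eventually_sequentially geodesic_flow_def by blast
    show thesis
    proof (rule that[OF n(2)])
      fix s assume "s \<in> {-2*a..2*a}"
      then show "dist (g (s + \<tau> n)) (g s) < \<delta>" using n(1)[of "tx + 2 * a + s"] by (simp add: g_def add.assoc)
    qed
  qed
  have T2: "2 * a \<le> T" "0 < T"
  proof -
    have "0 \<le> a * a / \<delta>" using a \<delta> by simp
    then show "2 * a \<le> T" "0 < T" using T a by linarith+
  qed
  \<comment> \<open>Only now, with \<open>T\<close> known, can a convexity radius be fixed; the ball
    contains every point within \<open>12 * a\<close> of the segment of length
    \<open>T\<close>.\<close>
  obtain r where r: "0 < r" "\<And>z. z \<in> cball (g 0) (T + 12 * a) \<Longrightarrow> npc z r"
    using uniform_npc[OF cpt npc] by metis
  obtain K :: nat where K: "32 * (6 * a) / r < K" using reals_Archimedean2 by blast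
  interpret closing_tube G T g a r K \<delta> \<eta>
  proof
    show c0: "lgeo T (\<lambda>t. g (t * T))" using lg[of 0 T] T2 a by simp
    show "npc (g 0) (2 * (6 * a))" by (rule npc0)
    show "g (0 * T) \<in> ball (g 0) (6 * a)" using a by simp
    have "dist (g (0 + T)) (g 0) < \<delta>" using a by (intro T(2)) auto
    then show "g (1 * T) \<in> ball (g 0) (6 * a)" using \<delta> a by (simp add: dist_commute)
    show "npc z r" if "t \<in> {0..1}" "dist (g (t * T)) z \<le> 2 * (6 * a)" for t z
    proof (rule r(2))
      have "dist (g (0 * T)) (g (t * T)) \<le> T * \<bar>0 - t\<bar>" using that by (intro lgeo_dist_le[OF c0]) auto
      also have "\<dots> \<le> T * 1" using that T2 by (intro mult_left_mono) auto
      finally show "z \<in> cball (g 0) (T + 12 * a)" using that(2) dist_triangle[of "g 0" z "g (t * T)"] by simp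
    qed
    show "0 < r" by (rule r(1))
    show "32 * (6 * a) < real K * r" using K r by (simp add: divide_less_eq)
    show "0 < a" by (rule a)
    show "dist (g s) (g t) = \<bar>s - t\<bar>" if "s \<in> {-2*a..2*a}" "t \<in> {-2*a..2*a}" for s t using iso[OF that] .
    show "lgeo (t - s) (\<lambda>u. g (s + u * (t - s)))" if "-2*a \<le> s" "s < t" for s t using lg[OF that] .
    show "dist (g (s + T)) (g s) < \<delta>" if "s \<in> {-2*a..2*a}" for s using T(2)[OF that] .
    show "0 < \<delta>" "\<delta> \<le> a / 16" "3 * \<delta> \<le> \<eta>" by (fact \<delta>)+
    show "2 * a + a * a / \<delta> \<le> T" by (fact T(1))
    show "compact (cball (g 0) (5 * a))" by (rule cpt)
    show "no_strip (g 0) (5 * a) a (a / 16) \<eta>" using \<eta>(2) by simp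
  qed
  obtain c where "closed_geodesic c" "\<And>t. t \<in> {0..period c} \<Longrightarrow> dist (c t) (g (t - 2 * a)) < \<epsilon>"
    using closed_geodesic_near[OF \<open>4 * a < \<epsilon>\<close>] by blast
  then show ?thesis by (intro exI[of _ c]) (auto simp: g_def add.commute)
qed

end

theorem theorem2:
  fixes \<kappa> :: real and \<gamma> :: "real \<Rightarrow> 'a::metric_space" and I :: "real set"
  assumes "\<kappa> < 0"
    and "locally compact (UNIV :: 'a set)"
    and "complete (UNIV :: 'a set)"
    and "geodesic_space TYPE('a)"
    and "curvature_le TYPE('a) \<kappa>"
    and "I = UNIV \<or> I = {0..}"
    and "local_geodesic_on I \<gamma>"
    and "recurrent_on I \<gamma>"
  shows "approximated_by_closed_geodesics I \<gamma>"
proof -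
  have "\<exists>c. ageo c x y" for x y :: 'a
    using assms(4) geodesic_segment_imp_ageo unfolding geodesic_space_def by blast
  then obtain G :: "'a \<Rightarrow> 'a \<Rightarrow> real \<Rightarrow> 'a" where "\<And>x y. ageo (G x y) x y" by metis
  then interpret complete_geodesic G using assms(3) by unfold_locales
  show ?thesis unfolding approximated_by_closed_geodesics_def
  proof (intro allI impI ballI)
    fix \<epsilon> :: real and x t\<^sub>x assume "0 < \<epsilon>" "t\<^sub>x \<in> I"
    then obtain c where c: "closed_geodesic c" "\<And>t. t \<in> {0..period c} \<Longrightarrow> dist (c t) (\<gamma> (t + t\<^sub>x)) < \<epsilon>"
      using recurrent_imp_close_closed_geodesic[OF assms(2) curvature_le_imp_npc[OF assms(1,4,5)] assms(6-8)] by blast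
    then show "\<exists>c. closed_geodesic c \<and> (\<exists>y\<in>range c. \<exists>t\<^sub>y. y = c t\<^sub>y \<and>
              (\<forall>t\<in>{0..period c}. dist (c (t + t\<^sub>y)) (\<gamma> (t + t\<^sub>x)) < \<epsilon>))"
      by (intro exI[of _ c] conjI bexI[of _ "c 0"] exI[of _ 0]) auto
  qed
qed

end
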